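(* Let $k$ be a field of characteristic zero and $G$ a finite group. Let $I(G)$ be the two-sided ideal of $kB(G,G)$ spanned by the $(G,G)$-bisets $(G\times G)/(A\times B)$ for $A,B\le G$ (equivalently, generated by all $(G,G)$-bisets that factor through the trivial group), and let $I_c(G)$ be the $k$-subspace of $I(G)$ spanned by the elements $(G\times G)/(A\times B)$ with $A$ and $B$ cyclic subgroups of $G$. Let $M$ be the kernel of the action of $kB(G,G)$ on the simple module $S_{1,k}(G)$ (a maximal two-sided ideal). Then: (1) $kB(G,G)=I_c(G)\oplus M$; (2) $I(G)=I_c(G)\oplus\big(I(G)\cap J(kB(G,G))\big)$; (3) $\dim\big(I(G)\cap J(kB(G,G))\big)=b(G)^2-c(G)^2$, where $b(G)$ is the number of conjugacy classes of subgroups of $G$ and $c(G)$ the number of conjugacy classes of cyclic subgroups of $G$.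
   Context: $(G,H)$-bisets are finite sets with commuting left $G$- and right $H$-actions; $kB(G,H)=k\otimes_{\mathbb Z}B(G,H)$ with $B(G,H)$ the Grothendieck group; composition $U\times_HV=(U\times V)/((uh,v)\sim(u,hv))$; $kB(G,G)$ is the double Burnside algebra; $(G\times G)/(A\times B)$ denotes the $(G,G)$-biset $G\times G$ modulo $A\times B$, with $(G,G)$-action $g\cdot(x,y)\cdot g'=(gx,g'^{-1}y)$. Biset functors are $k$-linear functors from the category of finite groups with $\mathrm{Hom}(H,G)=kB(G,H)$ to $k$-vector spaces. For the trivial group $1$ and trivial module $k$: $L_{1,k}=kB(-,1)\otimes_k k$, $J_{1,k}(X)=\{x\in L_{1,k}(X):\psi\cdot x=0\ \forall\psi\in kB(1,X)\}$, $S_{1,k}=L_{1,k}/J_{1,k}$, a simple biset functor; $S_{1,k}(G)$ is a simple $kB(G,G)$-module (isomorphic to $k\otimes R_{\mathbb Q}(G)$, of dimension $c(G)$). $J(\cdot)$ denotes Jacobson radical. *)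

theory Defs
  imports "HOL-Algebra.Algebra"
begin

definition sg_conj :: "('p,'m) monoid_scheme \<Rightarrow> 'p set \<Rightarrow> 'p set \<Rightarrow> bool" where
  "sg_conj P L L' \<longleftrightarrow> (\<exists>x\<in>carrier P. L' = (\<lambda>l. x \<otimes>\<^bsub>P\<^esub> l \<otimes>\<^bsub>P\<^esub> inv\<^bsub>P\<^esub> x) ` L)"

definition sg_classes :: "('p,'m) monoid_scheme \<Rightarrow> 'p set set set" where
  "sg_classes P = {{L'. sg_conj P L L'} | L. subgroup L P}"

definition cyclic_sg :: "('p,'m) monoid_scheme \<Rightarrow> 'p set \<Rightarrow> bool" where
  "cyclic_sg P A \<longleftrightarrow> (\<exists>a\<in>carrier P. A = generate P {a})"

definition num_b :: "('p,'m) monoid_scheme \<Rightarrow> nat" where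
  "num_b P = card {{L'. sg_conj P L L'} | L. subgroup L P}"

definition num_c :: "('p,'m) monoid_scheme \<Rightarrow> nat" where
  "num_c P = card {{L'. sg_conj P L L'} | L. subgroup L P \<and> cyclic_sg P L}"

definition rep :: "'x set \<Rightarrow> 'x" where
  "rep C = (SOME L. L \<in> C)"

definition triv :: "unit monoid" where
  "triv = \<lparr>carrier = {()}, monoid.mult = (\<lambda>_ _. ()), one = ()\<rparr>"

text \<open>A (G,H)-biset is given by a finite carrier X and an action act g x h = g.x.h.
  Orbits and stabilisers; the stabiliser of x is the subgroup of G x H of pairs
  (g,h) with g.x.h^-1 = x, so that the orbit of x is isomorphic to (G x H)/stab(x).\<close>
definition biset_orbit :: "('a,'m) monoid_scheme \<Rightarrow> ('b,'n) monoid_scheme \<Rightarrow>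
    ('a \<Rightarrow> 'x \<Rightarrow> 'b \<Rightarrow> 'x) \<Rightarrow> 'x \<Rightarrow> 'x set" where
  "biset_orbit G H act x = {act g x h | g h. g \<in> carrier G \<and> h \<in> carrier H}"

definition biset_stab :: "('a,'m) monoid_scheme \<Rightarrow> ('b,'n) monoid_scheme \<Rightarrow>
    ('a \<Rightarrow> 'x \<Rightarrow> 'b \<Rightarrow> 'x) \<Rightarrow> 'x \<Rightarrow> ('a \<times> 'b) set" where
  "biset_stab G H act x = {(g,h). g \<in> carrier G \<and> h \<in> carrier H \<and> act g x (inv\<^bsub>H\<^esub> h) = x}"

text \<open>The class [X] in kB(G,H) of a biset X, as a function on subgroups L of G x H:
  the number of transitive summands (orbits) of X isomorphic to (G x H)/L.\<close>
definition biset_class :: "('a,'m) monoid_scheme \<Rightarrow> ('b,'n) monoid_scheme \<Rightarrow> 'x set \<Rightarrow>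
    ('a \<Rightarrow> 'x \<Rightarrow> 'b \<Rightarrow> 'x) \<Rightarrow> ('a \<times> 'b) set \<Rightarrow> 'k::semiring_1" where
  "biset_class G H Xs act = (\<lambda>L. if subgroup L (G \<times>\<times> H) then
      of_nat (card {Orb \<in> biset_orbit G H act ` Xs.
                    \<exists>x\<in>Orb. sg_conj (G \<times>\<times> H) L (biset_stab G H act x)}) else 0)"

definition coset_carrier :: "('a,'m) monoid_scheme \<Rightarrow> ('b,'n) monoid_scheme \<Rightarrow>
    ('a \<times> 'b) set \<Rightarrow> ('a \<times> 'b) set set" where
  "coset_carrier G H L = {z <#\<^bsub>G \<times>\<times> H\<^esub> L | z. z \<in> carrier (G \<times>\<times> H)}"

definition coset_act :: "('a,'m) monoid_scheme \<Rightarrow> ('b,'n) monoid_scheme \<Rightarrow>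
    'a \<Rightarrow> ('a \<times> 'b) set \<Rightarrow> 'b \<Rightarrow> ('a \<times> 'b) set" where
  "coset_act G H g C h = (\<lambda>(x,y). (g \<otimes>\<^bsub>G\<^esub> x, inv\<^bsub>H\<^esub> h \<otimes>\<^bsub>H\<^esub> y)) ` C"

text \<open>Composition U x_H V = (U x V)/((uh,v) ~ (u,hv)); the equivalence classes are
  exactly the sets {(uh, h^-1 v) | h in H}. Action g.[(u,v)].k = [(gu, vk)].\<close>
definition comp_carrier :: "('a,'m) monoid_scheme \<Rightarrow> ('b,'n) monoid_scheme \<Rightarrow> ('c,'o) monoid_scheme \<Rightarrow>
    'u set \<Rightarrow> ('a \<Rightarrow> 'u \<Rightarrow> 'b \<Rightarrow> 'u) \<Rightarrow> 'v set \<Rightarrow> ('b \<Rightarrow> 'v \<Rightarrow> 'c \<Rightarrow> 'v) \<Rightarrow> ('u \<times> 'v) set set" where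
  "comp_carrier G H K XU actU XV actV =
     (\<lambda>(u,v). {(actU \<one>\<^bsub>G\<^esub> u h, actV (inv\<^bsub>H\<^esub> h) v \<one>\<^bsub>K\<^esub>) | h. h \<in> carrier H}) ` (XU \<times> XV)"

definition comp_act :: "('a,'m) monoid_scheme \<Rightarrow> ('b,'n) monoid_scheme \<Rightarrow> ('c,'o) monoid_scheme \<Rightarrow>
    ('a \<Rightarrow> 'u \<Rightarrow> 'b \<Rightarrow> 'u) \<Rightarrow> ('b \<Rightarrow> 'v \<Rightarrow> 'c \<Rightarrow> 'v) \<Rightarrow> 'a \<Rightarrow> ('u \<times> 'v) set \<Rightarrow> 'c \<Rightarrow> ('u \<times> 'v) set" where
  "comp_act G H K actU actV g c k = (\<lambda>(u,v). (actU g u \<one>\<^bsub>H\<^esub>, actV \<one>\<^bsub>H\<^esub> v k)) ` c"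

text \<open>kB(G,H) = k tensor B(G,H): k-valued functions on subgroups of G x H which are
  constant on conjugacy classes (coordinates w.r.t. the basis of transitive bisets).\<close>
definition kB :: "('a,'m) monoid_scheme \<Rightarrow> ('b,'n) monoid_scheme \<Rightarrow> (('a \<times> 'b) set \<Rightarrow> 'k::field) set" where
  "kB G H = {f. (\<forall>L. \<not> subgroup L (G \<times>\<times> H) \<longrightarrow> f L = 0) \<and>
                (\<forall>L L'. subgroup L (G \<times>\<times> H) \<longrightarrow> sg_conj (G \<times>\<times> H) L L' \<longrightarrow> f L = f L')}"

definition tr :: "('a,'m) monoid_scheme \<Rightarrow> ('b,'n) monoid_scheme \<Rightarrow> ('a \<times> 'b) set \<Rightarrow> (('a \<times> 'b) set \<Rightarrow> 'k::field)" where
  "tr G H L = biset_class G H (coset_carrier G H L) (coset_act G H)"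

definition bcomp :: "('a,'m) monoid_scheme \<Rightarrow> ('b,'n) monoid_scheme \<Rightarrow> ('c,'o) monoid_scheme \<Rightarrow>
    (('a \<times> 'b) set \<Rightarrow> 'k::field) \<Rightarrow> (('b \<times> 'c) set \<Rightarrow> 'k) \<Rightarrow> (('a \<times> 'c) set \<Rightarrow> 'k)" where
  "bcomp G H K f f' = (\<lambda>M. \<Sum>C\<in>sg_classes (G \<times>\<times> H). \<Sum>D\<in>sg_classes (H \<times>\<times> K).
      f (rep C) * f' (rep D) *
      biset_class G K
        (comp_carrier G H K (coset_carrier G H (rep C)) (coset_act G H)
                            (coset_carrier H K (rep D)) (coset_act H K))
        (comp_act G H K (coset_act G H) (coset_act H K)) M)"

definition lin_span :: "('x \<Rightarrow> 'k::field) set \<Rightarrow> ('x \<Rightarrow> 'k) set" where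
  "lin_span S = {f. \<exists>F c. finite F \<and> F \<subseteq> S \<and> f = (\<lambda>x. \<Sum>s\<in>F. c s * s x)}"

definition lin_indep :: "('x \<Rightarrow> 'k::field) set \<Rightarrow> bool" where
  "lin_indep S \<longleftrightarrow> (\<forall>F c. finite F \<and> F \<subseteq> S \<and> (\<lambda>x. \<Sum>s\<in>F. c s * s x) = (\<lambda>_. 0)
                      \<longrightarrow> (\<forall>s\<in>F. c s = 0))"

definition has_dim :: "('x \<Rightarrow> 'k::field) set \<Rightarrow> nat \<Rightarrow> bool" where
  "has_dim V n \<longleftrightarrow> (\<exists>B. finite B \<and> B \<subseteq> V \<and> lin_indep B \<and> lin_span B = V \<and> card B = n)"

definition is_direct_sum :: "('x \<Rightarrow> 'k::field) set \<Rightarrow> ('x \<Rightarrow> 'k) set \<Rightarrow> ('x \<Rightarrow> 'k) set \<Rightarrow> bool" where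
  "is_direct_sum V U W \<longleftrightarrow> U \<inter> W = {\<lambda>_. 0} \<and> V = {(\<lambda>x. u x + w x) | u w. u \<in> U \<and> w \<in> W}"

definition left_ideal :: "('a,'m) monoid_scheme \<Rightarrow> (('a \<times> 'a) set \<Rightarrow> 'k::field) set \<Rightarrow> bool" where
  "left_ideal G I \<longleftrightarrow> I \<subseteq> kB G G \<and> (\<lambda>_. 0) \<in> I \<and>
     (\<forall>x\<in>I. \<forall>y\<in>I. (\<lambda>L. x L + y L) \<in> I) \<and> (\<forall>c. \<forall>x\<in>I. (\<lambda>L. c * x L) \<in> I) \<and>
     (\<forall>a\<in>kB G G. \<forall>x\<in>I. bcomp G G G a x \<in> I)"

definition maximal_left_ideal :: "('a,'m) monoid_scheme \<Rightarrow> (('a \<times> 'a) set \<Rightarrow> 'k::field) set \<Rightarrow> bool" where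
  "maximal_left_ideal G I \<longleftrightarrow> left_ideal G I \<and> I \<noteq> kB G G \<and>
     (\<forall>I'. left_ideal G I' \<and> I \<subseteq> I' \<longrightarrow> I' = I \<or> I' = kB G G)"

definition jac :: "('a,'m) monoid_scheme \<Rightarrow> (('a \<times> 'a) set \<Rightarrow> 'k::field) set" where
  "jac G = kB G G \<inter> \<Inter>{I. maximal_left_ideal G I}"

definition ideal_I :: "('a,'m) monoid_scheme \<Rightarrow> (('a \<times> 'a) set \<Rightarrow> 'k::field) set" where
  "ideal_I G = lin_span {tr G G (A \<times> B) | A B. subgroup A G \<and> subgroup B G}"

definition ideal_Ic :: "('a,'m) monoid_scheme \<Rightarrow> (('a \<times> 'a) set \<Rightarrow> 'k::field) set" where
  "ideal_Ic G = lin_span {tr G G (A \<times> B) | A B. cyclic_sg G A \<and> cyclic_sg G B}"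

text \<open>J_{1,k}(G) inside L_{1,k}(G) = kB(G,1), and the kernel M of the action of
  kB(G,G) on S_{1,k}(G) = L_{1,k}(G)/J_{1,k}(G).\<close>
definition J1 :: "('a,'m) monoid_scheme \<Rightarrow> (('a \<times> unit) set \<Rightarrow> 'k::field) set" where
  "J1 G = {x \<in> kB G triv. \<forall>\<psi>\<in>kB triv G. bcomp triv G triv \<psi> x = (\<lambda>_. 0)}"

definition ker_S1 :: "('a,'m) monoid_scheme \<Rightarrow> (('a \<times> 'a) set \<Rightarrow> 'k::field) set" where
  "ker_S1 G = {a \<in> kB G G. \<forall>x\<in>kB G triv. bcomp G G triv a x \<in> J1 G}"

end

(*
  Sending a (G,H)-biset U to the function (g,h) |-> #{u. g u h^-1 = u} turns composition of
  bisets into a matrix product: the fixed points of the quotient U x_H V are counted by a twisted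
  Burnside lemma. Hence kB(G,G) acts on functions on G. The permutation characters of the G/A span
  the functions that depend only on the conjugacy class of the cyclic subgroup generated by the
  argument; by triangularity, the G/C with C cyclic give a basis of this space, on which the
  pairing is nondegenerate. So this space is the simple module S(G), M is the kernel of the action
  on it, and I_c(G) maps isomorphically onto its endomorphism ring, which gives (1). On I(G) one
  has (G/A x G/B)(G/A' x G/B') = <G/B, G/A'> G/A x G/B'. Thus n (n n) = 0 for n in the
  intersection of I(G) and M, a left ideal which therefore lies in the Jacobson radical; conversely
  the radical lies in M because the annihilator of a nonzero element of S(G) is a maximal left
  ideal. Subtracting from each (G x G)/(A x B), with A and B not both cyclic, the element of I_c(G)
  with the same action yields the basis that proves (3).
*)
theory Submission
  imports Defs
begin

section \<open>Finite group actions\<close>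

text \<open>Biset characters see a biset only through cyclic subgroups of
  \<open>G \<times>\<times> H\<close>, so in general they do not determine an element of
  \<open>kB G H\<close>. Identities in the algebra itself must come from bisets: composing subgroups
  as relations gives the stabilisers in a composite, and characters only supply the scalar that is
  still missing. The power three has the same cause. That \<open>n\<close> kills S(G) is a statement
  about the characters of the G/A, not about the classes of the G/A in the algebra. In n n each
  factor keeps one side as a label of a basis element; only a factor standing between two others is
  reduced to characters on both sides. The radical argument runs on left multiplication with one
  fixed bracketing. With e the class of the diagonal, a right identity, and e = x + y, the geometric
  series y + x y + x (x y) equals e as soon as x (x x) = 0. Nondegeneracy of the pairing over an
  arbitrary k comes from the indicator functions of the classes of cyclic subgroups: they are
  orthogonal, and their weights are nonzero in characteristic zero.\<close>

lemma card_eq_mult_card_fibres: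
  assumes "finite Z" "finite F" "\<phi> ` Z \<subseteq> F" "\<And>y. y \<in> F \<Longrightarrow> card {z \<in> Z. \<phi> z = y} = n"
  shows "card Z = card F * n"
proof -
  have "card Z = (\<Sum>z\<in>Z. 1)" by simp
  also have "\<dots> = (\<Sum>y\<in>F. \<Sum>z\<in>{z \<in> Z. \<phi> z = y}. 1)"
    using sum.group[OF assms(1-3), of "\<lambda>_. 1::nat"] by simp
  also have "\<dots> = card F * n" using assms(4) by simp
  finally show ?thesis .
qed

locale fin_group = group P for P :: "('a,'m) monoid_scheme" (structure) +
  assumes fin: "finite (carrier P)"

lemma (in group) cancel_inv_left:
  "a \<in> carrier G \<Longrightarrow> x \<in> carrier G \<Longrightarrow> a \<otimes> (inv a \<otimes> x) = x"
  by (simp flip: m_assoc)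

lemma (in group) inv_cancel_left:
  "a \<in> carrier G \<Longrightarrow> x \<in> carrier G \<Longrightarrow> inv a \<otimes> (a \<otimes> x) = x"
  by (simp flip: m_assoc)

locale fin_action = fin_group P for P :: "('a,'m) monoid_scheme" (structure) +
  fixes E :: "'x set" and \<alpha> :: "'a \<Rightarrow> 'x \<Rightarrow> 'x"
  assumes fin_E: "finite E"
    and closed: "p \<in> carrier P \<Longrightarrow> x \<in> E \<Longrightarrow> \<alpha> p x \<in> E"
    and one_act: "x \<in> E \<Longrightarrow> \<alpha> \<one> x = x"
    and mult_act: "p \<in> carrier P \<Longrightarrow> q \<in> carrier P \<Longrightarrow> x \<in> E \<Longrightarrow> \<alpha> (p \<otimes> q) x = \<alpha> p (\<alpha> q x)"
begin

definition orb :: "'x \<Rightarrow> 'x set" where "orb x = (\<lambda>p. \<alpha> p x) ` carrier P"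
definition stab :: "'x \<Rightarrow> 'a set" where "stab x = {p \<in> carrier P. \<alpha> p x = x}"

lemma inv_act_iff:
  assumes "p \<in> carrier P" "x \<in> E" "y \<in> E"
  shows "\<alpha> (inv p) y = x \<longleftrightarrow> y = \<alpha> p x"
proof
  assume "\<alpha> (inv p) y = x"
  then have "\<alpha> p x = \<alpha> (p \<otimes> inv p) y" using assms mult_act[of p "inv p" y] by simp
  then show "y = \<alpha> p x" using assms one_act by simp
next
  assume "y = \<alpha> p x"
  then have "\<alpha> (inv p) y = \<alpha> (inv p \<otimes> p) x" using assms mult_act[of "inv p" p x] by simp
  then show "\<alpha> (inv p) y = x" using assms one_act by simp
qed

lemma orb_subset: "x \<in> E \<Longrightarrow> orb x \<subseteq> E"
  using closed by (auto simp: orb_def)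

lemma orb_refl: "x \<in> E \<Longrightarrow> x \<in> orb x"
  unfolding orb_def using one_act by (metis image_eqI one_closed)

lemma orb_eq:
  assumes "x \<in> E" "y \<in> orb x"
  shows "orb y = orb x"
proof -
  obtain p where p: "p \<in> carrier P" "y = \<alpha> p x" using assms(2) by (auto simp: orb_def)
  have 1: "\<alpha> q y = \<alpha> (q \<otimes> p) x" if "q \<in> carrier P" for q
    using p that assms mult_act by simp
  have 2: "\<alpha> q x = \<alpha> (q \<otimes> inv p) y" if "q \<in> carrier P" for q
  proof -
    have "\<alpha> (q \<otimes> inv p) y = \<alpha> (q \<otimes> inv p \<otimes> p) x" using p that assms mult_act[of "q \<otimes> inv p" p x] by simp
    also have "q \<otimes> inv p \<otimes> p = q" using p that by (simp add: m_assoc)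
    finally show ?thesis by simp
  qed
  show ?thesis
  proof
    show "orb y \<subseteq> orb x" unfolding orb_def using 1 p by (metis image_subsetI image_eqI m_closed)
    show "orb x \<subseteq> orb y" unfolding orb_def using 2 p by (metis image_subsetI image_eqI m_closed inv_closed)
  qed
qed

lemma orb_eq_iff: "x \<in> E \<Longrightarrow> y \<in> E \<Longrightarrow> orb y = orb x \<longleftrightarrow> y \<in> orb x"
  using orb_eq orb_refl by blast

lemma stab_subgroup:
  assumes "x \<in> E" shows "subgroup (stab x) P"
proof (rule subgroupI)
  show "stab x \<subseteq> carrier P" "stab x \<noteq> {}" using assms one_act by (auto simp: stab_def)
  show "inv a \<in> stab x" if "a \<in> stab x" for a
    using that assms inv_act_iff[of a x x] by (auto simp: stab_def)
  show "a \<otimes> b \<in> stab x" if "a \<in> stab x" "b \<in> stab x" for a b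
    using that assms mult_act[of a b x] by (auto simp: stab_def)
qed

lemma stab_act:
  assumes "x \<in> E" "p \<in> carrier P"
  shows "stab (\<alpha> p x) = (\<lambda>l. p \<otimes> l \<otimes> inv p) ` stab x"
proof (intro Set.set_eqI iffI)
  fix q assume "q \<in> stab (\<alpha> p x)"
  then have q: "q \<in> carrier P" "\<alpha> q (\<alpha> p x) = \<alpha> p x" by (auto simp: stab_def)
  have "\<alpha> (inv p \<otimes> q \<otimes> p) x = \<alpha> (inv p) (\<alpha> q (\<alpha> p x))"
    using assms q closed by (simp add: mult_act m_assoc)
  then have "inv p \<otimes> q \<otimes> p \<in> stab x" using assms q closed inv_act_iff[of p x "\<alpha> p x"] by (simp add: stab_def)
  moreover have "q = p \<otimes> (inv p \<otimes> q \<otimes> p) \<otimes> inv p"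
    using assms q by (simp add: m_assoc cancel_inv_left)
  ultimately show "q \<in> (\<lambda>l. p \<otimes> l \<otimes> inv p) ` stab x" by blast
next
  fix q assume "q \<in> (\<lambda>l. p \<otimes> l \<otimes> inv p) ` stab x"
  then obtain l where l: "l \<in> carrier P" "\<alpha> l x = x" "q = p \<otimes> l \<otimes> inv p" by (auto simp: stab_def)
  have "\<alpha> q (\<alpha> p x) = \<alpha> p (\<alpha> l (\<alpha> (inv p) (\<alpha> p x)))"
    using assms l closed by (simp add: mult_act m_assoc)
  then show "q \<in> stab (\<alpha> p x)" using assms l closed inv_act_iff[of p x "\<alpha> p x"] by (simp add: stab_def)
qed

text \<open>With \<open>y = a x\<close> and \<open>y' = b x\<close> the transporter is
  \<open>a S inv b\<close>, where \<open>S\<close> is the stabiliser of \<open>x\<close>; its size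
  is therefore the same for all pairs of points of the orbit.\<close>

lemma card_transporter:
  assumes "x \<in> E" "y \<in> orb x" "y' \<in> orb x"
  shows "card {p \<in> carrier P. \<alpha> p y' = y} = card (stab x)"
proof -
  obtain a where a: "a \<in> carrier P" "y = \<alpha> a x" using assms by (auto simp: orb_def)
  obtain b where b: "b \<in> carrier P" "y' = \<alpha> b x" using assms by (auto simp: orb_def)
  have *: "\<alpha> p y' = y \<longleftrightarrow> inv a \<otimes> p \<otimes> b \<in> stab x" if p: "p \<in> carrier P" for p
  proof -
    have "\<alpha> (inv a \<otimes> p \<otimes> b) x = \<alpha> (inv a) (\<alpha> p y')"
      using assms a b p closed by (simp add: mult_act m_assoc)
    then show ?thesis using a b p assms closed inv_act_iff[of a x "\<alpha> p y'"] by (simp add: stab_def)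
  qed
  have "bij_betw (\<lambda>p. inv a \<otimes> p \<otimes> b) {p \<in> carrier P. \<alpha> p y' = y} (stab x)"
  proof (rule bij_betw_byWitness[where f' = "\<lambda>s. a \<otimes> s \<otimes> inv b"])
    have st: "stab x \<subseteq> carrier P" by (auto simp: stab_def)
    show "\<forall>p\<in>{p \<in> carrier P. \<alpha> p y' = y}. a \<otimes> (inv a \<otimes> p \<otimes> b) \<otimes> inv b = p"
      using a b by (auto simp: m_assoc cancel_inv_left)
    show inv: "\<forall>s\<in>stab x. inv a \<otimes> (a \<otimes> s \<otimes> inv b) \<otimes> b = s"
      using a b st by (auto simp: m_assoc inv_cancel_left subset_iff)
    show "(\<lambda>p. inv a \<otimes> p \<otimes> b) ` {p \<in> carrier P. \<alpha> p y' = y} \<subseteq> stab x" using * by auto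
    show "(\<lambda>s. a \<otimes> s \<otimes> inv b) ` stab x \<subseteq> {p \<in> carrier P. \<alpha> p y' = y}"
      using * inv st a b by auto
  qed
  then show ?thesis by (rule bij_betw_same_card)
qed

lemma orbit_stabilizer:
  assumes "x \<in> E"
  shows "card (carrier P) = card (orb x) * card (stab x)"
proof (rule card_eq_mult_card_fibres[where \<phi> = "\<lambda>p. \<alpha> p x"])
  show "finite (orb x)" using fin by (simp add: orb_def)
  show "card {p \<in> carrier P. \<alpha> p x = y} = card (stab x)" if "y \<in> orb x" for y
    using card_transporter[of x y x] that assms orb_refl by blast
qed (use fin in \<open>auto simp: orb_def\<close>)

text \<open>\<open>inv z p z\<close> stabilises \<open>x\<close> exactly when \<open>p\<close> fixes
  \<open>z x\<close>, and each fixed point arises from \<open>card (stab x)\<close> such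
  \<open>z\<close>. This links fixed points on an orbit to the quotient that defines
  \<open>perm_char\<close>.\<close>

lemma card_fixed_in_orb:
  assumes "x \<in> E" "p \<in> carrier P"
  shows "card {z \<in> carrier P. inv z \<otimes> p \<otimes> z \<in> stab x} = card {y \<in> orb x. \<alpha> p y = y} * card (stab x)"
proof (rule card_eq_mult_card_fibres[where \<phi> = "\<lambda>z. \<alpha> z x"])
  show "finite {z \<in> carrier P. inv z \<otimes> p \<otimes> z \<in> stab x}" using fin by simp
  show "finite {y \<in> orb x. \<alpha> p y = y}" using fin by (simp add: orb_def)
  have *: "inv z \<otimes> p \<otimes> z \<in> stab x \<longleftrightarrow> \<alpha> p (\<alpha> z x) = \<alpha> z x" if z: "z \<in> carrier P" for z
  proof -
    have "\<alpha> (inv z \<otimes> p \<otimes> z) x = \<alpha> (inv z) (\<alpha> p (\<alpha> z x))"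
      using assms z closed by (simp add: mult_act m_assoc)
    then show ?thesis using z assms closed inv_act_iff[of z x "\<alpha> p (\<alpha> z x)"] by (simp add: stab_def)
  qed
  then show "(\<lambda>z. \<alpha> z x) ` {z \<in> carrier P. inv z \<otimes> p \<otimes> z \<in> stab x} \<subseteq> {y \<in> orb x. \<alpha> p y = y}"
    by (auto simp: orb_def)
  fix y assume y: "y \<in> {y \<in> orb x. \<alpha> p y = y}"
  then have "{z \<in> {z \<in> carrier P. inv z \<otimes> p \<otimes> z \<in> stab x}. \<alpha> z x = y} = {z \<in> carrier P. \<alpha> z x = y}"
    using * by auto
  then show "card {z \<in> {z \<in> carrier P. inv z \<otimes> p \<otimes> z \<in> stab x}. \<alpha> z x = y} = card (stab x)"
    using card_transporter[of x y x] y assms orb_refl by simp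
qed

lemma sum_over_orbits: "(\<Sum>y\<in>E. F y) = (\<Sum>c\<in>orb ` E. \<Sum>y\<in>c. F y)"
proof -
  have "(\<Sum>y\<in>E. F y) = (\<Sum>c\<in>orb ` E. \<Sum>y\<in>{y\<in>E. orb y = c}. F y)"
    using sum.group[of E "orb ` E" orb F] fin_E by auto
  also have "\<dots> = (\<Sum>c\<in>orb ` E. \<Sum>y\<in>c. F y)"
  proof (rule sum.cong[OF refl])
    fix c assume "c \<in> orb ` E"
    then obtain x where x: "x \<in> E" "c = orb x" by auto
    have "{y\<in>E. orb y = c} = c"
      using x orb_eq_iff orb_subset by blast
    then show "(\<Sum>y\<in>{y\<in>E. orb y = c}. F y) = (\<Sum>y\<in>c. F y)" by simp
  qed
  finally show ?thesis .
qed

lemma card_eq_sum_orbits: "card {y \<in> E. Q y} = (\<Sum>c\<in>orb ` E. card {y \<in> c. Q y})"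
proof -
  have fc: "finite c" if "c \<in> orb ` E" for c using that fin by (auto simp: orb_def)
  have "card {y \<in> E. Q y} = (\<Sum>y\<in>E. if Q y then 1 else 0)"
    using fin_E by (simp add: sum.If_cases Int_def)
  also have "\<dots> = (\<Sum>c\<in>orb ` E. \<Sum>y\<in>c. if Q y then 1 else 0)" by (rule sum_over_orbits)
  also have "\<dots> = (\<Sum>c\<in>orb ` E. card {y \<in> c. Q y})"
    using fc by (intro sum.cong) (auto simp: sum.If_cases Int_def)
  finally show ?thesis .
qed

text \<open>The orbits fixed by an endomap commuting with the action; the action need not be free.\<close>

lemma twisted_burnside:
  assumes \<gamma>: "\<And>y. y \<in> E \<Longrightarrow> \<gamma> y \<in> E"
    and comm: "\<And>p y. p \<in> carrier P \<Longrightarrow> y \<in> E \<Longrightarrow> \<gamma> (\<alpha> p y) = \<alpha> p (\<gamma> y)"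
  shows "(\<Sum>p\<in>carrier P. card {y \<in> E. \<alpha> p (\<gamma> y) = y}) = card (carrier P) * card {c \<in> orb ` E. \<gamma> ` c = c}"
proof -
  have im: "\<gamma> ` orb y = orb (\<gamma> y)" if "y \<in> E" for y
    using that comm by (auto simp: orb_def image_image)
  have "(\<Sum>p\<in>carrier P. card {y \<in> E. \<alpha> p (\<gamma> y) = y}) = (\<Sum>p\<in>carrier P. \<Sum>y\<in>E. if \<alpha> p (\<gamma> y) = y then 1 else 0)"
    using fin_E by (simp add: sum.If_cases Int_def)
  also have "\<dots> = (\<Sum>y\<in>E. \<Sum>p\<in>carrier P. if \<alpha> p (\<gamma> y) = y then 1 else 0)"
    by (rule sum.swap)
  also have "\<dots> = (\<Sum>y\<in>E. card {p \<in> carrier P. \<alpha> p (\<gamma> y) = y})"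
    using fin by (simp add: sum.If_cases Int_def)
  also have "\<dots> = (\<Sum>c\<in>orb ` E. \<Sum>y\<in>c. card {p \<in> carrier P. \<alpha> p (\<gamma> y) = y})"
    by (rule sum_over_orbits)
  also have "\<dots> = (\<Sum>c\<in>orb ` E. if \<gamma> ` c = c then card (carrier P) else 0)"
  proof (rule sum.cong[OF refl])
    fix c assume c: "c \<in> orb ` E"
    then obtain x where x: "x \<in> E" "c = orb x" by auto
    show "(\<Sum>y\<in>c. card {p \<in> carrier P. \<alpha> p (\<gamma> y) = y}) = (if \<gamma> ` c = c then card (carrier P) else 0)"
    proof (cases "\<gamma> ` c = c")
      case True
      \<comment> \<open>\<open>\<gamma> y\<close> stays in the orbit, so the elements carrying it
        back to \<open>y\<close> form a transporter, as large as a stabiliser. Orbit times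
        stabiliser gives the order of the group for each preserved orbit.\<close>
      then have "(\<Sum>y\<in>c. card {p \<in> carrier P. \<alpha> p (\<gamma> y) = y}) = (\<Sum>y\<in>c. card (stab x))"
        using card_transporter[OF x(1)] x(2) by (intro sum.cong) blast+
      then show ?thesis using True x orbit_stabilizer[of x] by simp
    next
      case False
      \<comment> \<open>A solution \<open>p\<close> would put \<open>y\<close> and
        \<open>\<gamma> y\<close> into one orbit, and then \<open>\<gamma>\<close> would preserve
        that orbit.\<close>
      have "{p \<in> carrier P. \<alpha> p (\<gamma> y) = y} = {}" if y: "y \<in> c" for y
      proof (rule ccontr)
        assume "\<not> ?thesis"
        then obtain p where "p \<in> carrier P" "\<alpha> p (\<gamma> y) = y" by auto
        then have "y \<in> orb (\<gamma> y)" by (metis image_eqI orb_def)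
        moreover have "y \<in> E" "orb y = c" using y x orb_subset orb_eq by blast+
        ultimately have "\<gamma> ` c = c" using im[of y] orb_eq[of "\<gamma> y" y] \<gamma>[of y] by metis
        then show False using False by simp
      qed
      then have "(\<Sum>y\<in>c. card {p \<in> carrier P. \<alpha> p (\<gamma> y) = y}) = (\<Sum>y\<in>c. 0)"
        by (intro sum.cong) (simp_all only: card.empty)
      then show ?thesis using False by simp
    qed
  qed
  also have "\<dots> = card (carrier P) * card {c \<in> orb ` E. \<gamma> ` c = c}"
    using fin_E by (simp add: sum.If_cases Int_def)
  finally show ?thesis .
qed

end

section \<open>Conjugacy classes of subgroups and permutation characters\<close>

definition conj_sg :: "('p,'m) monoid_scheme \<Rightarrow> 'p \<Rightarrow> 'p set \<Rightarrow> 'p set" where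
  "conj_sg P x L = (\<lambda>l. x \<otimes>\<^bsub>P\<^esub> l \<otimes>\<^bsub>P\<^esub> inv\<^bsub>P\<^esub> x) ` L"

abbreviation cls :: "('p,'m) monoid_scheme \<Rightarrow> 'p set \<Rightarrow> 'p set set" where
  "cls P L \<equiv> {L'. sg_conj P L L'}"

text \<open>The number of fixed points of \<open>p\<close> on \<open>P / L\<close>: the cosets \<open>z L\<close> with \<open>p z L = z L\<close>
  are counted through their representatives \<open>z\<close>.\<close>

definition perm_char :: "('p,'m) monoid_scheme \<Rightarrow> 'p set \<Rightarrow> 'p \<Rightarrow> 'k::field_char_0" where
  "perm_char P L p =
     of_nat (card {z \<in> carrier P. inv\<^bsub>P\<^esub> z \<otimes>\<^bsub>P\<^esub> p \<otimes>\<^bsub>P\<^esub> z \<in> L}) / of_nat (card L)"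

lemma sg_conj_iff: "sg_conj P L L' \<longleftrightarrow> (\<exists>x\<in>carrier P. L' = conj_sg P x L)"
  by (simp add: sg_conj_def conj_sg_def)

context fin_group
begin

lemma conj_sg_cj:
  assumes "x \<in> carrier P" "y \<in> carrier P" "L \<subseteq> carrier P"
  shows "conj_sg P x (conj_sg P y L) = conj_sg P (x \<otimes> y) L"
  unfolding conj_sg_def image_image
  using assms by (intro image_cong) (auto simp: m_assoc inv_mult_group subset_iff)

lemma conj_sg_one: "L \<subseteq> carrier P \<Longrightarrow> conj_sg P \<one> L = L"
  unfolding conj_sg_def by (simp add: subset_iff)

lemma conj_sg_subset: "x \<in> carrier P \<Longrightarrow> L \<subseteq> carrier P \<Longrightarrow> conj_sg P x L \<subseteq> carrier P"
  by (auto simp: conj_sg_def)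

lemma conj_sg_inv_cj:
  assumes "x \<in> carrier P" "L \<subseteq> carrier P"
  shows "conj_sg P (inv x) (conj_sg P x L) = L"
  using assms by (simp add: conj_sg_cj conj_sg_one)

lemma mem_cj_iff:
  assumes "x \<in> carrier P" "p \<in> carrier P" "L \<subseteq> carrier P"
  shows "p \<in> conj_sg P x L \<longleftrightarrow> inv x \<otimes> p \<otimes> x \<in> L"
proof
  assume "p \<in> conj_sg P x L"
  then show "inv x \<otimes> p \<otimes> x \<in> L"
    using assms by (auto simp: conj_sg_def m_assoc inv_cancel_left subset_iff)
next
  assume "inv x \<otimes> p \<otimes> x \<in> L"
  moreover have "p = x \<otimes> (inv x \<otimes> p \<otimes> x) \<otimes> inv x"
    using assms by (simp add: m_assoc cancel_inv_left)
  ultimately show "p \<in> conj_sg P x L" unfolding conj_sg_def by blast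
qed

lemma subgroup_cj:
  assumes "x \<in> carrier P" "subgroup L P"
  shows "subgroup (conj_sg P x L) P"
proof (rule subgroupI)
  have L: "L \<subseteq> carrier P" using assms subgroup.subset by blast
  show "conj_sg P x L \<subseteq> carrier P" using assms L conj_sg_subset by blast
  show "conj_sg P x L \<noteq> {}" using subgroup.one_closed[OF assms(2)] unfolding conj_sg_def by blast
  show "inv a \<in> conj_sg P x L" if "a \<in> conj_sg P x L" for a
  proof -
    obtain l where l: "l \<in> L" "a = x \<otimes> l \<otimes> inv x" using \<open>a \<in> conj_sg P x L\<close> by (auto simp: conj_sg_def)
    then have "inv a = x \<otimes> inv l \<otimes> inv x"
      using L assms(1) by (auto simp: inv_mult_group m_assoc subset_iff)
    then show ?thesis using l subgroup.m_inv_closed[OF assms(2) l(1)] unfolding conj_sg_def by blast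
  qed
  show "a \<otimes> b \<in> conj_sg P x L" if "a \<in> conj_sg P x L" "b \<in> conj_sg P x L" for a b
  proof -
    obtain l where l: "l \<in> L" "a = x \<otimes> l \<otimes> inv x" using \<open>a \<in> conj_sg P x L\<close> by (auto simp: conj_sg_def)
    obtain l' where l': "l' \<in> L" "b = x \<otimes> l' \<otimes> inv x" using \<open>b \<in> conj_sg P x L\<close> by (auto simp: conj_sg_def)
    have "a \<otimes> b = x \<otimes> (l \<otimes> l') \<otimes> inv x"
      using L l l' assms(1) by (auto simp: m_assoc inv_cancel_left subset_iff)
    then show ?thesis using subgroup.m_closed[OF assms(2) l(1) l'(1)] unfolding conj_sg_def by blast
  qed
qed

lemma card_cj:
  assumes "x \<in> carrier P" "L \<subseteq> carrier P"
  shows "card (conj_sg P x L) = card L"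
  unfolding conj_sg_def
proof (rule card_image, rule inj_on_inverseI)
  fix a assume "a \<in> L"
  then show "inv x \<otimes> (x \<otimes> a \<otimes> inv x) \<otimes> x = a"
    using assms by (auto simp: m_assoc inv_cancel_left subset_iff)
qed

lemma sg_conj_refl: "L \<subseteq> carrier P \<Longrightarrow> sg_conj P L L"
  unfolding sg_conj_iff by (rule bexI[of _ \<one>]) (simp_all add: conj_sg_one)

lemma sg_conj_sym: "sg_conj P L L' \<Longrightarrow> L \<subseteq> carrier P \<Longrightarrow> sg_conj P L' L"
  unfolding sg_conj_iff by (auto intro!: bexI[of _ "inv _"] simp: conj_sg_inv_cj)

lemma sg_conj_trans: "sg_conj P L L' \<Longrightarrow> sg_conj P L' L'' \<Longrightarrow> L \<subseteq> carrier P \<Longrightarrow> sg_conj P L L''"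
  unfolding sg_conj_iff by (auto intro!: bexI[of _ "_ \<otimes> _"] simp: conj_sg_cj)

lemma sg_conj_subgroup: "sg_conj P L L' \<Longrightarrow> subgroup L P \<Longrightarrow> subgroup L' P"
  unfolding sg_conj_iff using subgroup_cj by blast

lemma sg_conj_card: "sg_conj P L L' \<Longrightarrow> L \<subseteq> carrier P \<Longrightarrow> card L' = card L"
  unfolding sg_conj_iff using card_cj by blast

lemma cls_eq_iff:
  assumes "subgroup L P" "subgroup L' P"
  shows "cls P L = cls P L' \<longleftrightarrow> sg_conj P L L'"
proof
  assume "cls P L = cls P L'"
  moreover have "L' \<in> cls P L'" using sg_conj_refl[of L'] assms(2) subgroup.subset by blast
  ultimately show "sg_conj P L L'" by blast
next
  have c: "L \<subseteq> carrier P" "L' \<subseteq> carrier P" using assms subgroup.subset by blast+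
  assume h: "sg_conj P L L'"
  have "sg_conj P L M \<longleftrightarrow> sg_conj P L' M" for M
    using sg_conj_trans[of L L' M] sg_conj_trans[of L' L M] sg_conj_sym[of L L'] h c by blast
  then show "cls P L = cls P L'" by blast
qed

lemma finite_subgroups: "finite {L. subgroup L P}"
  using fin by (rule finite_subset[rotated, OF finite_Pow_iff[THEN iffD2]]) (auto dest: subgroup.subset)

lemma finite_sg_classes: "finite (sg_classes P)"
  using finite_subgroups unfolding sg_classes_def by (simp add: setcompr_eq_image)

lemma cls_in_classes: "subgroup L P \<Longrightarrow> cls P L \<in> sg_classes P"
  unfolding sg_classes_def by blast

lemma rep_cls: "subgroup L P \<Longrightarrow> sg_conj P L (rep (cls P L))"
  unfolding rep_def using someI[of "\<lambda>L'. L' \<in> cls P L" L] sg_conj_refl[of L] subgroup.subset[of L P] by blast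

lemma rep_subgroup:
  assumes "C \<in> sg_classes P" shows "subgroup (rep C) P"
proof -
  obtain L where L: "subgroup L P" "C = cls P L" using assms unfolding sg_classes_def by blast
  then show ?thesis using rep_cls[of L] sg_conj_subgroup[of L "rep C"] by blast
qed

lemma cls_rep:
  assumes "C \<in> sg_classes P" shows "cls P (rep C) = C"
proof -
  obtain L where L: "subgroup L P" "C = cls P L" using assms unfolding sg_classes_def by blast
  then show ?thesis using rep_cls[of L] cls_eq_iff[of L "rep C"] rep_subgroup[OF assms] by simp
qed

lemma sg_conj_rep_iff:
  assumes "C \<in> sg_classes P" "subgroup L P"
  shows "sg_conj P (rep C) L \<longleftrightarrow> C = cls P L"
  using cls_eq_iff[of "rep C" L] assms rep_subgroup cls_rep by simp

lemma card_subgroup_pos: "subgroup L P \<Longrightarrow> card L > 0"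
  using subgroup.finite_imp_card_positive[of L P] fin by blast

section \<open>Dependence of permutation characters on conjugacy and on generated cyclic
  subgroups\<close>

lemma perm_char_conj:
  assumes "subgroup L P" "sg_conj P L L'" "p \<in> carrier P"
  shows "perm_char P L' p = (perm_char P L p :: 'k::field_char_0)"
proof -
  obtain x where x: "x \<in> carrier P" "L' = conj_sg P x L" using assms unfolding sg_conj_iff by blast
  have L: "L \<subseteq> carrier P" using assms subgroup.subset by blast
  have "bij_betw (\<lambda>z. z \<otimes> x) {z \<in> carrier P. inv z \<otimes> p \<otimes> z \<in> L'} {z \<in> carrier P. inv z \<otimes> p \<otimes> z \<in> L}"
  proof (rule bij_betw_byWitness[where f' = "\<lambda>z. z \<otimes> inv x"])
    have eq: "inv z \<otimes> p \<otimes> z \<in> L' \<longleftrightarrow> inv (z \<otimes> x) \<otimes> p \<otimes> (z \<otimes> x) \<in> L" if "z \<in> carrier P" for z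
      using mem_cj_iff[of x "inv z \<otimes> p \<otimes> z" L] x L that assms by (simp add: inv_mult_group m_assoc)
    then show "(\<lambda>z. z \<otimes> x) ` {z \<in> carrier P. inv z \<otimes> p \<otimes> z \<in> L'} \<subseteq> {z \<in> carrier P. inv z \<otimes> p \<otimes> z \<in> L}"
      using x by auto
    have "z \<otimes> inv x \<otimes> x = z" if "z \<in> carrier P" for z using x that by (simp add: m_assoc)
    then show "(\<lambda>z. z \<otimes> inv x) ` {z \<in> carrier P. inv z \<otimes> p \<otimes> z \<in> L} \<subseteq> {z \<in> carrier P. inv z \<otimes> p \<otimes> z \<in> L'}"
      using x eq[of "_ \<otimes> inv x"] by auto
  qed (use x in \<open>auto simp: m_assoc\<close>)
  then show ?thesis unfolding perm_char_def using sg_conj_card[OF assms(2) L] by (simp add: bij_betw_same_card)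
qed

text \<open>A subgroup contains \<open>g\<close> exactly when it contains the cyclic group of
  \<open>g\<close>, so the fixed points of \<open>g\<close> on \<open>P / A\<close> are governed by
  \<open>generate P {g}\<close> alone.\<close>

lemma generate_sub_cj_iff:
  assumes "subgroup A P" "z \<in> carrier P" "g \<in> carrier P"
  shows "inv z \<otimes> g \<otimes> z \<in> A \<longleftrightarrow> generate P {g} \<subseteq> conj_sg P z A"
proof -
  have "inv z \<otimes> g \<otimes> z \<in> A \<longleftrightarrow> g \<in> conj_sg P z A"
    using mem_cj_iff[of z g A] assms subgroup.subset[of A P] by blast
  also have "\<dots> \<longleftrightarrow> generate P {g} \<subseteq> conj_sg P z A"
    using generate_subgroup_incl[OF _ subgroup_cj[OF assms(2,1)], of "{g}"] generate.incl[of g "{g}" P] by blast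
  finally show ?thesis .
qed

lemma generate_subset: "g \<in> carrier P \<Longrightarrow> generate P {g} \<subseteq> carrier P"
  using generate_in_carrier by blast

lemma generate_subgroup: "g \<in> carrier P \<Longrightarrow> subgroup (generate P {g}) P"
  using generate_is_subgroup by simp

text \<open>If \<open>y\<close> conjugates the first cyclic group to the second, translating coset
  representatives by \<open>inv y\<close> matches the cosets fixed by \<open>h\<close> with those
  fixed by \<open>g\<close>. The elements themselves may be non-conjugate, for instance two
  generators of one cyclic group.\<close>

lemma perm_char_generate_conj:
  assumes "subgroup A P" "g \<in> carrier P" "h \<in> carrier P" "sg_conj P (generate P {g}) (generate P {h})"
  shows "perm_char P A h = (perm_char P A g :: 'k::field_char_0)"
proof -
  obtain y where y: "y \<in> carrier P" "generate P {h} = conj_sg P y (generate P {g})"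
    using assms unfolding sg_conj_iff by blast
  have A: "A \<subseteq> carrier P" using assms subgroup.subset by blast
  have "bij_betw (\<lambda>z. inv y \<otimes> z) {z \<in> carrier P. inv z \<otimes> h \<otimes> z \<in> A} {z \<in> carrier P. inv z \<otimes> g \<otimes> z \<in> A}"
  proof (rule bij_betw_byWitness[where f' = "\<lambda>z. y \<otimes> z"])
    have eq: "inv z \<otimes> h \<otimes> z \<in> A \<longleftrightarrow> inv (inv y \<otimes> z) \<otimes> g \<otimes> (inv y \<otimes> z) \<in> A" if z: "z \<in> carrier P" for z
    proof -
      have "conj_sg P (inv y) (generate P {h}) = generate P {g}"
        using y assms(2) by (simp add: conj_sg_inv_cj generate_subset)
      moreover have "conj_sg P (inv y) (conj_sg P z A) = conj_sg P (inv y \<otimes> z) A" using conj_sg_cj y z A by simp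
      moreover have "conj_sg P y (conj_sg P (inv y \<otimes> z) A) = conj_sg P z A"
        using conj_sg_cj[of y "inv y \<otimes> z" A] y z A by (simp add: cancel_inv_left)
      ultimately have "generate P {h} \<subseteq> conj_sg P z A \<longleftrightarrow> generate P {g} \<subseteq> conj_sg P (inv y \<otimes> z) A"
        using y unfolding conj_sg_def by (metis image_mono)
      then show ?thesis using generate_sub_cj_iff assms z y by simp
    qed
    then show "(\<lambda>z. inv y \<otimes> z) ` {z \<in> carrier P. inv z \<otimes> h \<otimes> z \<in> A} \<subseteq> {z \<in> carrier P. inv z \<otimes> g \<otimes> z \<in> A}"
      using y by auto
    show "(\<lambda>z. y \<otimes> z) ` {z \<in> carrier P. inv z \<otimes> g \<otimes> z \<in> A} \<subseteq> {z \<in> carrier P. inv z \<otimes> h \<otimes> z \<in> A}"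
      using y eq[of "y \<otimes> _"] by (auto simp: inv_cancel_left)
  qed (use y in \<open>auto simp: cancel_inv_left inv_cancel_left\<close>)
  then show ?thesis unfolding perm_char_def by (simp add: bij_betw_same_card)
qed

lemma perm_char_nonzeroD:
  assumes "subgroup A P" "g \<in> carrier P" "perm_char P A g \<noteq> (0::'k::field_char_0)"
  obtains z where "z \<in> carrier P" "generate P {g} \<subseteq> conj_sg P z A"
proof -
  have "{z \<in> carrier P. inv z \<otimes> g \<otimes> z \<in> A} \<noteq> {}"
    using assms(3) unfolding perm_char_def by (metis card.empty div_0 of_nat_0)
  then show ?thesis using that generate_sub_cj_iff[OF assms(1) _ assms(2)] by blast
qed

lemma perm_char_generator_nonzero:
  assumes "g \<in> carrier P"
  shows "perm_char P (generate P {g}) g \<noteq> (0::'k::field_char_0)"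
proof -
  have "\<one> \<in> {z \<in> carrier P. inv z \<otimes> g \<otimes> z \<in> generate P {g}}"
    using assms generate.incl[of g "{g}" P] by simp
  then have "card {z \<in> carrier P. inv z \<otimes> g \<otimes> z \<in> generate P {g}} \<noteq> 0"
    using fin by (subst card_eq_0_iff) auto
  then show ?thesis
    using card_subgroup_pos[OF generate_subgroup[OF assms]] by (simp add: perm_char_def)
qed

lemma cyclic_sg_subgroup: "cyclic_sg P A \<Longrightarrow> subgroup A P"
  unfolding cyclic_sg_def using generate_subgroup by blast

lemma cyclic_sg_conj:
  assumes "cyclic_sg P A" "sg_conj P A A'"
  shows "cyclic_sg P A'"
proof -
  obtain a where a: "a \<in> carrier P" "A = generate P {a}" using assms unfolding cyclic_sg_def by blast
  obtain x where x: "x \<in> carrier P" "A' = conj_sg P x A" using assms unfolding sg_conj_iff by blast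
  let ?b = "x \<otimes> a \<otimes> inv x"
  have "?b \<in> A'" using x a generate.incl[of a "{a}" P] unfolding conj_sg_def by blast
  then have 1: "generate P {?b} \<subseteq> A'"
    using generate_subgroup_incl subgroup_cj x a generate_subgroup by (metis empty_subsetI insert_subset)
  have "a \<in> conj_sg P (inv x) (generate P {?b})"
    using mem_cj_iff[of "inv x" a "generate P {?b}"] x a generate_subset[of ?b] generate.incl[of ?b "{?b}" P] by simp
  then have "A \<subseteq> conj_sg P (inv x) (generate P {?b})"
    using generate_subgroup_incl subgroup_cj x a generate_subgroup
    by (metis empty_subsetI insert_subset inv_closed m_closed)
  then have "A' \<subseteq> conj_sg P x (conj_sg P (inv x) (generate P {?b}))" using x unfolding conj_sg_def by blast
  also have "\<dots> = generate P {?b}" using x a generate_subset[of ?b] by (simp add: conj_sg_cj conj_sg_one)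
  finally show ?thesis using 1 x a unfolding cyclic_sg_def by blast
qed

end

lemma fin_group_DirProd: "fin_group G \<Longrightarrow> fin_group H \<Longrightarrow> fin_group (G \<times>\<times> H)"
  unfolding fin_group_def fin_group_axioms_def by (simp add: DirProd_group)

lemma conj_sg_Times:
  assumes "group G" "group H" "x \<in> carrier G" "y \<in> carrier H"
  shows "conj_sg (G \<times>\<times> H) (x,y) (A \<times> B) = conj_sg G x A \<times> conj_sg H y B"
  using assms by (force simp: conj_sg_def)

lemma sg_conj_Times_iff:
  assumes "group G" "group H"
  shows "sg_conj (G \<times>\<times> H) (A \<times> B) L \<longleftrightarrow> (\<exists>A' B'. sg_conj G A A' \<and> sg_conj H B B' \<and> L = A' \<times> B')"
proof
  assume "sg_conj (G \<times>\<times> H) (A \<times> B) L"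
  then obtain x y where "x \<in> carrier G" "y \<in> carrier H" "L = conj_sg (G \<times>\<times> H) (x,y) (A \<times> B)"
    unfolding sg_conj_iff by auto
  then show "\<exists>A' B'. sg_conj G A A' \<and> sg_conj H B B' \<and> L = A' \<times> B'"
    using conj_sg_Times[OF assms, of x y A B] unfolding sg_conj_iff by blast
next
  assume "\<exists>A' B'. sg_conj G A A' \<and> sg_conj H B B' \<and> L = A' \<times> B'"
  then obtain x y where "x \<in> carrier G" "y \<in> carrier H" "L = conj_sg G x A \<times> conj_sg H y B"
    unfolding sg_conj_iff by blast
  then show "sg_conj (G \<times>\<times> H) (A \<times> B) L"
    unfolding sg_conj_iff by (intro bexI[of _ "(x,y)"]) (simp_all add: conj_sg_Times[OF assms])
qed

lemma perm_char_Times: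
  assumes "fin_group G" "fin_group H" "g \<in> carrier G" "h \<in> carrier H"
  shows "perm_char (G \<times>\<times> H) (A \<times> B) (g,h) = (perm_char G A g * perm_char H B h :: 'k::field_char_0)"
proof -
  have G: "group G" and H: "group H" using assms by (auto simp: fin_group_def)
  have "{z \<in> carrier (G \<times>\<times> H). inv\<^bsub>G \<times>\<times> H\<^esub> z \<otimes>\<^bsub>G \<times>\<times> H\<^esub> (g,h) \<otimes>\<^bsub>G \<times>\<times> H\<^esub> z \<in> A \<times> B} =
    {z \<in> carrier G. inv\<^bsub>G\<^esub> z \<otimes>\<^bsub>G\<^esub> g \<otimes>\<^bsub>G\<^esub> z \<in> A} \<times> {z \<in> carrier H. inv\<^bsub>H\<^esub> z \<otimes>\<^bsub>H\<^esub> h \<otimes>\<^bsub>H\<^esub> z \<in> B}"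
    using G H by auto
  then show ?thesis unfolding perm_char_def by (simp add: card_cartesian_product)
qed

section \<open>Bisets and their composition\<close>

locale biset = G: fin_group G + H: fin_group H
  for G :: "('a,'m) monoid_scheme" and H :: "('b,'n) monoid_scheme" +
  fixes E :: "'x set" and act :: "'a \<Rightarrow> 'x \<Rightarrow> 'b \<Rightarrow> 'x"
  assumes finite_E: "finite E"
    and act_closed: "\<And>g x h. g \<in> carrier G \<Longrightarrow> x \<in> E \<Longrightarrow> h \<in> carrier H \<Longrightarrow> act g x h \<in> E"
    and act_one: "\<And>x. x \<in> E \<Longrightarrow> act \<one>\<^bsub>G\<^esub> x \<one>\<^bsub>H\<^esub> = x"
    and act_mult: "\<And>g g' x h h'. g \<in> carrier G \<Longrightarrow> g' \<in> carrier G \<Longrightarrow> x \<in> E \<Longrightarrow> h \<in> carrier H \<Longrightarrow>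
      h' \<in> carrier H \<Longrightarrow> act g (act g' x h) h' = act (g \<otimes>\<^bsub>G\<^esub> g') x (h \<otimes>\<^bsub>H\<^esub> h')"
begin

abbreviation "P \<equiv> G \<times>\<times> H"

sublocale P: fin_group "G \<times>\<times> H"
  by (rule fin_group_DirProd) unfold_locales

text \<open>Letting \<open>(g,h)\<close> act by \<open>g x (inv h)\<close> turns the two commuting
  actions into one left action of the product group; its stabilisers are then literally
  \<open>biset_stab\<close>.\<close>

sublocale A: fin_action "G \<times>\<times> H" E "\<lambda>(g,h) x. act g x (inv\<^bsub>H\<^esub> h)"
  by unfold_locales
    (auto simp: finite_E act_closed act_one act_mult H.inv_mult_group)

lemma stab_eq: "A.stab x = biset_stab G H act x"
  by (auto simp: A.stab_def biset_stab_def)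

lemma orb_eq: "A.orb x = biset_orbit G H act x"
proof (intro Set.set_eqI iffI)
  fix y assume "y \<in> A.orb x"
  then show "y \<in> biset_orbit G H act x" by (auto simp: A.orb_def biset_orbit_def)
next
  fix y assume "y \<in> biset_orbit G H act x"
  then obtain g h where "g \<in> carrier G" "h \<in> carrier H" "y = act g x h" by (auto simp: biset_orbit_def)
  then show "y \<in> A.orb x" unfolding A.orb_def by (intro image_eqI[of _ _ "(g, inv\<^bsub>H\<^esub> h)"]) auto
qed

lemma conj_stab: "x \<in> E \<Longrightarrow> y \<in> A.orb x \<Longrightarrow> sg_conj P (A.stab x) (A.stab y)"
  unfolding A.orb_def sg_conj_def using A.stab_act by blast

text \<open>Stabilisers along an orbit are conjugate, so the existential quantifier in
  \<open>biset_class\<close> may be tested at any single point.\<close>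

lemma orbit_type_iff:
  assumes "x \<in> E" "L \<subseteq> carrier P"
  shows "(\<exists>y\<in>A.orb x. sg_conj P L (A.stab y)) \<longleftrightarrow> sg_conj P L (A.stab x)"
proof
  assume "\<exists>y\<in>A.orb x. sg_conj P L (A.stab y)"
  then obtain y where y: "y \<in> A.orb x" "sg_conj P L (A.stab y)" by blast
  have "sg_conj P (A.stab y) (A.stab x)"
    using P.sg_conj_sym[OF conj_stab[OF assms(1) y(1)]] A.stab_subgroup[OF assms(1)] subgroup.subset by blast
  then show "sg_conj P L (A.stab x)" using P.sg_conj_trans y assms by blast
qed (use A.orb_refl assms in blast)

lemma biset_class_eq:
  "biset_class G H E act L =
     (if subgroup L P then of_nat (card {c \<in> A.orb ` E. \<exists>x\<in>c. sg_conj P L (A.stab x)}) else 0)"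
  unfolding biset_class_def stab_eq orb_eq[abs_def] by simp

lemma biset_class_in_kB: "biset_class G H E act \<in> (kB G H :: (_ \<Rightarrow> 'k::field) set)"
proof -
  have "biset_class G H E act L = (biset_class G H E act L' :: 'k)"
    if h: "subgroup L P" "sg_conj P L L'" for L L'
  proof -
    have c: "L \<subseteq> carrier P" "L' \<subseteq> carrier P"
      using h P.sg_conj_subgroup[of L L'] subgroup.subset by blast+
    have "sg_conj P L S \<longleftrightarrow> sg_conj P L' S" for S
      using h c P.sg_conj_trans[of L L' S] P.sg_conj_trans[of L' L S] P.sg_conj_sym[of L L'] by blast
    then show ?thesis unfolding biset_class_eq using h P.sg_conj_subgroup[of L L'] by simp
  qed
  moreover have "biset_class G H E act L = (0::'k)" if "\<not> subgroup L P" for L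
    using that by (simp add: biset_class_def)
  ultimately show ?thesis unfolding kB_def by blast
qed

lemma card_fixed_in_orb:
  assumes "x \<in> E" "g \<in> carrier G" "h \<in> carrier H"
  shows "of_nat (card {y \<in> A.orb x. act g y (inv\<^bsub>H\<^esub> h) = y}) =
    (perm_char P (A.stab x) (g,h) :: 'k::field_char_0)"
proof -
  have "card (A.stab x) > 0" using P.card_subgroup_pos A.stab_subgroup assms by blast
  moreover have "card {z \<in> carrier P. inv\<^bsub>P\<^esub> z \<otimes>\<^bsub>P\<^esub> (g,h) \<otimes>\<^bsub>P\<^esub> z \<in> A.stab x} =
    card {y \<in> A.orb x. act g y (inv\<^bsub>H\<^esub> h) = y} * card (A.stab x)"
    using A.card_fixed_in_orb[of x "(g,h)"] assms by simp
  ultimately show ?thesis unfolding perm_char_def by simp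
qed

text \<open>Each orbit belongs to exactly one class of stabilisers, and its fixed points depend only
  on that class; the rest is an exchange of sums. Fixed points of a biset thus become a linear
  function of its class in the algebra.\<close>

lemma card_fixed:
  assumes "g \<in> carrier G" "h \<in> carrier H"
  shows "of_nat (card {x \<in> E. act g x (inv\<^bsub>H\<^esub> h) = x}) =
    (\<Sum>C\<in>sg_classes P. biset_class G H E act (rep C) * (perm_char P (rep C) (g,h) :: 'k::field_char_0))"
proof -
  let ?T = "\<lambda>c C. \<exists>x\<in>c. sg_conj P (rep C) (A.stab x)"
  have "of_nat (card {x \<in> E. act g x (inv\<^bsub>H\<^esub> h) = x}) =
    (\<Sum>c\<in>A.orb ` E. of_nat (card {x \<in> c. act g x (inv\<^bsub>H\<^esub> h) = x}) :: 'k)"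
    unfolding A.card_eq_sum_orbits by simp
  also have "\<dots> = (\<Sum>c\<in>A.orb ` E. \<Sum>C\<in>sg_classes P. if ?T c C then perm_char P (rep C) (g,h) else 0)"
  proof (rule sum.cong[OF refl])
    fix c assume "c \<in> A.orb ` E"
    then obtain x where x: "x \<in> E" "c = A.orb x" by blast
    have S: "subgroup (A.stab x) P" using x A.stab_subgroup by blast
    have T: "?T c C \<longleftrightarrow> C = cls P (A.stab x)" if C: "C \<in> sg_classes P" for C
      using orbit_type_iff[of x "rep C"] x P.sg_conj_rep_iff[OF C S]
        subgroup.subset[OF P.rep_subgroup[OF C]] by blast
    have "(\<Sum>C\<in>sg_classes P. if ?T c C then perm_char P (rep C) (g,h) else 0) =
      (\<Sum>C\<in>sg_classes P. if C = cls P (A.stab x) then perm_char P (rep C) (g,h) else (0::'k))"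
      using T by (intro sum.cong) auto
    also have "\<dots> = perm_char P (rep (cls P (A.stab x))) (g,h)"
      using P.finite_sg_classes P.cls_in_classes[OF S] by (simp add: sum.delta)
    also have "\<dots> = perm_char P (A.stab x) (g,h)"
      using P.perm_char_conj[OF S P.rep_cls[OF S], of "(g,h)"] assms by simp
    finally show "of_nat (card {x \<in> c. act g x (inv\<^bsub>H\<^esub> h) = x}) =
      (\<Sum>C\<in>sg_classes P. if ?T c C then perm_char P (rep C) (g,h) else (0::'k))"
      using card_fixed_in_orb x assms by simp
  qed
  also have "\<dots> = (\<Sum>C\<in>sg_classes P. \<Sum>c\<in>A.orb ` E. if ?T c C then perm_char P (rep C) (g,h) else 0)"
    by (rule sum.swap)
  also have "\<dots> = (\<Sum>C\<in>sg_classes P. biset_class G H E act (rep C) * perm_char P (rep C) (g,h))"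
    using finite_E P.rep_subgroup
    by (intro sum.cong refl) (simp add: biset_class_eq sum.If_cases Int_def)
  finally show ?thesis .
qed

text \<open>When all stabilisers are conjugate to \<open>S\<close>, the orbits are copies of one
  transitive biset and their number is the only invariant left.\<close>

lemma biset_class_isotypic:
  assumes "\<And>x. x \<in> E \<Longrightarrow> sg_conj P (A.stab x) S" "subgroup S P"
  shows "biset_class G H E act L =
    (if subgroup L P \<and> sg_conj P L S then of_nat (card (A.orb ` E)) else 0)"
proof (cases "subgroup L P")
  case True
  have "(\<exists>y\<in>c. sg_conj P L (A.stab y)) \<longleftrightarrow> sg_conj P L S" if c: "c \<in> A.orb ` E" for c
  proof -
    obtain x where x: "x \<in> E" "c = A.orb x" using c by blast
    have "A.stab x \<subseteq> carrier P" "L \<subseteq> carrier P" "S \<subseteq> carrier P"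
      using A.stab_subgroup x True assms subgroup.subset by blast+
    then have "sg_conj P L (A.stab x) \<longleftrightarrow> sg_conj P L S"
      using assms(1)[OF x(1)] P.sg_conj_trans[of L "A.stab x" S] P.sg_conj_trans[of L S "A.stab x"]
        P.sg_conj_sym[of "A.stab x" S] by blast
    then show ?thesis using orbit_type_iff[of x L] x True subgroup.subset by blast
  qed
  then have "{c \<in> A.orb ` E. \<exists>y\<in>c. sg_conj P L (A.stab y)} = (if sg_conj P L S then A.orb ` E else {})"
    by auto
  then show ?thesis unfolding biset_class_eq using True by simp
qed (simp add: biset_class_def)

end

text \<open>An equivariant bijection carries orbits to orbits and leaves stabilisers unchanged. It
  is applied in \<open>comp_class_diag\<close> to identify a composite with its left factor.\<close>

lemma biset_class_iso:
  assumes U: "biset G H U actU" and V: "biset G H V actV" and bij: "bij_betw \<phi> U V"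
    and equiv: "\<And>g u h. g \<in> carrier G \<Longrightarrow> u \<in> U \<Longrightarrow> h \<in> carrier H \<Longrightarrow> \<phi> (actU g u h) = actV g (\<phi> u) h"
  shows "biset_class G H V actV = (biset_class G H U actU :: _ \<Rightarrow> 'k::field_char_0)"
proof
  fix L
  interpret U: biset G H U actU by fact
  interpret V: biset G H V actV by fact
  have im: "\<phi> ` U = V" and inj: "inj_on \<phi> U" using bij by (auto simp: bij_betw_def)
  have orb: "V.A.orb (\<phi> u) = \<phi> ` U.A.orb u" if "u \<in> U" for u
    using that equiv by (auto simp: U.A.orb_def V.A.orb_def image_image split_beta intro!: image_cong)
  have stab: "V.A.stab (\<phi> u) = U.A.stab u" if u: "u \<in> U" for u
  proof -
    have "actV g (\<phi> u) (inv\<^bsub>H\<^esub> h) = \<phi> u \<longleftrightarrow> actU g u (inv\<^bsub>H\<^esub> h) = u"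
      if "g \<in> carrier G" "h \<in> carrier H" for g h
      using equiv[of g u "inv\<^bsub>H\<^esub> h"] u that inj_onD[OF inj, of "actU g u (inv\<^bsub>H\<^esub> h)" u] U.act_closed by auto
    then show ?thesis by (auto simp: U.A.stab_def V.A.stab_def)
  qed
  have sub: "c \<subseteq> U" if "c \<in> U.A.orb ` U" for c using that U.A.orb_subset by blast
  have 1: "V.A.orb ` V = (\<lambda>c. \<phi> ` c) ` U.A.orb ` U"
    using orb by (force simp flip: im)
  have 2: "(\<exists>y\<in>\<phi> ` c. sg_conj (G \<times>\<times> H) L (V.A.stab y)) \<longleftrightarrow> (\<exists>x\<in>c. sg_conj (G \<times>\<times> H) L (U.A.stab x))"
    if "c \<in> U.A.orb ` U" for c
  proof -
    have "V.A.stab (\<phi> x) = U.A.stab x" if "x \<in> c" for x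
      using stab sub \<open>c \<in> U.A.orb ` U\<close> that by blast
    then show ?thesis by simp
  qed
  have "{c \<in> V.A.orb ` V. \<exists>x\<in>c. sg_conj (G \<times>\<times> H) L (V.A.stab x)} =
    (\<lambda>c. \<phi> ` c) ` {c \<in> U.A.orb ` U. \<exists>y\<in>\<phi> ` c. sg_conj (G \<times>\<times> H) L (V.A.stab y)}"
    unfolding 1 by blast
  also have "{c \<in> U.A.orb ` U. \<exists>y\<in>\<phi> ` c. sg_conj (G \<times>\<times> H) L (V.A.stab y)} =
    {c \<in> U.A.orb ` U. \<exists>x\<in>c. sg_conj (G \<times>\<times> H) L (U.A.stab x)}"
    by (rule Collect_cong) (use 2 in \<open>blast\<close>)
  finally have "{c \<in> V.A.orb ` V. \<exists>x\<in>c. sg_conj (G \<times>\<times> H) L (V.A.stab x)} =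
    (\<lambda>c. \<phi> ` c) ` {c \<in> U.A.orb ` U. \<exists>x\<in>c. sg_conj (G \<times>\<times> H) L (U.A.stab x)}" .
  moreover have "inj_on (\<lambda>c. \<phi> ` c) {c \<in> U.A.orb ` U. \<exists>x\<in>c. sg_conj (G \<times>\<times> H) L (U.A.stab x)}"
    using inj_on_image[of \<phi> "U.A.orb ` U"] inj sub inj_on_subset
    by (smt (verit) Union_least inj_onI inj_on_image_eq_iff mem_Collect_eq)
  ultimately show "biset_class G H V actV L = (biset_class G H U actU L :: 'k)"
    unfolding U.biset_class_eq V.biset_class_eq by (simp add: card_image)
qed

section \<open>Composites as orbit spaces of the middle group\<close>

locale composable = U: biset G H U actU + V: biset H K V actV
  for G :: "('a,'m) monoid_scheme" and H :: "('b,'n) monoid_scheme" and K :: "('c,'o) monoid_scheme"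
    and U :: "'u set" and actU and V :: "'v set" and actV
begin

text \<open>The middle group acts by \<open>h (u,v) = (u (inv h), h v)\<close>. Its orbits are the
  classes of the relation that defines the composite, which brings counting on the quotient within
  reach of \<open>twisted_burnside\<close>.\<close>

sublocale M: fin_action H "U \<times> V" "\<lambda>h (u,v). (actU \<one>\<^bsub>G\<^esub> u (inv\<^bsub>H\<^esub> h), actV h v \<one>\<^bsub>K\<^esub>)"
  by unfold_locales
    (auto simp: U.finite_E V.finite_E U.act_closed V.act_closed U.act_one V.act_one U.act_mult V.act_mult
      U.H.inv_mult_group)

lemma orb_eq:
  "M.orb (u,v) = {(actU \<one>\<^bsub>G\<^esub> u h, actV (inv\<^bsub>H\<^esub> h) v \<one>\<^bsub>K\<^esub>) | h. h \<in> carrier H}"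
proof (intro Set.set_eqI iffI)
  fix y assume "y \<in> M.orb (u,v)"
  then obtain h where "h \<in> carrier H" "y = (actU \<one>\<^bsub>G\<^esub> u (inv\<^bsub>H\<^esub> h), actV h v \<one>\<^bsub>K\<^esub>)" by (auto simp: M.orb_def)
  then show "y \<in> {(actU \<one>\<^bsub>G\<^esub> u h, actV (inv\<^bsub>H\<^esub> h) v \<one>\<^bsub>K\<^esub>) | h. h \<in> carrier H}"
    by (auto intro!: exI[of _ "inv\<^bsub>H\<^esub> h"])
next
  fix y assume "y \<in> {(actU \<one>\<^bsub>G\<^esub> u h, actV (inv\<^bsub>H\<^esub> h) v \<one>\<^bsub>K\<^esub>) | h. h \<in> carrier H}"
  then obtain h where "h \<in> carrier H" "y = (actU \<one>\<^bsub>G\<^esub> u h, actV (inv\<^bsub>H\<^esub> h) v \<one>\<^bsub>K\<^esub>)" by auto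
  then show "y \<in> M.orb (u,v)" unfolding M.orb_def by (auto intro!: image_eqI[of _ _ "inv\<^bsub>H\<^esub> h"])
qed

abbreviation "carr \<equiv> comp_carrier G H K U actU V actV"
abbreviation "cact \<equiv> comp_act G H K actU actV"
text \<open>The outer actions before passing to the quotient; they commute with the middle group and
  hence descend to its orbits.\<close>

abbreviation "move g k \<equiv> \<lambda>(u,v). (actU g u \<one>\<^bsub>H\<^esub>, actV \<one>\<^bsub>H\<^esub> v k)"

lemma carr_eq: "carr = M.orb ` (U \<times> V)"
  unfolding comp_carrier_def by (rule image_cong) (auto simp: orb_eq)

lemma move_closed: "g \<in> carrier G \<Longrightarrow> k \<in> carrier K \<Longrightarrow> y \<in> U \<times> V \<Longrightarrow> move g k y \<in> U \<times> V"
  by (auto simp: U.act_closed V.act_closed)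

lemma move_comm:
  "g \<in> carrier G \<Longrightarrow> k \<in> carrier K \<Longrightarrow> h \<in> carrier H \<Longrightarrow> y \<in> U \<times> V \<Longrightarrow>
    move g k ((\<lambda>(u,v). (actU \<one>\<^bsub>G\<^esub> u (inv\<^bsub>H\<^esub> h), actV h v \<one>\<^bsub>K\<^esub>)) y) =
    (\<lambda>(u,v). (actU \<one>\<^bsub>G\<^esub> u (inv\<^bsub>H\<^esub> h), actV h v \<one>\<^bsub>K\<^esub>)) (move g k y)"
  by (auto simp: U.act_mult V.act_mult)

lemma cact_orb:
  assumes "g \<in> carrier G" "k \<in> carrier K" "y \<in> U \<times> V"
  shows "cact g (M.orb y) k = M.orb (move g k y)"
proof -
  have "cact g (M.orb y) k = move g k ` M.orb y" by (simp add: comp_act_def)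
  also have "\<dots> = M.orb (move g k y)"
    unfolding M.orb_def image_image using assms move_comm by (intro image_cong) auto
  finally show ?thesis .
qed

sublocale C: biset G K carr cact
proof unfold_locales
  show "finite carr" unfolding carr_eq using U.finite_E V.finite_E by simp
  fix c assume "c \<in> carr"
  then obtain y where y: "y \<in> U \<times> V" "c = M.orb y" unfolding carr_eq by blast
  have "move \<one>\<^bsub>G\<^esub> \<one>\<^bsub>K\<^esub> y = y" using y by (auto simp: U.act_one V.act_one)
  then show "cact \<one>\<^bsub>G\<^esub> c \<one>\<^bsub>K\<^esub> = c" using cact_orb y by simp
  fix g k assume gk: "g \<in> carrier G" "k \<in> carrier K"
  show "cact g c k \<in> carr" unfolding carr_eq using cact_orb move_closed y gk by simp
  fix g' k' assume gk': "g' \<in> carrier G" "k' \<in> carrier K"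
  have "move g k' (move g' k y) = move (g \<otimes>\<^bsub>G\<^esub> g') (k \<otimes>\<^bsub>K\<^esub> k') y"
    using y gk gk' by (auto simp: U.act_mult V.act_mult)
  then show "cact g (cact g' c k) k' = cact (g \<otimes>\<^bsub>G\<^esub> g') c (k \<otimes>\<^bsub>K\<^esub> k')"
    using cact_orb move_closed[of g' k y] y gk gk' by simp
qed

text \<open>A pair with \<open>(g u (inv h), h v (inv k)) = (u,v)\<close> is a fixed point of
  \<open>(g,h)\<close> together with a fixed point of \<open>(h,k)\<close>. The left side therefore
  counts solutions of the twisted equation with \<open>move g (inv k)\<close> as the commuting
  endomap.\<close>

lemma card_fixed_comp:
  assumes "g \<in> carrier G" "k \<in> carrier K"
  shows "(\<Sum>h\<in>carrier H. card {u \<in> U. actU g u (inv\<^bsub>H\<^esub> h) = u} * card {v \<in> V. actV h v (inv\<^bsub>K\<^esub> k) = v}) =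
    card (carrier H) * card {c \<in> carr. cact g c (inv\<^bsub>K\<^esub> k) = c}"
proof -
  let ?\<gamma> = "move g (inv\<^bsub>K\<^esub> k)"
  have "card {u \<in> U. actU g u (inv\<^bsub>H\<^esub> h) = u} * card {v \<in> V. actV h v (inv\<^bsub>K\<^esub> k) = v} =
     card {y \<in> U \<times> V. (\<lambda>(u,v). (actU \<one>\<^bsub>G\<^esub> u (inv\<^bsub>H\<^esub> h), actV h v \<one>\<^bsub>K\<^esub>)) (?\<gamma> y) = y}"
    if h: "h \<in> carrier H" for h
  proof -
    have "{y \<in> U \<times> V. (\<lambda>(u,v). (actU \<one>\<^bsub>G\<^esub> u (inv\<^bsub>H\<^esub> h), actV h v \<one>\<^bsub>K\<^esub>)) (?\<gamma> y) = y} =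
      {u \<in> U. actU g u (inv\<^bsub>H\<^esub> h) = u} \<times> {v \<in> V. actV h v (inv\<^bsub>K\<^esub> k) = v}"
      using assms h by (auto simp: U.act_mult V.act_mult)
    then show ?thesis by (simp add: card_cartesian_product)
  qed
  then have "(\<Sum>h\<in>carrier H. card {u \<in> U. actU g u (inv\<^bsub>H\<^esub> h) = u} * card {v \<in> V. actV h v (inv\<^bsub>K\<^esub> k) = v}) =
    (\<Sum>h\<in>carrier H. card {y \<in> U \<times> V. (\<lambda>(u,v). (actU \<one>\<^bsub>G\<^esub> u (inv\<^bsub>H\<^esub> h), actV h v \<one>\<^bsub>K\<^esub>)) (?\<gamma> y) = y})"
    by simp
  also have "\<dots> = card (carrier H) * card {c \<in> M.orb ` (U \<times> V). ?\<gamma> ` c = c}"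
    using assms move_closed move_comm by (intro M.twisted_burnside) auto
  finally show ?thesis by (simp add: carr_eq comp_act_def)
qed

text \<open>The orbit of \<open>(u,v)\<close> is fixed by \<open>(g,k)\<close> when some
  \<open>h\<close> undoes the displacement in the middle, so stabilisers compose as relations. This
  is the star product of subgroups in the Mackey formula for bisets.\<close>

lemma stab_comp:
  assumes "u \<in> U" "v \<in> V"
  shows "C.A.stab (M.orb (u,v)) =
    {(g,k). \<exists>h\<in>carrier H. (g,h) \<in> U.A.stab u \<and> (h,k) \<in> V.A.stab v}"
proof -
  have "cact g (M.orb (u,v)) (inv\<^bsub>K\<^esub> k) = M.orb (u,v) \<longleftrightarrow>
      (\<exists>h\<in>carrier H. actU g u (inv\<^bsub>H\<^esub> h) = u \<and> actV h v (inv\<^bsub>K\<^esub> k) = v)"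
    if gk: "g \<in> carrier G" "k \<in> carrier K" for g k
  proof -
    let ?w = "move g (inv\<^bsub>K\<^esub> k) (u,v)"
    have w: "?w \<in> U \<times> V" "(u,v) \<in> U \<times> V" using gk assms move_closed[of g "inv\<^bsub>K\<^esub> k" "(u,v)"] by auto
    have "cact g (M.orb (u,v)) (inv\<^bsub>K\<^esub> k) = M.orb (u,v) \<longleftrightarrow> (u,v) \<in> M.orb ?w"
      using cact_orb[of g "inv\<^bsub>K\<^esub> k" "(u,v)"] gk assms M.orb_eq_iff[OF w] by auto
    also have "\<dots> \<longleftrightarrow> (\<exists>h\<in>carrier H. actU g u (inv\<^bsub>H\<^esub> h) = u \<and> actV h v (inv\<^bsub>K\<^esub> k) = v)"
      using gk assms by (auto simp: M.orb_def U.act_mult V.act_mult image_iff) metis+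
    finally show ?thesis .
  qed
  then show ?thesis by (auto simp: C.A.stab_def U.A.stab_def V.A.stab_def)
qed

end

section \<open>Transitive bisets\<close>

text \<open>The linear extension of the fixed point count of \<open>(g,h)\<close> on a biset;
  \<open>card_fixed\<close> is the source of the formula.\<close>

definition biset_char :: "('a,'m) monoid_scheme \<Rightarrow> ('b,'n) monoid_scheme \<Rightarrow> (('a \<times> 'b) set \<Rightarrow> 'k) \<Rightarrow> 'a \<Rightarrow> 'b \<Rightarrow> 'k::field_char_0" where
  "biset_char G H f g h = (\<Sum>C\<in>sg_classes (G \<times>\<times> H). f (rep C) * perm_char (G \<times>\<times> H) (rep C) (g,h))"

definition comp_class :: "('a,'m) monoid_scheme \<Rightarrow> ('b,'n) monoid_scheme \<Rightarrow> ('c,'o) monoid_scheme \<Rightarrow>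
    ('a \<times> 'b) set \<Rightarrow> ('b \<times> 'c) set \<Rightarrow> ('a \<times> 'c) set \<Rightarrow> 'k::field_char_0" where
  "comp_class G H K L L' = biset_class G K
     (comp_carrier G H K (coset_carrier G H L) (coset_act G H) (coset_carrier H K L') (coset_act H K))
     (comp_act G H K (coset_act G H) (coset_act H K))"

text \<open>A bilinear form, with no conjugation and no inverse in one argument: on permutation
  characters it is the usual inner product, and it is the average over the middle group that
  composition produces.\<close>

definition char_ip :: "('b,'n) monoid_scheme \<Rightarrow> ('b \<Rightarrow> 'k) \<Rightarrow> ('b \<Rightarrow> 'k) \<Rightarrow> 'k::field_char_0" where
  "char_ip H f f' = (\<Sum>h\<in>carrier H. f h * f' h) / of_nat (card (carrier H))"

definition prod_sg :: "('a,'m) monoid_scheme \<Rightarrow> ('b,'n) monoid_scheme \<Rightarrow> ('a \<times> 'b) set \<Rightarrow> bool" where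
  "prod_sg G H L \<longleftrightarrow> (\<exists>A B. subgroup A G \<and> subgroup B H \<and> L = A \<times> B)"

lemma bcomp_eq:
  "bcomp G H K f f' = (\<lambda>M. \<Sum>C\<in>sg_classes (G \<times>\<times> H). \<Sum>D\<in>sg_classes (H \<times>\<times> K).
      f (rep C) * f' (rep D) * comp_class G H K (rep C) (rep D) M)"
  by (simp add: bcomp_def comp_class_def)

lemma kB_zero: "(\<lambda>_. 0) \<in> kB G H" by (simp add: kB_def)

lemma kB_add: "f \<in> kB G H \<Longrightarrow> f' \<in> kB G H \<Longrightarrow> (\<lambda>L. f L + f' L) \<in> kB G H"
  unfolding kB_def by simp

lemma kB_scale: "f \<in> kB G H \<Longrightarrow> (\<lambda>L. c * f L) \<in> kB G H"
  unfolding kB_def by simp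

lemma kB_sum: "(\<And>i. i \<in> I \<Longrightarrow> f i \<in> kB G H) \<Longrightarrow> (\<lambda>L. \<Sum>i\<in>I. f i L) \<in> kB G H"
  by (induction I rule: infinite_finite_induct) (simp_all add: kB_zero kB_add)

lemma biset_char_sum: "biset_char G H (\<lambda>L. \<Sum>i\<in>I. c i * f i L) g h = (\<Sum>i\<in>I. c i * biset_char G H (f i) g h)"
  unfolding biset_char_def by (simp add: sum_distrib_left sum_distrib_right sum.swap[of _ I] mult.assoc)

lemma biset_char_sum': "biset_char G H (\<lambda>L. \<Sum>i\<in>I. f i L) g h = (\<Sum>i\<in>I. biset_char G H (f i) g h)"
  using biset_char_sum[of G H "\<lambda>_. 1" f I g h] by simp

lemma biset_char_add: "biset_char G H (\<lambda>L. f L + f' L) g h = biset_char G H f g h + biset_char G H f' g h"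
  unfolding biset_char_def by (simp add: algebra_simps sum.distrib)

lemma biset_char_diff: "biset_char G H (\<lambda>L. f L - f' L) g h = biset_char G H f g h - biset_char G H f' g h"
  unfolding biset_char_def by (simp add: algebra_simps sum_subtractf)

lemma biset_char_scale: "biset_char G H (\<lambda>L. c * f L) g h = c * biset_char G H f g h"
  unfolding biset_char_def by (simp add: sum_distrib_left mult.assoc)

lemma biset_char_zero: "biset_char G H (\<lambda>_. 0) g h = 0"
  by (simp add: biset_char_def)

lemma bcomp_sum_left:
  fixes f :: "'i \<Rightarrow> ('a \<times> 'b) set \<Rightarrow> 'k::field_char_0"
  shows "bcomp G H K (\<lambda>L. \<Sum>i\<in>I. c i * f i L) f' = (\<lambda>M. \<Sum>i\<in>I. c i * bcomp G H K (f i) f' M)"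
  unfolding bcomp_eq
  by (simp add: sum_distrib_left sum_distrib_right sum.swap[of _ I] mult.assoc)

lemma bcomp_sum_right:
  fixes f :: "('a \<times> 'b) set \<Rightarrow> 'k::field_char_0"
  shows "bcomp G H K f (\<lambda>L. \<Sum>i\<in>I. c i * f' i L) = (\<lambda>M. \<Sum>i\<in>I. c i * bcomp G H K f (f' i) M)"
  unfolding bcomp_eq
  by (simp add: sum_distrib_left sum_distrib_right sum.swap[of _ I] ac_simps)

lemma bcomp_diff_right:
  fixes f :: "('a \<times> 'b) set \<Rightarrow> 'k::field_char_0"
  shows "bcomp G H K f (\<lambda>L. x L - y L) = (\<lambda>M. bcomp G H K f x M - bcomp G H K f y M)"
  unfolding bcomp_eq by (simp add: algebra_simps sum_subtractf)

lemma bcomp_add_right: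
  fixes f :: "('a \<times> 'b) set \<Rightarrow> 'k::field_char_0"
  shows "bcomp G H K f (\<lambda>L. x L + y L) = (\<lambda>M. bcomp G H K f x M + bcomp G H K f y M)"
  unfolding bcomp_eq by (simp add: algebra_simps sum.distrib)

locale two_groups = G: fin_group G + H: fin_group H
  for G :: "('a,'m) monoid_scheme" and H :: "('b,'n) monoid_scheme"
begin

abbreviation "P \<equiv> G \<times>\<times> H"

sublocale P: fin_group "G \<times>\<times> H"
  by (rule fin_group_DirProd) unfold_locales

lemma coset_act_eq: "coset_act G H g C h = (g, inv\<^bsub>H\<^esub> h) <#\<^bsub>P\<^esub> C"
  by (auto simp: coset_act_def l_coset_def)

lemma coset_carrier_eq: "coset_carrier G H L = (\<lambda>z. z <#\<^bsub>P\<^esub> L) ` carrier P"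
  by (auto simp: coset_carrier_def)

lemma coset_biset:
  assumes "subgroup L P"
  shows "biset G H (coset_carrier G H L) (coset_act G H)"
proof unfold_locales
  have L: "L \<subseteq> carrier P" using assms subgroup.subset by blast
  show "finite (coset_carrier G H L)" unfolding coset_carrier_eq using P.fin by simp
  fix c assume "c \<in> coset_carrier G H L"
  then obtain z where z: "z \<in> carrier P" "c = z <#\<^bsub>P\<^esub> L" unfolding coset_carrier_eq by blast
  have c: "c \<subseteq> carrier P" using z L P.l_coset_subset_G by blast
  show "coset_act G H \<one>\<^bsub>G\<^esub> c \<one>\<^bsub>H\<^esub> = c"
    unfolding coset_act_eq using P.lcos_mult_one[OF c] by simp
  fix g h assume gh: "g \<in> carrier G" "h \<in> carrier H"
  then have "coset_act G H g c h = ((g, inv\<^bsub>H\<^esub> h) \<otimes>\<^bsub>P\<^esub> z) <#\<^bsub>P\<^esub> L"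
    unfolding coset_act_eq using z P.lcos_m_assoc[OF L, of "(g, inv\<^bsub>H\<^esub> h)" z] by simp
  moreover have "(g, inv\<^bsub>H\<^esub> h) \<otimes>\<^bsub>P\<^esub> z \<in> carrier P" using gh z by (intro P.m_closed) auto
  ultimately show "coset_act G H g c h \<in> coset_carrier G H L" unfolding coset_carrier_eq by blast
  fix g' h' assume gh': "g' \<in> carrier G" "h' \<in> carrier H"
  show "coset_act G H g (coset_act G H g' c h) h' = coset_act G H (g \<otimes>\<^bsub>G\<^esub> g') c (h \<otimes>\<^bsub>H\<^esub> h')"
    unfolding coset_act_eq using gh gh' c P.lcos_m_assoc[OF c, of "(g, inv\<^bsub>H\<^esub> h')" "(g', inv\<^bsub>H\<^esub> h)"]
    by (simp add: H.inv_mult_group)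
qed

context
  fixes L :: "('a \<times> 'b) set"
  assumes L: "subgroup L (G \<times>\<times> H)"
begin

interpretation B: biset G H "coset_carrier G H L" "coset_act G H" using L by (rule coset_biset)

lemma self_in_coset_carrier: "L \<in> coset_carrier G H L"
  unfolding coset_carrier_eq using P.lcos_mult_one[OF subgroup.subset[OF L]] P.one_closed
  by (metis image_eqI)

lemma act_self: "g \<in> carrier G \<Longrightarrow> h \<in> carrier H \<Longrightarrow> coset_act G H g C (inv\<^bsub>H\<^esub> h) = (g,h) <#\<^bsub>P\<^esub> C"
  by (simp add: coset_act_eq)

lemma stab_self: "B.A.stab L = L"
proof (intro Set.set_eqI iffI)
  fix p assume "p \<in> B.A.stab L"
  then have p: "p \<in> carrier P" "p <#\<^bsub>P\<^esub> L = L"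
    unfolding B.stab_eq biset_stab_def using act_self by auto
  then have "p \<otimes>\<^bsub>P\<^esub> \<one>\<^bsub>P\<^esub> \<in> L" using subgroup.one_closed[OF L] unfolding l_coset_def by blast
  then show "p \<in> L" using p P.r_one by metis
next
  fix p assume p: "p \<in> L"
  then have "p <#\<^bsub>P\<^esub> L = L" using P.coset_join3[OF _ L p] subgroup.subset[OF L] by blast
  then show "p \<in> B.A.stab L" using p subgroup.subset[OF L]
    unfolding B.stab_eq biset_stab_def by (cases p) (auto simp: act_self)
qed

lemma orb_self:
  assumes "c \<in> coset_carrier G H L" shows "c \<in> B.A.orb L"
proof -
  obtain g h where "g \<in> carrier G" "h \<in> carrier H" "c = (g,h) <#\<^bsub>P\<^esub> L"
    using assms unfolding coset_carrier_eq by auto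
  then show ?thesis unfolding B.A.orb_def using act_self[of g h L]
    by (intro image_eqI[of _ _ "(g,h)"]) auto
qed

lemma coset_stab_conj:
  assumes "c \<in> coset_carrier G H L" shows "sg_conj P L (B.A.stab c)"
  using B.conj_stab[OF self_in_coset_carrier orb_self[OF assms]] stab_self by simp

lemma coset_orbits: "B.A.orb ` coset_carrier G H L = {coset_carrier G H L}"
proof -
  have "B.A.orb c = B.A.orb L" if "c \<in> coset_carrier G H L" for c
    using B.A.orb_eq[OF self_in_coset_carrier orb_self[OF that]] .
  moreover have "B.A.orb L = coset_carrier G H L"
    using orb_self B.A.orb_subset[OF self_in_coset_carrier] by blast
  ultimately show ?thesis using self_in_coset_carrier by (auto simp: image_iff)
qed

text \<open>The coset biset is a single orbit whose stabilisers are conjugate to \<open>L\<close>,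
  so its class is the indicator of the conjugacy class of \<open>L\<close>.\<close>

lemma tr_apply: "tr G H L M = (if subgroup M P \<and> sg_conj P M L then 1 else (0::'k::field_char_0))"
proof -
  have "sg_conj P (B.A.stab c) L" if "c \<in> coset_carrier G H L" for c
    using P.sg_conj_sym[OF coset_stab_conj[OF that]] subgroup.subset[OF L] by blast
  then show ?thesis
    unfolding tr_def by (simp add: B.biset_class_isotypic[OF _ L] coset_orbits)
qed

lemma tr_in_kB: "tr G H L \<in> kB G H"
  unfolding tr_def by (rule B.biset_class_in_kB)

lemma coset_fixed:
  assumes "g \<in> carrier G" "h \<in> carrier H"
  shows "of_nat (card {c \<in> coset_carrier G H L. coset_act G H g c (inv\<^bsub>H\<^esub> h) = c}) =
    (perm_char P L (g,h) :: 'k::field_char_0)"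
proof -
  have "B.A.orb L = coset_carrier G H L"
    using orb_self B.A.orb_subset[OF self_in_coset_carrier] by blast
  then show ?thesis using B.card_fixed_in_orb[OF self_in_coset_carrier assms] stab_self by simp
qed

lemma biset_char_tr:
  "g \<in> carrier G \<Longrightarrow> h \<in> carrier H \<Longrightarrow> biset_char G H (tr G H L) g h = (perm_char P L (g,h) :: 'k::field_char_0)"
  unfolding biset_char_def tr_def by (simp add: B.card_fixed[symmetric] coset_fixed)

end

lemma tr_conj:
  assumes "subgroup L P" "sg_conj P L L'"
  shows "tr G H L' = (tr G H L :: _ \<Rightarrow> 'k::field_char_0)"
proof
  fix M
  have "L \<subseteq> carrier P" "L' \<subseteq> carrier P" using assms P.sg_conj_subgroup subgroup.subset by blast+
  then have "subgroup M P \<and> sg_conj P M L \<longleftrightarrow> subgroup M P \<and> sg_conj P M L'"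
    using assms P.sg_conj_trans[of M L L'] P.sg_conj_trans[of M L' L] P.sg_conj_sym[of L L'] subgroup.subset
    by blast
  then show "tr G H L' M = (tr G H L M :: 'k)"
    by (simp add: tr_apply[OF assms(1)] tr_apply[OF P.sg_conj_subgroup[OF assms(2,1)]])
qed

lemma tr_rep:
  assumes "subgroup L P" "C \<in> sg_classes P"
  shows "tr G H L (rep C) = (if C = cls P L then 1 else (0::'k::field_char_0))"
  using P.sg_conj_rep_iff[OF assms(2,1)] P.rep_subgroup[OF assms(2)] by (simp add: tr_apply[OF assms(1)])

lemma kB_conj: "f \<in> kB G H \<Longrightarrow> subgroup L P \<Longrightarrow> sg_conj P L L' \<Longrightarrow> f L' = f L"
  unfolding kB_def by auto

lemma kB_expand:
  assumes "f \<in> (kB G H :: (_ \<Rightarrow> 'k::field_char_0) set)"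
  shows "f = (\<lambda>M. \<Sum>C\<in>sg_classes P. f (rep C) * tr G H (rep C) M)"
proof
  fix M
  show "f M = (\<Sum>C\<in>sg_classes P. f (rep C) * tr G H (rep C) M)"
  proof (cases "subgroup M P")
    case True
    have "tr G H (rep C) M = (if C = cls P M then 1 else (0::'k))" if C: "C \<in> sg_classes P" for C
    proof -
      have "sg_conj P M (rep C) \<longleftrightarrow> C = cls P M"
        using P.sg_conj_rep_iff[OF C True]
          P.sg_conj_sym[of M "rep C"] P.sg_conj_sym[of "rep C" M] subgroup.subset[OF True]
          subgroup.subset[OF P.rep_subgroup[OF C]] by blast
      then show ?thesis using True by (simp add: tr_apply[OF P.rep_subgroup[OF C]])
    qed
    then have "(\<Sum>C\<in>sg_classes P. f (rep C) * tr G H (rep C) M) =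
      (\<Sum>C\<in>sg_classes P. if C = cls P M then f (rep C) else 0)" by (intro sum.cong) auto
    also have "\<dots> = f (rep (cls P M))"
      using P.finite_sg_classes P.cls_in_classes[OF True] by (simp add: sum.delta)
    also have "\<dots> = f M" using kB_conj[OF assms True P.rep_cls[OF True]] .
    finally show ?thesis by simp
  next
    case False
    then show ?thesis using assms by (simp add: kB_def tr_apply[OF P.rep_subgroup])
  qed
qed

lemma Times_subgroup:
  "subgroup A G \<Longrightarrow> subgroup B H \<Longrightarrow> subgroup (A \<times> B) P"
  using DirProd_subgroups[of G A H B] G.is_group H.is_group by blast

text \<open>Each factor is recovered as the slice through the identity of the other one.\<close>

lemma Times_subgroupD:
  assumes "subgroup (A \<times> B) P"
  shows "subgroup A G" "subgroup B H"
proof -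
  have one: "\<one>\<^bsub>G\<^esub> \<in> A" "\<one>\<^bsub>H\<^esub> \<in> B" using subgroup.one_closed[OF assms] by auto
  have sub: "A \<subseteq> carrier G" "B \<subseteq> carrier H" using subgroup.subset[OF assms] one by auto
  show "subgroup A G"
  proof (rule G.subgroupI)
    show "inv\<^bsub>G\<^esub> a \<in> A" if "a \<in> A" for a
      using subgroup.m_inv_closed[OF assms, of "(a, \<one>\<^bsub>H\<^esub>)"] one sub that by auto
    show "a \<otimes>\<^bsub>G\<^esub> b \<in> A" if "a \<in> A" "b \<in> A" for a b
      using subgroup.m_closed[OF assms, of "(a, \<one>\<^bsub>H\<^esub>)" "(b, \<one>\<^bsub>H\<^esub>)"] one that by auto
  qed (use one sub in auto)
  show "subgroup B H"
  proof (rule H.subgroupI)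
    show "inv\<^bsub>H\<^esub> a \<in> B" if "a \<in> B" for a
      using subgroup.m_inv_closed[OF assms, of "(\<one>\<^bsub>G\<^esub>, a)"] one sub that by auto
    show "a \<otimes>\<^bsub>H\<^esub> b \<in> B" if "a \<in> B" "b \<in> B" for a b
      using subgroup.m_closed[OF assms, of "(\<one>\<^bsub>G\<^esub>, a)" "(\<one>\<^bsub>G\<^esub>, b)"] one that by auto
  qed (use one sub in auto)
qed

lemma prod_sg_conj:
  assumes "prod_sg G H L" "sg_conj P L L'" shows "prod_sg G H L'"
proof -
  obtain A B where "subgroup A G" "subgroup B H" "L = A \<times> B" using assms(1) unfolding prod_sg_def by blast
  moreover then obtain A' B' where "sg_conj G A A'" "sg_conj H B B'" "L' = A' \<times> B'"
    using assms(2) sg_conj_Times_iff[OF G.is_group H.is_group, of A B L'] by blast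
  ultimately show ?thesis unfolding prod_sg_def using G.sg_conj_subgroup H.sg_conj_subgroup by blast
qed

end

section \<open>Characters of compositions and the identity biset\<close>

locale three_groups = GH: two_groups G H + HK: two_groups H K
  for G :: "('a,'m) monoid_scheme" and H :: "('b,'n) monoid_scheme" and K :: "('c,'o) monoid_scheme"
begin

sublocale GK: two_groups G K by unfold_locales

lemma composable_cosets:
  assumes "subgroup L (G \<times>\<times> H)" "subgroup L' (H \<times>\<times> K)"
  shows "composable G H K (coset_carrier G H L) (coset_act G H) (coset_carrier H K L') (coset_act H K)"
  unfolding composable_def using GH.coset_biset HK.coset_biset assms by blast

lemma card_H_pos: "(of_nat (card (carrier H)) :: 'k::field_char_0) \<noteq> 0"
  using GH.H.fin GH.H.one_closed by (auto simp: card_eq_0_iff)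

context
  fixes L :: "('a \<times> 'b) set" and L' :: "('b \<times> 'c) set"
  assumes L: "subgroup L (G \<times>\<times> H)" and L': "subgroup L' (H \<times>\<times> K)"
begin

interpretation C: composable G H K "coset_carrier G H L" "coset_act G H" "coset_carrier H K L'" "coset_act H K"
  using L L' by (rule composable_cosets)

lemma comp_class_in_kB: "comp_class G H K L L' \<in> kB G K"
  unfolding comp_class_def by (rule C.C.biset_class_in_kB)

lemma biset_char_comp_class:
  assumes "g \<in> carrier G" "k \<in> carrier K"
  shows "biset_char G K (comp_class G H K L L') g k =
    (\<Sum>h\<in>carrier H. perm_char (G \<times>\<times> H) L (g,h) * perm_char (H \<times>\<times> K) L' (h,k)) / (of_nat (card (carrier H)) :: 'k::field_char_0)"
proof -
  have "biset_char G K (comp_class G H K L L') g k = (of_nat (card {c \<in> C.carr. C.cact g c (inv\<^bsub>K\<^esub> k) = c}) :: 'k)"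
    unfolding biset_char_def comp_class_def using assms by (simp add: C.C.card_fixed)
  also have "\<dots> = of_nat (card (carrier H) * card {c \<in> C.carr. C.cact g c (inv\<^bsub>K\<^esub> k) = c}) / of_nat (card (carrier H))"
    using card_H_pos by simp
  also have "\<dots> = (\<Sum>h\<in>carrier H. of_nat (card {u \<in> coset_carrier G H L. coset_act G H g u (inv\<^bsub>H\<^esub> h) = u}) *
     of_nat (card {v \<in> coset_carrier H K L'. coset_act H K h v (inv\<^bsub>K\<^esub> k) = v})) / of_nat (card (carrier H))"
    unfolding C.card_fixed_comp[OF assms, symmetric] by simp
  also have "\<dots> = (\<Sum>h\<in>carrier H. perm_char (G \<times>\<times> H) L (g,h) * perm_char (H \<times>\<times> K) L' (h,k)) / of_nat (card (carrier H))"
    using assms by (simp add: GH.coset_fixed[OF L] HK.coset_fixed[OF L'])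
  finally show ?thesis .
qed

text \<open>The qualitative half of the Mackey formula: a constituent of a composite is an orbit,
  and \<open>S\<close>, \<open>T\<close> are the stabilisers of the two components of a point
  \<open>(u,v)\<close> representing it.\<close>

lemma comp_class_nonzeroD:
  assumes "comp_class G H K L L' M \<noteq> (0::'k::field_char_0)"
  obtains S T where "sg_conj (G \<times>\<times> H) L S" "sg_conj (H \<times>\<times> K) L' T"
    "sg_conj (G \<times>\<times> K) {(g,k). \<exists>h\<in>carrier H. (g,h) \<in> S \<and> (h,k) \<in> T} M"
    "subgroup {(g,k). \<exists>h\<in>carrier H. (g,h) \<in> S \<and> (h,k) \<in> T} (G \<times>\<times> K)"
proof -
  have M: "subgroup M (G \<times>\<times> K)" and
    "card {c \<in> C.C.A.orb ` C.carr. \<exists>x\<in>c. sg_conj (G \<times>\<times> K) M (C.C.A.stab x)} \<noteq> 0"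
    using assms unfolding comp_class_def C.C.biset_class_eq by (auto split: if_splits)
  then have "{c \<in> C.C.A.orb ` C.carr. \<exists>x\<in>c. sg_conj (G \<times>\<times> K) M (C.C.A.stab x)} \<noteq> {}"
    by (metis card.empty)
  then obtain c x where cx: "c \<in> C.C.A.orb ` C.carr" "x \<in> c" "sg_conj (G \<times>\<times> K) M (C.C.A.stab x)" by blast
  then have x: "x \<in> C.carr" using C.C.A.orb_subset by blast
  then obtain u v where uv: "u \<in> coset_carrier G H L" "v \<in> coset_carrier H K L'" "x = C.M.orb (u,v)"
    unfolding C.carr_eq by blast
  have st: "C.C.A.stab x = {(g,k). \<exists>h\<in>carrier H. (g,h) \<in> C.U.A.stab u \<and> (h,k) \<in> C.V.A.stab v}"
    using C.stab_comp uv by simp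
  show ?thesis
  proof
    show "sg_conj (G \<times>\<times> H) L (C.U.A.stab u)" using GH.coset_stab_conj[OF L uv(1)] .
    show "sg_conj (H \<times>\<times> K) L' (C.V.A.stab v)" using HK.coset_stab_conj[OF L' uv(2)] .
    show "sg_conj (G \<times>\<times> K) {(g,k). \<exists>h\<in>carrier H. (g,h) \<in> C.U.A.stab u \<and> (h,k) \<in> C.V.A.stab v} M"
      using GK.P.sg_conj_sym[OF cx(3) subgroup.subset[OF M]] unfolding st .
    show "subgroup {(g,k). \<exists>h\<in>carrier H. (g,h) \<in> C.U.A.stab u \<and> (h,k) \<in> C.V.A.stab v} (G \<times>\<times> K)"
      using C.C.A.stab_subgroup[OF x] unfolding st .
  qed
qed

text \<open>Once all relational composites of conjugates fall into one class, the composite is a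
  multiple of one transitive biset, the multiplicity being the number of its orbits.\<close>

lemma comp_class_isotypic:
  assumes S: "subgroup S (G \<times>\<times> K)"
    and iso: "\<And>L1 L1'. sg_conj (G \<times>\<times> H) L L1 \<Longrightarrow> sg_conj (H \<times>\<times> K) L' L1' \<Longrightarrow>
      sg_conj (G \<times>\<times> K) {(g,k). \<exists>h\<in>carrier H. (g,h) \<in> L1 \<and> (h,k) \<in> L1'} S"
  shows "comp_class G H K L L' = (\<lambda>M. of_nat (card (C.C.A.orb ` C.carr)) * (tr G K S M :: 'k::field_char_0))"
proof
  fix M
  have "sg_conj (G \<times>\<times> K) (C.C.A.stab x) S" if x: "x \<in> C.carr" for x
  proof -
    obtain u v where uv: "u \<in> coset_carrier G H L" "v \<in> coset_carrier H K L'" "x = C.M.orb (u,v)"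
      using x unfolding C.carr_eq by blast
    show ?thesis unfolding uv(3) C.stab_comp[OF uv(1,2)]
      using iso GH.coset_stab_conj[OF L uv(1)] HK.coset_stab_conj[OF L' uv(2)] by blast
  qed
  then show "comp_class G H K L L' M = of_nat (card (C.C.A.orb ` C.carr)) * (tr G K S M :: 'k)"
    unfolding comp_class_def GK.tr_apply[OF S] by (simp add: C.C.biset_class_isotypic[OF _ S])
qed

end

text \<open>Composing any relation with a rectangle \<open>A \<times> B\<close> gives a rectangle
  with second side \<open>B\<close>. This is why \<open>ideal_I\<close> is stable under left
  multiplication.\<close>

lemma comp_class_prod_sg:
  assumes L: "subgroup L (G \<times>\<times> H)" and L': "prod_sg H K L'" and nz: "comp_class G H K L L' M \<noteq> (0::'k::field_char_0)"
  shows "prod_sg G K M"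
proof -
  have sL': "subgroup L' (H \<times>\<times> K)" using L' HK.Times_subgroup unfolding prod_sg_def by blast
  obtain S T where ST: "sg_conj (H \<times>\<times> K) L' T"
    "sg_conj (G \<times>\<times> K) {(g,k). \<exists>h\<in>carrier H. (g,h) \<in> S \<and> (h,k) \<in> T} M"
    "subgroup {(g,k). \<exists>h\<in>carrier H. (g,h) \<in> S \<and> (h,k) \<in> T} (G \<times>\<times> K)"
    using comp_class_nonzeroD[OF L sL' nz] by blast
  obtain A B where AB: "T = A \<times> B" using HK.prod_sg_conj[OF L' ST(1)] unfolding prod_sg_def by blast
  have eq: "{(g,k). \<exists>h\<in>carrier H. (g,h) \<in> S \<and> (h,k) \<in> T} = {g. \<exists>h\<in>carrier H. (g,h) \<in> S \<and> h \<in> A} \<times> B"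
    using AB by auto
  have "prod_sg G K {(g,k). \<exists>h\<in>carrier H. (g,h) \<in> S \<and> (h,k) \<in> T}"
    using ST(3) GK.Times_subgroupD unfolding eq prod_sg_def by blast
  then show ?thesis using GK.prod_sg_conj ST(2) by blast
qed

text \<open>Rectangles compose to rectangles, up to conjugation \<open>A \<times> B'\<close>, so
  only an integer multiplicity is unknown. It is read off from the characters at the
  identity.\<close>

lemma comp_class_Times:
  assumes "subgroup A G" "subgroup B H" "subgroup A' H" "subgroup B' K"
  shows "comp_class G H K (A \<times> B) (A' \<times> B') =
    (\<lambda>M. char_ip H (perm_char H B) (perm_char H A') * (tr G K (A \<times> B') M :: 'k::field_char_0))"
proof -
  have s: "subgroup (A \<times> B) (G \<times>\<times> H)" "subgroup (A' \<times> B') (H \<times>\<times> K)" "subgroup (A \<times> B') (G \<times>\<times> K)"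
    using assms GH.Times_subgroup HK.Times_subgroup GK.Times_subgroup by blast+
  have "sg_conj (G \<times>\<times> K) {(g,k). \<exists>h\<in>carrier H. (g,h) \<in> L1 \<and> (h,k) \<in> L1'} (A \<times> B')"
    if c: "sg_conj (G \<times>\<times> H) (A \<times> B) L1" "sg_conj (H \<times>\<times> K) (A' \<times> B') L1'" for L1 L1'
  proof -
    obtain A1 B1 where 1: "sg_conj G A A1" "sg_conj H B B1" "L1 = A1 \<times> B1"
      using c(1) sg_conj_Times_iff[OF GH.G.is_group GH.H.is_group] by metis
    obtain A1' B1' where 2: "sg_conj H A' A1'" "sg_conj K B' B1'" "L1' = A1' \<times> B1'"
      using c(2) sg_conj_Times_iff[OF GH.H.is_group HK.H.is_group] by metis
    \<comment> \<open>Both middle sides contain the identity, so the two rectangles always meet and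
      compose to the full rectangle \<open>A1 \<times> B1'\<close>.\<close>
    have "\<one>\<^bsub>H\<^esub> \<in> B1" "\<one>\<^bsub>H\<^esub> \<in> A1'"
      using 1 2 GH.H.sg_conj_subgroup assms subgroup.one_closed by blast+
    then have "{(g,k). \<exists>h\<in>carrier H. (g,h) \<in> L1 \<and> (h,k) \<in> L1'} = A1 \<times> B1'" using 1 2 by auto
    moreover have "sg_conj (G \<times>\<times> K) (A \<times> B') (A1 \<times> B1')"
      using sg_conj_Times_iff[OF GH.G.is_group HK.H.is_group] 1 2 by blast
    ultimately show ?thesis using GK.P.sg_conj_sym subgroup.subset[OF s(3)] by simp
  qed
  then obtain N :: nat where N: "comp_class G H K (A \<times> B) (A' \<times> B') = (\<lambda>M. of_nat N * (tr G K (A \<times> B') M :: 'k))"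
    using comp_class_isotypic[OF s] by blast
  have one: "\<one>\<^bsub>G\<^esub> \<in> carrier G" "\<one>\<^bsub>K\<^esub> \<in> carrier K" by simp_all
  have pos: "perm_char G A \<one>\<^bsub>G\<^esub> * perm_char K B' \<one>\<^bsub>K\<^esub> \<noteq> (0::'k)"
  proof -
    have "{z \<in> carrier G. inv\<^bsub>G\<^esub> z \<otimes>\<^bsub>G\<^esub> \<one>\<^bsub>G\<^esub> \<otimes>\<^bsub>G\<^esub> z \<in> A} = carrier G"
      using subgroup.one_closed[OF assms(1)] by auto
    moreover have "{z \<in> carrier K. inv\<^bsub>K\<^esub> z \<otimes>\<^bsub>K\<^esub> \<one>\<^bsub>K\<^esub> \<otimes>\<^bsub>K\<^esub> z \<in> B'} = carrier K"
      using subgroup.one_closed[OF assms(4)] by auto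
    moreover have "card (carrier G) > 0" "card (carrier K) > 0"
      using GH.G.card_subgroup_pos[OF GH.G.subgroup_self] HK.H.card_subgroup_pos[OF HK.H.subgroup_self] .
    ultimately show ?thesis
      unfolding perm_char_def
      using GH.G.card_subgroup_pos[OF assms(1)] HK.H.card_subgroup_pos[OF assms(4)] by simp
  qed
  \<comment> \<open>The character of the composite is evaluated at the pair of identities in two
    ways; the common factor is the product of the indices of \<open>A\<close> and \<open>B'\<close>,
    which \<open>pos\<close> allows to cancel.\<close>
  have "of_nat N * (perm_char G A \<one>\<^bsub>G\<^esub> * perm_char K B' \<one>\<^bsub>K\<^esub>) =
     (biset_char G K (comp_class G H K (A \<times> B) (A' \<times> B')) \<one>\<^bsub>G\<^esub> \<one>\<^bsub>K\<^esub> :: 'k)"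
    unfolding N biset_char_scale using one
    by (simp add: GK.biset_char_tr[OF s(3)] perm_char_Times[OF GH.G.fin_group_axioms HK.H.fin_group_axioms])
  also have "\<dots> = (\<Sum>h\<in>carrier H. perm_char G A \<one>\<^bsub>G\<^esub> * perm_char H B h * (perm_char H A' h * perm_char K B' \<one>\<^bsub>K\<^esub>))
      / of_nat (card (carrier H))"
    unfolding biset_char_comp_class[OF s(1,2) one] using one
    by (simp add: perm_char_Times[OF GH.G.fin_group_axioms GH.H.fin_group_axioms]
       perm_char_Times[OF GH.H.fin_group_axioms HK.H.fin_group_axioms])
  also have "\<dots> = char_ip H (perm_char H B) (perm_char H A') * (perm_char G A \<one>\<^bsub>G\<^esub> * perm_char K B' \<one>\<^bsub>K\<^esub>)"
    unfolding char_ip_def by (simp add: sum_distrib_left sum_distrib_right ac_simps)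
  finally have "of_nat N = char_ip H (perm_char H B) (perm_char H A' :: _ \<Rightarrow> 'k)" using pos by simp
  then show ?thesis using N by simp
qed

lemma bcomp_in_kB: "bcomp G H K f f' \<in> (kB G K :: (_ \<Rightarrow> 'k::field_char_0) set)"
  unfolding bcomp_eq
  by (intro kB_sum kB_scale comp_class_in_kB GH.P.rep_subgroup HK.P.rep_subgroup)

text \<open>For transitive bisets this is \<open>card_fixed_comp\<close> divided by the order of the
  middle group; bilinearity does the rest. Composition becomes a normalised product of matrices
  indexed by group elements.\<close>

lemma biset_char_bcomp:
  assumes "g \<in> carrier G" "k \<in> carrier K"
  shows "biset_char G K (bcomp G H K f f') g k =
    (\<Sum>h\<in>carrier H. biset_char G H f g h * biset_char H K f' h k) / (of_nat (card (carrier H)) :: 'k::field_char_0)"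
proof -
  have "biset_char G K (bcomp G H K f f') g k =
    (\<Sum>C\<in>sg_classes (G \<times>\<times> H). \<Sum>D\<in>sg_classes (H \<times>\<times> K). f (rep C) * f' (rep D) * biset_char G K (comp_class G H K (rep C) (rep D)) g k)"
    unfolding bcomp_eq by (simp add: biset_char_sum' biset_char_scale)
  also have "\<dots> = (\<Sum>C\<in>sg_classes (G \<times>\<times> H). \<Sum>D\<in>sg_classes (H \<times>\<times> K). f (rep C) * f' (rep D) *
    ((\<Sum>h\<in>carrier H. perm_char (G \<times>\<times> H) (rep C) (g,h) * perm_char (H \<times>\<times> K) (rep D) (h,k)) / of_nat (card (carrier H))))"
    using assms by (intro sum.cong refl) (simp add: biset_char_comp_class GH.P.rep_subgroup HK.P.rep_subgroup)
  also have "\<dots> = (\<Sum>C\<in>sg_classes (G \<times>\<times> H). \<Sum>D\<in>sg_classes (H \<times>\<times> K). \<Sum>h\<in>carrier H.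
     (f (rep C) * perm_char (G \<times>\<times> H) (rep C) (g,h)) * (f' (rep D) * perm_char (H \<times>\<times> K) (rep D) (h,k)))
      / of_nat (card (carrier H))"
    by (simp add: sum_divide_distrib sum_distrib_left ac_simps)
  also have "\<dots> = (\<Sum>h\<in>carrier H. \<Sum>C\<in>sg_classes (G \<times>\<times> H). \<Sum>D\<in>sg_classes (H \<times>\<times> K).
     (f (rep C) * perm_char (G \<times>\<times> H) (rep C) (g,h)) * (f' (rep D) * perm_char (H \<times>\<times> K) (rep D) (h,k)))
      / of_nat (card (carrier H))"
    by (simp only: sum.swap[where A = "sg_classes (H \<times>\<times> K)" and B = "carrier H"]
        sum.swap[where A = "sg_classes (G \<times>\<times> H)" and B = "carrier H"])
  also have "\<dots> = (\<Sum>h\<in>carrier H. biset_char G H f g h * biset_char H K f' h k) / of_nat (card (carrier H))"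
    unfolding biset_char_def by (simp add: sum_product)
  finally show ?thesis .
qed

text \<open>\<open>tr\<close> is nonzero at just one representative, so one term of the double sum
  survives. Since \<open>bcomp\<close> reads subgroups through \<open>rep\<close>, the result
  involves the representatives instead of \<open>L\<close> and \<open>L'\<close>.\<close>

lemma bcomp_tr:
  assumes "subgroup L (G \<times>\<times> H)" "subgroup L' (H \<times>\<times> K)"
  shows "bcomp G H K (tr G H L) (tr H K L') =
    (comp_class G H K (rep (cls (G \<times>\<times> H) L)) (rep (cls (H \<times>\<times> K) L')) :: _ \<Rightarrow> 'k::field_char_0)"
proof
  fix M
  have "bcomp G H K (tr G H L) (tr H K L') M = (\<Sum>C\<in>sg_classes (G \<times>\<times> H). \<Sum>D\<in>sg_classes (H \<times>\<times> K).
     if D = cls (H \<times>\<times> K) L' then if C = cls (G \<times>\<times> H) L then comp_class G H K (rep C) (rep D) M else (0::'k) else 0)"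
    unfolding bcomp_eq by (intro sum.cong refl) (simp add: GH.tr_rep[OF assms(1)] HK.tr_rep[OF assms(2)])
  also have "\<dots> = comp_class G H K (rep (cls (G \<times>\<times> H) L)) (rep (cls (H \<times>\<times> K) L')) M"
    using GH.P.finite_sg_classes HK.P.finite_sg_classes GH.P.cls_in_classes[OF assms(1)] HK.P.cls_in_classes[OF assms(2)]
    by (simp add: sum.delta)
  finally show "bcomp G H K (tr G H L) (tr H K L') M =
    (comp_class G H K (rep (cls (G \<times>\<times> H) L)) (rep (cls (H \<times>\<times> K) L')) M :: 'k)" .
qed

text \<open>The representatives replace the four subgroups by conjugates, under which permutation
  characters and \<open>tr\<close> are invariant. The resulting rule is that of a Munn algebra whose
  sandwich matrix is the table of pairings of permutation characters.\<close>

lemma bcomp_tr_Times: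
  assumes "subgroup A G" "subgroup B H" "subgroup A' H" "subgroup B' K"
  shows "bcomp G H K (tr G H (A \<times> B)) (tr H K (A' \<times> B')) =
    (\<lambda>M. char_ip H (perm_char H B) (perm_char H A') * (tr G K (A \<times> B') M :: 'k::field_char_0))"
proof -
  have s: "subgroup (A \<times> B) (G \<times>\<times> H)" "subgroup (A' \<times> B') (H \<times>\<times> K)" "subgroup (A \<times> B') (G \<times>\<times> K)"
    using assms GH.Times_subgroup HK.Times_subgroup GK.Times_subgroup by blast+
  obtain A1 B1 where 1: "sg_conj G A A1" "sg_conj H B B1" "rep (cls (G \<times>\<times> H) (A \<times> B)) = A1 \<times> B1"
    using GH.P.rep_cls[OF s(1)] sg_conj_Times_iff[OF GH.G.is_group GH.H.is_group] by metis
  obtain A1' B1' where 2: "sg_conj H A' A1'" "sg_conj K B' B1'" "rep (cls (H \<times>\<times> K) (A' \<times> B')) = A1' \<times> B1'"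
    using HK.P.rep_cls[OF s(2)] sg_conj_Times_iff[OF GH.H.is_group HK.H.is_group] by metis
  have sub: "subgroup A1 G" "subgroup B1 H" "subgroup A1' H" "subgroup B1' K"
    using 1 2 assms GH.G.sg_conj_subgroup GH.H.sg_conj_subgroup HK.H.sg_conj_subgroup by blast+
  have "sg_conj (G \<times>\<times> K) (A \<times> B') (A1 \<times> B1')"
    using sg_conj_Times_iff[OF GH.G.is_group HK.H.is_group] 1 2 by blast
  then have "tr G K (A1 \<times> B1') = (tr G K (A \<times> B') :: _ \<Rightarrow> 'k)" using GK.tr_conj[OF s(3)] by blast
  moreover have "char_ip H (perm_char H B1) (perm_char H A1') = (char_ip H (perm_char H B) (perm_char H A') :: 'k)"
    unfolding char_ip_def
    by (simp add: GH.H.perm_char_conj[OF assms(2) 1(2)] GH.H.perm_char_conj[OF assms(3) 2(1)])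
  ultimately show ?thesis
    unfolding bcomp_tr[OF s(1,2)] 1(3) 2(3) comp_class_Times[OF sub] by simp
qed

end

section \<open>The diagonal biset, a group acting on itself from both sides, as right
  identity\<close>

definition diag :: "('a,'m) monoid_scheme \<Rightarrow> ('a \<times> 'a) set" where
  "diag G = (\<lambda>g. (g,g)) ` carrier G"

lemma (in fin_group) diag_subgroup: "subgroup (diag P) (P \<times>\<times> P)"
proof -
  interpret PP: group "P \<times>\<times> P" by (rule DirProd_group) unfold_locales
  show ?thesis by (rule PP.subgroupI) (auto simp: diag_def)
qed

context two_groups
begin

interpretation T: three_groups G H H by unfold_locales

text \<open>A point \<open>v0\<close> with diagonal stabiliser plays the role of 1 in
  \<open>H\<close>, and every class of the composite has exactly one member of the form
  \<open>(u,v0)\<close>. The subgroup \<open>D\<close> is a conjugate of the diagonal because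
  \<open>bcomp_tr\<close> hands over a class representative.\<close>

lemma comp_class_diag:
  assumes L: "subgroup L P" and conj: "sg_conj (H \<times>\<times> H) (diag H) D"
  shows "comp_class G H H L D = (tr G H L :: _ \<Rightarrow> 'k::field_char_0)"
proof -
  have sD: "subgroup D (H \<times>\<times> H)" using conj H.diag_subgroup T.HK.P.sg_conj_subgroup by blast
  interpret C: composable G H H "coset_carrier G H L" "coset_act G H" "coset_carrier H H D" "coset_act H H"
    using L sD by (rule T.composable_cosets)
  let ?aV = "coset_act H H" and ?aU = "coset_act G H"
  obtain z where z: "z \<in> carrier (H \<times>\<times> H)" "diag H = conj_sg (H \<times>\<times> H) z D"
    using T.HK.P.sg_conj_sym[OF conj subgroup.subset[OF H.diag_subgroup]] unfolding sg_conj_iff by blast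
  \<comment> \<open>The coset \<open>D\<close> has stabiliser \<open>D\<close>; moving it by
    \<open>z\<close> conjugates the stabiliser into the diagonal.\<close>
  define v0 where "v0 = (\<lambda>(g,h) x. ?aV g x (inv\<^bsub>H\<^esub> h)) z D"
  have v0: "v0 \<in> coset_carrier H H D"
    unfolding v0_def using C.V.A.closed[OF z(1) T.HK.self_in_coset_carrier[OF sD]] .
  have st: "C.V.A.stab v0 = diag H"
    unfolding v0_def C.V.A.stab_act[OF T.HK.self_in_coset_carrier[OF sD] z(1)] T.HK.stab_self[OF sD]
    using z(2) by (simp add: conj_sg_def)
  have comm: "?aV h v0 (inv\<^bsub>H\<^esub> k) = v0 \<longleftrightarrow> h = k" if "h \<in> carrier H" "k \<in> carrier H" for h k
  proof -
    have "(h,k) \<in> C.V.A.stab v0 \<longleftrightarrow> ?aV h v0 (inv\<^bsub>H\<^esub> k) = v0" using that by (simp add: C.V.A.stab_def)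
    then show ?thesis unfolding st using that by (auto simp: diag_def)
  qed
  \<comment> \<open>As for 1 in \<open>H\<close>, acting on \<open>v0\<close> from the right is the
    same as acting from the left, so group elements can be carried across \<open>v0\<close>.\<close>
  have comm': "?aV a v0 b = ?aV (a \<otimes>\<^bsub>H\<^esub> b) v0 \<one>\<^bsub>H\<^esub>" if ab: "a \<in> carrier H" "b \<in> carrier H" for a b
  proof -
    have "?aV a v0 b = ?aV a (?aV b v0 (inv\<^bsub>H\<^esub> b)) b" using comm[of b b] ab by simp
    also have "\<dots> = ?aV (a \<otimes>\<^bsub>H\<^esub> b) v0 \<one>\<^bsub>H\<^esub>" using C.V.act_mult ab v0 by simp
    finally show ?thesis .
  qed
  have orbV: "\<exists>c\<in>carrier H. v = ?aV c v0 \<one>\<^bsub>H\<^esub>" if v: "v \<in> coset_carrier H H D" for v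
  proof -
    have "v \<in> C.V.A.orb v0"
      using T.HK.orb_self[OF sD v] C.V.A.orb_eq[OF T.HK.self_in_coset_carrier[OF sD] T.HK.orb_self[OF sD v0]] by simp
    then obtain a b where ab: "a \<in> carrier H" "b \<in> carrier H" "v = ?aV a v0 (inv\<^bsub>H\<^esub> b)"
      by (auto simp: C.V.A.orb_def)
    then have "v = ?aV (a \<otimes>\<^bsub>H\<^esub> inv\<^bsub>H\<^esub> b) v0 \<one>\<^bsub>H\<^esub>" using comm'[of a "inv\<^bsub>H\<^esub> b"] by simp
    then show ?thesis using ab by blast
  qed
  \<comment> \<open>This is the balancing relation \<open>(u h, v) ~ (u, h v)\<close>, read as an
    equality of orbits.\<close>
  have slide: "C.M.orb (?aU \<one>\<^bsub>G\<^esub> u h, v) = C.M.orb (u, ?aV h v \<one>\<^bsub>H\<^esub>)"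
    if "u \<in> coset_carrier G H L" "v \<in> coset_carrier H H D" "h \<in> carrier H" for u v h
  proof -
    have "(u, ?aV h v \<one>\<^bsub>H\<^esub>) = (\<lambda>(u,v). (?aU \<one>\<^bsub>G\<^esub> u (inv\<^bsub>H\<^esub> h), ?aV h v \<one>\<^bsub>H\<^esub>)) (?aU \<one>\<^bsub>G\<^esub> u h, v)"
      using that by (simp add: C.U.act_mult C.U.act_one)
    then have "(u, ?aV h v \<one>\<^bsub>H\<^esub>) \<in> C.M.orb (?aU \<one>\<^bsub>G\<^esub> u h, v)"
      unfolding C.M.orb_def using that(3) by (rule image_eqI)
    then show ?thesis using C.M.orb_eq[of "(?aU \<one>\<^bsub>G\<^esub> u h, v)"] that C.U.act_closed by simp
  qed
  let ?\<phi> = "\<lambda>u. C.M.orb (u, v0)"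
  have bij: "bij_betw ?\<phi> (coset_carrier G H L) C.carr"
  proof (rule bij_betw_imageI)
    show "inj_on ?\<phi> (coset_carrier G H L)"
    proof (rule inj_onI)
      fix u u' assume u: "u \<in> coset_carrier G H L" "u' \<in> coset_carrier G H L" "C.M.orb (u, v0) = C.M.orb (u', v0)"
      then have "(u', v0) \<in> C.M.orb (u, v0)" using C.M.orb_refl[of "(u',v0)"] v0 by simp
      then obtain h where h: "h \<in> carrier H" "u' = ?aU \<one>\<^bsub>G\<^esub> u (inv\<^bsub>H\<^esub> h)" "v0 = ?aV h v0 \<one>\<^bsub>H\<^esub>"
        by (auto simp: C.M.orb_def)
      then have "h = \<one>\<^bsub>H\<^esub>" using comm[of h "\<one>\<^bsub>H\<^esub>"] by simp
      then show "u = u'" using h u C.U.act_one by simp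
    qed
    show "?\<phi> ` coset_carrier G H L = C.carr"
    proof
      show "?\<phi> ` coset_carrier G H L \<subseteq> C.carr" unfolding C.carr_eq using v0 by blast
      show "C.carr \<subseteq> ?\<phi> ` coset_carrier G H L"
      proof
        fix x assume "x \<in> C.carr"
        then obtain u v where uv: "u \<in> coset_carrier G H L" "v \<in> coset_carrier H H D" "x = C.M.orb (u,v)"
          unfolding C.carr_eq by blast
        obtain c where c: "c \<in> carrier H" "v = ?aV c v0 \<one>\<^bsub>H\<^esub>" using orbV uv by blast
        then have "x = ?\<phi> (?aU \<one>\<^bsub>G\<^esub> u c)" using slide[OF uv(1) v0 c(1)] uv by simp
        moreover have "?aU \<one>\<^bsub>G\<^esub> u c \<in> coset_carrier G H L" using C.U.act_closed uv c by simp
        ultimately show "x \<in> ?\<phi> ` coset_carrier G H L" by blast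
      qed
    qed
  qed
  have "?\<phi> (?aU g u h) = C.cact g (?\<phi> u) h"
    if gh: "g \<in> carrier G" "u \<in> coset_carrier G H L" "h \<in> carrier H" for g u h
  proof -
    have gu: "?aU g u \<one>\<^bsub>H\<^esub> \<in> coset_carrier G H L" using C.U.act_closed gh by simp
    have "?\<phi> (?aU g u h) = C.M.orb (?aU \<one>\<^bsub>G\<^esub> (?aU g u \<one>\<^bsub>H\<^esub>) h, v0)" using gh C.U.act_mult by simp
    also have "\<dots> = C.M.orb (?aU g u \<one>\<^bsub>H\<^esub>, ?aV \<one>\<^bsub>H\<^esub> v0 h)" using slide[OF gu v0 gh(3)] comm'[of "\<one>\<^bsub>H\<^esub>" h] gh by simp
    also have "\<dots> = C.cact g (?\<phi> u) h" using C.cact_orb[of g h "(u,v0)"] gh v0 by simp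
    finally show ?thesis .
  qed
  then show ?thesis
    unfolding comp_class_def tr_def
    using biset_class_iso[OF C.U.biset_axioms C.C.biset_axioms bij] by blast
qed

text \<open>A right identity fits the arguments with left ideals: a left ideal that contains it
  contains \<open>r = r e\<close> for every \<open>r\<close>.\<close>

lemma bcomp_diag:
  assumes "f \<in> (kB G H :: (_ \<Rightarrow> 'k::field_char_0) set)"
  shows "bcomp G H H f (tr H H (diag H)) = f"
proof -
  have 1: "bcomp G H H (tr G H (rep C)) (tr H H (diag H)) = (tr G H (rep C) :: _ \<Rightarrow> 'k)"
    if C: "C \<in> sg_classes P" for C
  proof -
    have s: "subgroup (rep C) P" using P.rep_subgroup[OF C] .
    show ?thesis unfolding T.bcomp_tr[OF s H.diag_subgroup]
      using comp_class_diag[OF P.rep_subgroup[OF P.cls_in_classes[OF s]] T.HK.P.rep_cls[OF H.diag_subgroup]]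
      using tr_conj[OF s P.rep_cls[OF s]] by metis
  qed
  have "bcomp G H H f (tr H H (diag H)) =
    bcomp G H H (\<lambda>M. \<Sum>C\<in>sg_classes P. f (rep C) * tr G H (rep C) M) (tr H H (diag H))"
    using kB_expand[OF assms] by simp
  also have "\<dots> = (\<lambda>M. \<Sum>C\<in>sg_classes P. f (rep C) * tr G H (rep C) M)"
    unfolding bcomp_sum_left using 1 by simp
  also have "\<dots> = f" using kB_expand[OF assms] by simp
  finally show ?thesis .
qed

end

section \<open>Cyclic subgroups and permutation characters\<close>

lemma char_ip_sum_left: "char_ip H (\<lambda>h. \<Sum>i\<in>I. c i * f i h) f' = (\<Sum>i\<in>I. c i * char_ip H (f i) f')"
  unfolding char_ip_def by (simp add: sum_divide_distrib sum_distrib_left sum_distrib_right sum.swap[of _ I] mult.assoc)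

lemma char_ip_sym: "char_ip H f f' = char_ip H f' f"
  unfolding char_ip_def by (simp add: mult.commute)

lemma char_ip_sum_right: "char_ip H f' (\<lambda>h. \<Sum>i\<in>I. c i * f i h) = (\<Sum>i\<in>I. c i * char_ip H f' (f i))"
  unfolding char_ip_sym[of H f'] by (rule char_ip_sum_left)

lemma char_ip_cong: "(\<And>h. h \<in> carrier H \<Longrightarrow> f h = f1 h) \<Longrightarrow> (\<And>h. h \<in> carrier H \<Longrightarrow> f' h = f1' h) \<Longrightarrow> char_ip H f f' = char_ip H f1 f1'"
  unfolding char_ip_def by simp

context fin_group
begin

definition cyc_classes :: "'a set set set" where "cyc_classes = {C \<in> sg_classes P. cyclic_sg P (rep C)}"

abbreviation rep_char :: "'a set set \<Rightarrow> 'a \<Rightarrow> 'k::field_char_0" where "rep_char C \<equiv> perm_char P (rep C)"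

text \<open>Over the rationals these are the functions spanned by the characters of rational
  representations. The space is the concrete model of \<open>S_{1,k}\<close>, as
  \<open>J1_iff\<close> and \<open>cyc_classes_span\<close> show.\<close>

definition cyclic_cf :: "('a \<Rightarrow> 'k) \<Rightarrow> bool" where
  "cyclic_cf f \<longleftrightarrow> (\<forall>g\<in>carrier P. \<forall>h\<in>carrier P. sg_conj P (generate P {g}) (generate P {h}) \<longrightarrow> f g = f h)"

lemma finite_cyc: "finite cyc_classes" using finite_sg_classes by (simp add: cyc_classes_def)

lemma cycD: "C \<in> cyc_classes \<Longrightarrow> C \<in> sg_classes P \<and> subgroup (rep C) P \<and> cyclic_sg P (rep C)"
  using rep_subgroup by (auto simp: cyc_classes_def)

lemma cls_in_cyc_iff:
  assumes "subgroup A P" shows "cls P A \<in> cyc_classes \<longleftrightarrow> cyclic_sg P A"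
  using cyclic_sg_conj[of A "rep (cls P A)"] cyclic_sg_conj[of "rep (cls P A)" A] rep_cls[OF assms]
    sg_conj_sym[of A "rep (cls P A)"] subgroup.subset[OF assms] cls_in_classes[OF assms]
  unfolding cyc_classes_def by blast

lemma cls_generate_in_cyc: "g \<in> carrier P \<Longrightarrow> cls P (generate P {g}) \<in> cyc_classes"
  using cls_in_cyc_iff[OF generate_subgroup] by (auto simp: cyclic_sg_def)

lemma perm_char_cf: "subgroup A P \<Longrightarrow> cyclic_cf (perm_char P A :: _ \<Rightarrow> 'k::field_char_0)"
  unfolding cyclic_cf_def by (intro ballI impI perm_char_generate_conj[symmetric])

text \<open>Evaluation points, one for each class of cyclic subgroups: by
  \<open>cyclic_cf_gen\<close> the values there determine a function in the space.\<close>

definition gen :: "'a set set \<Rightarrow> 'a" where "gen C = (SOME c. c \<in> carrier P \<and> rep C = generate P {c})"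

lemma gen: assumes "C \<in> cyc_classes" shows "gen C \<in> carrier P" "generate P {gen C} = rep C"
proof -
  have "\<exists>c. c \<in> carrier P \<and> rep C = generate P {c}" using cycD[OF assms] by (auto simp: cyclic_sg_def)
  from someI_ex[OF this] show "gen C \<in> carrier P" "generate P {gen C} = rep C" by (auto simp: gen_def)
qed

lemma cls_gen: "C \<in> cyc_classes \<Longrightarrow> cls P (generate P {gen C}) = C"
  using gen cls_rep cycD by simp

lemma cyclic_cf_gen:
  assumes "cyclic_cf f" "g \<in> carrier P"
  shows "f g = f (gen (cls P (generate P {g})))"
proof -
  let ?C = "cls P (generate P {g})"
  have C: "?C \<in> cyc_classes" using cls_generate_in_cyc assms by blast
  have "sg_conj P (generate P {g}) (generate P {gen ?C})"
    using rep_cls[OF generate_subgroup[OF assms(2)]] gen(2)[OF C] by simp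
  then show ?thesis using assms gen(1)[OF C] unfolding cyclic_cf_def by blast
qed

lemma rep_char_eq_gen:
  "C \<in> cyc_classes \<Longrightarrow> g \<in> carrier P \<Longrightarrow> rep_char C (gen (cls P (generate P {g}))) = (rep_char C g :: 'k::field_char_0)"
  using cycD[of C] by (intro cyclic_cf_gen[where f = "rep_char C", symmetric] perm_char_cf) blast+

lemma rep_char_gen_nonzero: "C \<in> cyc_classes \<Longrightarrow> rep_char C (gen C) \<noteq> (0::'k::field_char_0)"
  using perm_char_generator_nonzero[OF gen(1)[of C]] gen(2)[of C] by simp

text \<open>A nonzero value puts \<open>generate P {g}\<close> inside a conjugate of
  \<open>rep C\<close>. Hence the table of these characters at the generators is triangular with
  respect to subgroup order; its diagonal is nonzero by \<open>rep_char_gen_nonzero\<close>.\<close>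

lemma rep_char_nonzero_card:
  assumes "C \<in> cyc_classes" "g \<in> carrier P" "rep_char C g \<noteq> (0::'k::field_char_0)"
  shows "card (generate P {g}) \<le> card (rep C)"
    and "card (generate P {g}) = card (rep C) \<Longrightarrow> C = cls P (generate P {g})"
proof -
  have s: "subgroup (rep C) P" using cycD assms by blast
  obtain z where z: "z \<in> carrier P" "generate P {g} \<subseteq> conj_sg P z (rep C)"
    by (rule perm_char_nonzeroD[OF s assms(2,3)])
  have fin': "finite (conj_sg P z (rep C))" using finite_subset[OF conj_sg_subset[OF z(1) subgroup.subset[OF s]] fin] .
  have eq: "card (conj_sg P z (rep C)) = card (rep C)" using card_cj[OF z(1) subgroup.subset[OF s]] .
  show "card (generate P {g}) \<le> card (rep C)" using card_mono[OF fin' z(2)] eq by simp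
  show "C = cls P (generate P {g})" if "card (generate P {g}) = card (rep C)"
  proof -
    have "generate P {g} = conj_sg P z (rep C)" using card_subset_eq[OF fin' z(2)] eq that by simp
    then have "sg_conj P (rep C) (generate P {g})" using z(1) unfolding sg_conj_iff by blast
    then show ?thesis
      using sg_conj_rep_iff[OF _ generate_subgroup[OF assms(2)]] cycD[OF assms(1)] by blast
  qed
qed

text \<open>Among the classes with nonzero coefficient one of maximal order is taken, and the
  relation is evaluated at its generator: by triangularity only its own term survives.\<close>

lemma cyc_classes_indep:
  assumes z: "\<And>g. g \<in> carrier P \<Longrightarrow> (\<Sum>C\<in>cyc_classes. r C * rep_char C g) = (0::'k::field_char_0)"
  shows "\<forall>C\<in>cyc_classes. r C = 0"
proof (rule ccontr)
  assume "\<not> ?thesis"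
  then have ne: "{C \<in> cyc_classes. r C \<noteq> 0} \<noteq> {}" by blast
  have fs: "finite {C \<in> cyc_classes. r C \<noteq> 0}" using finite_cyc by simp
  have "Max ((\<lambda>C. card (rep C)) ` {C \<in> cyc_classes. r C \<noteq> 0}) \<in> (\<lambda>C. card (rep C)) ` {C \<in> cyc_classes. r C \<noteq> 0}"
    using fs ne by (intro Max_in) auto
  then obtain C where C: "C \<in> cyc_classes" "r C \<noteq> 0"
    and C_max: "card (rep C) = Max ((\<lambda>C. card (rep C)) ` {C \<in> cyc_classes. r C \<noteq> 0})" by auto
  have max: "card (rep D) \<le> card (rep C)" if "D \<in> cyc_classes" "r D \<noteq> 0" for D
    unfolding C_max using fs that by (intro Max_ge) auto
  have "r D * rep_char D (gen C) = (if D = C then r C * rep_char C (gen C) else 0)" if D: "D \<in> cyc_classes" for D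
  proof -
    have "D = C" if nz: "r D * rep_char D (gen C) \<noteq> 0"
    proof -
      have nz': "r D \<noteq> 0" "rep_char D (gen C) \<noteq> (0::'k)" using nz by auto
      have "card (generate P {gen C}) = card (rep D)"
        using rep_char_nonzero_card(1)[OF D gen(1)[OF C(1)] nz'(2)] max[OF D nz'(1)] gen(2)[OF C(1)] by simp
      from rep_char_nonzero_card(2)[OF D gen(1)[OF C(1)] nz'(2) this]
      have "D = cls P (generate P {gen C})" .
      then show ?thesis using cls_gen[OF C(1)] by simp
    qed
    then show ?thesis by auto
  qed
  then have "(\<Sum>D\<in>cyc_classes. r D * rep_char D (gen C)) = (\<Sum>D\<in>cyc_classes. if D = C then r C * rep_char C (gen C) else 0)"
    by (rule sum.cong[OF refl])
  also have "\<dots> = r C * rep_char C (gen C)" using finite_cyc C(1) by (simp add: sum.delta)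
  finally have "(\<Sum>D\<in>cyc_classes. r D * rep_char D (gen C)) = r C * rep_char C (gen C)" .
  then show False using z[OF gen(1)[OF C(1)]] C(2) rep_char_gen_nonzero[OF C(1), where 'k = 'k] by simp
qed

text \<open>Induction on a bound \<open>n\<close> for the orders of the cyclic groups on which
  \<open>f\<close> is nonzero. The values at the top order are subtracted, which by triangularity
  creates no values at larger orders.\<close>

lemma cyc_classes_span:
  assumes "cyclic_cf (f :: 'a \<Rightarrow> 'k::field_char_0)"
  shows "\<exists>r. \<forall>g\<in>carrier P. f g = (\<Sum>C\<in>cyc_classes. r C * rep_char C g)"
proof -
  have "\<exists>r. \<forall>g\<in>carrier P. f g = (\<Sum>C\<in>cyc_classes. r C * rep_char C g)"
    if "cyclic_cf f" "\<forall>g\<in>carrier P. card (generate P {g}) > n \<longrightarrow> f g = 0" for n and f :: "'a \<Rightarrow> 'k"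
    using that
  proof (induction n arbitrary: f)
    case 0
    then have "\<forall>g\<in>carrier P. f g = 0" using card_subgroup_pos generate_subgroup by blast
    then show ?case by (intro exI[of _ "\<lambda>_. 0"]) simp
  next
    case (Suc n)
    \<comment> \<open>Only subgroups of the top order are used. The coefficient is forced by
      evaluation at \<open>gen C\<close>, where no other character of that order is nonzero.\<close>
    define q where "q C = (if card (rep C) = Suc n then f (gen C) / rep_char C (gen C) else 0)" for C
    define f' where "f' g = f g - (\<Sum>C\<in>cyc_classes. q C * rep_char C g)" for g
    have "cyclic_cf f'"
    proof -
      have "rep_char C g = (rep_char C h :: 'k)" if "C \<in> cyc_classes" "g \<in> carrier P" "h \<in> carrier P"
        "sg_conj P (generate P {g}) (generate P {h})" for C g h
        using perm_char_cf[of "rep C"] cycD[OF that(1)] that unfolding cyclic_cf_def by blast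
      moreover have "f g = f h" if "g \<in> carrier P" "h \<in> carrier P"
        "sg_conj P (generate P {g}) (generate P {h})" for g h
        using Suc.prems(1) that unfolding cyclic_cf_def by blast
      ultimately have "f' g = f' h" if "g \<in> carrier P" "h \<in> carrier P"
        "sg_conj P (generate P {g}) (generate P {h})" for g h
        unfolding f'_def using that by (metis (no_types, lifting) sum.cong)
      then show ?thesis unfolding cyclic_cf_def by blast
    qed
    moreover have "f' g = 0" if g: "g \<in> carrier P" "card (generate P {g}) > n" for g
    proof (cases "card (generate P {g}) = Suc n")
      case True
      let ?E = "cls P (generate P {g})"
      have E: "?E \<in> cyc_classes" using cls_generate_in_cyc g by blast
      have cE: "card (rep ?E) = Suc n"
        using sg_conj_card[OF rep_cls[OF generate_subgroup[OF g(1)]] generate_subset[OF g(1)]] True by simp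
      have "q C * rep_char C g = (if C = ?E then f g else 0)" if C: "C \<in> cyc_classes" for C
      proof (cases "C = ?E")
        case True
        have "rep_char C (gen C) = (rep_char C g :: 'k)" using rep_char_eq_gen[OF C g(1)] True by metis
        moreover have "f (gen C) = f g" using cyclic_cf_gen[OF Suc.prems(1) g(1)] True by metis
        ultimately show ?thesis using True cE rep_char_gen_nonzero[OF E, where 'k = 'k] unfolding q_def by simp
      next
        case False
        then have "rep_char C g = (0::'k)" if "card (rep C) = Suc n"
          using rep_char_nonzero_card(2)[OF C g(1)] that \<open>card (generate P {g}) = Suc n\<close> by metis
        then show ?thesis using False unfolding q_def by (cases "card (rep C) = Suc n") simp_all
      qed
      then have "(\<Sum>C\<in>cyc_classes. q C * rep_char C g) = f g" using finite_cyc E by (simp add: sum.delta)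
      then show ?thesis by (simp add: f'_def)
    next
      case False
      then have "f g = 0" using Suc.prems(2) g by simp
      have "q C * rep_char C g = 0" if C: "C \<in> cyc_classes" for C
        using rep_char_nonzero_card(1)[OF C g(1), where 'k = 'k] g False unfolding q_def by auto
      then have "(\<Sum>C\<in>cyc_classes. q C * rep_char C g) = 0" by (rule sum.neutral[OF ballI])
      with \<open>f g = 0\<close> show ?thesis unfolding f'_def by simp
    qed
    ultimately obtain r where r: "\<forall>g\<in>carrier P. f' g = (\<Sum>C\<in>cyc_classes. r C * rep_char C g)" using Suc.IH[of f'] by blast
    have "f g = (\<Sum>C\<in>cyc_classes. (r C + q C) * rep_char C g)" if "g \<in> carrier P" for g
      using r that unfolding f'_def by (simp add: algebra_simps sum.distrib)
    then show ?case by (intro exI[of _ "\<lambda>C. r C + q C"]) simp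
  qed
  \<comment> \<open>Taking the group order for \<open>n\<close> makes the vanishing condition empty,
    which starts the induction for arbitrary \<open>f\<close>.\<close>
  moreover have "card (generate P {g}) \<le> card (carrier P)" if "g \<in> carrier P" for g
    using generate_subset[OF that] fin by (rule card_mono[rotated])
  ultimately show ?thesis using assms by (metis not_le)
qed

text \<open>\<open>\<gamma>\<close> is the inverse of the Gram matrix. The indicator functions of
  the cyclic classes are orthogonal with weights \<open>n E\<close> over the group order; if
  \<open>s\<close> expresses them through the characters \<open>rep_char C\<close>, the inverse is
  the transpose of \<open>s\<close>, times the inverse weights, times \<open>s\<close>.\<close>

lemma dual_basis:
  obtains \<gamma> :: "'a set set \<Rightarrow> 'a set set \<Rightarrow> 'k::field_char_0"
  where "\<And>D D'. D \<in> cyc_classes \<Longrightarrow> D' \<in> cyc_classes \<Longrightarrow> (\<Sum>E\<in>cyc_classes. \<gamma> D E * char_ip P (rep_char E) (rep_char D')) = (if D = D' then 1 else 0)"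
proof -
  define indic :: "'a set set \<Rightarrow> 'a \<Rightarrow> 'k" where "indic E g = (if cls P (generate P {g}) = E then 1 else 0)" for E g
  have "cyclic_cf (indic E)" for E
  proof -
    have "indic E g = indic E h"
      if "g \<in> carrier P" "h \<in> carrier P" "sg_conj P (generate P {g}) (generate P {h})" for g h
      unfolding indic_def
        cls_eq_iff[OF generate_subgroup[OF that(1)] generate_subgroup[OF that(2)], THEN iffD2, OF that(3)] ..
    then show ?thesis unfolding cyclic_cf_def by blast
  qed
  then have "\<exists>r. \<forall>g\<in>carrier P. indic E g = (\<Sum>C\<in>cyc_classes. r C * rep_char C g)" for E
    by (rule cyc_classes_span)
  then obtain s where "\<forall>E. \<forall>g\<in>carrier P. indic E g = (\<Sum>C\<in>cyc_classes. s E C * rep_char C g)"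
    using choice[of "\<lambda>E r. \<forall>g\<in>carrier P. indic E g = (\<Sum>C\<in>cyc_classes. r C * rep_char C g)"] by blast
  then have s: "\<And>E g. g \<in> carrier P \<Longrightarrow> indic E g = (\<Sum>C\<in>cyc_classes. s E C * rep_char C g)" by blast
  define m :: "'a set set \<Rightarrow> 'a set set \<Rightarrow> 'k" where "m C F = rep_char C (gen F)" for C F
  \<comment> \<open>\<open>m\<close> expands characters in indicators and \<open>s\<close> expands
    indicators in characters; going there and back is the identity because the characters are
    independent.\<close>
  have inv: "(\<Sum>E\<in>cyc_classes. m D' E * s E D) = (if D = D' then 1 else 0)" if D: "D \<in> cyc_classes" "D' \<in> cyc_classes" for D D'
  proof -
    have "(\<Sum>D\<in>cyc_classes. ((\<Sum>E\<in>cyc_classes. m D' E * s E D) - (if D = D' then 1 else 0)) * rep_char D g) = 0" if g: "g \<in> carrier P" for g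
    proof -
      let ?F = "cls P (generate P {g})"
      have "(\<Sum>D\<in>cyc_classes. (\<Sum>E\<in>cyc_classes. m D' E * s E D) * rep_char D g) = (\<Sum>E\<in>cyc_classes. m D' E * indic E g)"
        by (simp add: s[OF g] sum_distrib_left sum_distrib_right mult.assoc) (rule sum.swap)
      also have "\<dots> = (\<Sum>E\<in>cyc_classes. if E = ?F then m D' E else 0)" by (intro sum.cong) (auto simp: indic_def)
      also have "\<dots> = m D' ?F" using finite_cyc cls_generate_in_cyc[OF g] by (simp add: sum.delta)
      also have "\<dots> = rep_char D' g" unfolding m_def
        using rep_char_eq_gen[OF D(2) g] .
      also have "\<dots> = (\<Sum>D\<in>cyc_classes. (if D = D' then 1 else 0) * rep_char D g)"
        using finite_cyc D(2) by (simp add: if_distrib[of "\<lambda>x. x * _"] sum.delta cong: if_cong)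
      finally show ?thesis by (simp add: left_diff_distrib sum_subtractf)
    qed
    from cyc_classes_indep[OF this] show ?thesis using D by simp
  qed
  define n :: "'a set set \<Rightarrow> 'k" where "n E = of_nat (card {g \<in> carrier P. cls P (generate P {g}) = E})" for E
  have n: "n E \<noteq> 0" if "E \<in> cyc_classes" for E
    unfolding n_def using fin gen(1)[OF that] cls_gen[OF that] by (auto simp: card_eq_0_iff)
  have cP: "of_nat (card (carrier P)) \<noteq> (0::'k)" using fin one_closed by (auto simp: card_eq_0_iff)
  have ipi: "char_ip P (indic E) (rep_char D') = n E * m D' E / of_nat (card (carrier P))" if E: "E \<in> cyc_classes" "D' \<in> cyc_classes" for E D'
  proof -
    have "(\<Sum>g\<in>carrier P. indic E g * rep_char D' g) = (\<Sum>g\<in>carrier P. if cls P (generate P {g}) = E then m D' E else 0)"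
    proof (rule sum.cong[OF refl])
      fix g assume "g \<in> carrier P"
      then show "indic E g * rep_char D' g = (if cls P (generate P {g}) = E then m D' E else 0)"
        by (auto simp: indic_def m_def rep_char_eq_gen[OF E(2)])
    qed
    also have "\<dots> = n E * m D' E" using fin by (simp add: sum.If_cases n_def Int_def)
    finally show ?thesis by (simp add: char_ip_def)
  qed
  define \<gamma> where "\<gamma> D C = (\<Sum>E\<in>cyc_classes. s E D * of_nat (card (carrier P)) / n E * s E C)" for D C
  show ?thesis
  proof (rule that[of \<gamma>])
    fix D D' assume D: "D \<in> cyc_classes" "D' \<in> cyc_classes"
    have "(\<Sum>C\<in>cyc_classes. \<gamma> D C * char_ip P (rep_char C) (rep_char D')) =
      (\<Sum>E\<in>cyc_classes. s E D * of_nat (card (carrier P)) / n E * (\<Sum>C\<in>cyc_classes. s E C * char_ip P (rep_char C) (rep_char D')))"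
      unfolding \<gamma>_def sum_distrib_left sum_distrib_right by (subst sum.swap) (simp add: mult.assoc)
    also have "\<dots> = (\<Sum>E\<in>cyc_classes. s E D * of_nat (card (carrier P)) / n E * char_ip P (indic E) (rep_char D'))"
    proof (rule sum.cong[OF refl])
      fix E
      have "(\<Sum>C\<in>cyc_classes. s E C * char_ip P (rep_char C) (rep_char D')) = char_ip P (\<lambda>g. \<Sum>C\<in>cyc_classes. s E C * rep_char C g) (rep_char D')"
        by (rule char_ip_sum_left[symmetric])
      also have "\<dots> = char_ip P (indic E) (rep_char D')" by (rule char_ip_cong[OF s[symmetric] refl])
      finally show "s E D * of_nat (card (carrier P)) / n E * (\<Sum>C\<in>cyc_classes. s E C * char_ip P (rep_char C) (rep_char D')) =
        s E D * of_nat (card (carrier P)) / n E * char_ip P (indic E) (rep_char D')" by simp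
    qed
    also have "\<dots> = (\<Sum>E\<in>cyc_classes. m D' E * s E D)"
      using n cP D by (intro sum.cong) (simp_all add: ipi)
    finally show "(\<Sum>C\<in>cyc_classes. \<gamma> D C * char_ip P (rep_char C) (rep_char D')) = (if D = D' then 1 else 0)" using inv D by simp
  qed
qed

text \<open>In the basis of the \<open>rep_char C\<close> the pairings are the Gram matrix applied
  to the coefficient vector of \<open>f\<close>, and \<open>dual_basis\<close> inverts that matrix.
  In a general field of characteristic zero this stands in for positivity of the form.\<close>

lemma cyclic_cf_nondegenerate:
  assumes "cyclic_cf (f :: 'a \<Rightarrow> 'k::field_char_0)" "\<And>C. C \<in> cyc_classes \<Longrightarrow> char_ip P (rep_char C) f = 0" "g \<in> carrier P"
  shows "f g = 0"
proof -
  obtain r where r: "\<And>g. g \<in> carrier P \<Longrightarrow> f g = (\<Sum>C\<in>cyc_classes. r C * rep_char C g)" using cyc_classes_span[OF assms(1)] by blast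
  obtain \<gamma> :: "'a set set \<Rightarrow> 'a set set \<Rightarrow> 'k" where \<gamma>: "\<And>D D'. D \<in> cyc_classes \<Longrightarrow> D' \<in> cyc_classes \<Longrightarrow>
    (\<Sum>E\<in>cyc_classes. \<gamma> D E * char_ip P (rep_char E) (rep_char D')) = (if D = D' then 1 else 0)" using dual_basis by blast
  have z: "(\<Sum>C\<in>cyc_classes. r C * char_ip P (rep_char E) (rep_char C)) = 0" if "E \<in> cyc_classes" for E
    using assms(2)[OF that] char_ip_cong[of P "rep_char E" "rep_char E" f "\<lambda>g. \<Sum>C\<in>cyc_classes. r C * rep_char C g"] r by (simp add: char_ip_sum_right)
  have "r D = 0" if D: "D \<in> cyc_classes" for D
  proof -
    have "r D = (\<Sum>C\<in>cyc_classes. if D = C then r C else 0)" using D finite_cyc by (simp add: sum.delta')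
    also have "\<dots> = (\<Sum>C\<in>cyc_classes. (if D = C then 1 else 0) * r C)" by (intro sum.cong) auto
    also have "\<dots> = (\<Sum>C\<in>cyc_classes. (\<Sum>E\<in>cyc_classes. \<gamma> D E * char_ip P (rep_char E) (rep_char C)) * r C)" using \<gamma> D by simp
    also have "\<dots> = (\<Sum>E\<in>cyc_classes. \<gamma> D E * (\<Sum>C\<in>cyc_classes. r C * char_ip P (rep_char E) (rep_char C)))"
      unfolding sum_distrib_left sum_distrib_right by (subst sum.swap) (simp add: ac_simps)
    finally show ?thesis using z by simp
  qed
  then show ?thesis using r[OF assms(3)] by simp
qed

lemma num_b_eq: "num_b P = card (sg_classes P)"
  by (simp add: num_b_def sg_classes_def)

lemma num_c_eq: "num_c P = card cyc_classes"
proof -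
  have "{{L'. sg_conj P L L'} | L. subgroup L P \<and> cyclic_sg P L} = cyc_classes"
  proof (intro Set.set_eqI iffI)
    fix C assume "C \<in> {{L'. sg_conj P L L'} | L. subgroup L P \<and> cyclic_sg P L}"
    then show "C \<in> cyc_classes" using cls_in_cyc_iff by blast
  next
    fix C assume C: "C \<in> cyc_classes"
    then have "C = cls P (rep C)" using cycD cls_rep by simp
    then show "C \<in> {{L'. sg_conj P L L'} | L. subgroup L P \<and> cyclic_sg P L}" using cycD[OF C] by blast
  qed
  then show ?thesis unfolding num_c_def by simp
qed

end

section \<open>The ideal spanned by product subgroups\<close>

lemma lin_span_zero: "(\<lambda>_. 0) \<in> lin_span S"
  unfolding lin_span_def by (intro CollectI exI[of _ "{}"]) simp

lemma lin_span_incl: "s \<in> S \<Longrightarrow> s \<in> lin_span S"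
  unfolding lin_span_def by (intro CollectI exI[of _ "{s}"] exI[of _ "\<lambda>_. 1"]) simp

lemma lin_span_scale:
  assumes "f \<in> lin_span S" shows "(\<lambda>x. a * f x) \<in> lin_span S"
proof -
  obtain F c where F: "finite F" "F \<subseteq> S" "f = (\<lambda>x. \<Sum>s\<in>F. c s * s x)" using assms unfolding lin_span_def by blast
  then show ?thesis unfolding lin_span_def
    by (intro CollectI exI[of _ F] exI[of _ "\<lambda>s. a * c s"]) (simp add: sum_distrib_left mult.assoc)
qed

lemma lin_span_add:
  assumes "f \<in> lin_span S" "f' \<in> lin_span S" shows "(\<lambda>x. f x + f' x) \<in> lin_span S"
proof -
  obtain F c where F: "finite F" "F \<subseteq> S" "f = (\<lambda>x. \<Sum>s\<in>F. c s * s x)" using assms(1) unfolding lin_span_def by blast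
  obtain F' c' where F': "finite F'" "F' \<subseteq> S" "f' = (\<lambda>x. \<Sum>s\<in>F'. c' s * s x)" using assms(2) unfolding lin_span_def by blast
  let ?c = "\<lambda>s. (if s \<in> F then c s else 0) + (if s \<in> F' then c' s else 0)"
  have "f x + f' x = (\<Sum>s\<in>F \<union> F'. ?c s * s x)" for x
  proof -
    have "f x = (\<Sum>s\<in>F \<union> F'. (if s \<in> F then c s else 0) * s x)"
      unfolding F(3) using F(1) F'(1) by (intro sum.mono_neutral_cong_left) auto
    moreover have "f' x = (\<Sum>s\<in>F \<union> F'. (if s \<in> F' then c' s else 0) * s x)"
      unfolding F'(3) using F(1) F'(1) by (intro sum.mono_neutral_cong_left) auto
    ultimately show ?thesis by (simp only: distrib_right sum.distrib)
  qed
  then show ?thesis unfolding lin_span_def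
    using F F' by (intro CollectI exI[of _ "F \<union> F'"] exI[of _ ?c]) auto
qed

lemma lin_span_sum:
  "(\<And>i. i \<in> I \<Longrightarrow> c i \<noteq> 0 \<Longrightarrow> f i \<in> S) \<Longrightarrow> (\<lambda>x. \<Sum>i\<in>I. c i * f i x) \<in> lin_span S"
proof (induction I rule: infinite_finite_induct)
  case (insert i I)
  have "(\<lambda>x. c i * f i x) \<in> lin_span S"
    using insert.prems[of i] lin_span_zero lin_span_scale[OF lin_span_incl] by (cases "c i = 0") auto
  from lin_span_add[OF this insert.IH] show ?case using insert by simp
qed (simp_all add: lin_span_zero)

lemma lin_span_subset:
  assumes "S \<subseteq> V" "(\<lambda>_. 0) \<in> V" "\<And>f f'. f \<in> V \<Longrightarrow> f' \<in> V \<Longrightarrow> (\<lambda>x. f x + f' x) \<in> V"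
    "\<And>a f. f \<in> V \<Longrightarrow> (\<lambda>x. a * f x) \<in> V"
  shows "lin_span S \<subseteq> V"
proof
  fix f assume "f \<in> lin_span S"
  then obtain F c where F: "finite F" "F \<subseteq> S" "f = (\<lambda>x. \<Sum>s\<in>F. c s * s x)" unfolding lin_span_def by blast
  from F(1,2) have "(\<lambda>x. \<Sum>s\<in>F. c s * s x) \<in> V"
  proof (induction F rule: finite_induct)
    case (insert s F)
    then show ?case using assms(3)[OF assms(4)[of s "c s"], of "\<lambda>x. \<Sum>s\<in>F. c s * s x"] assms(1) by auto
  qed (simp add: assms(2))
  then show "f \<in> V" using F by simp
qed

text \<open>A class function on subgroups is the sum of the indicators of the classes in its
  support. Membership in \<open>ideal_I\<close> and \<open>ideal_Ic\<close> thereby reduces to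
  inspecting where a function is nonzero.\<close>

lemma (in two_groups) lin_span_tr:
  assumes Q: "\<And>L. Q L \<Longrightarrow> subgroup L P" "\<And>L L'. Q L \<Longrightarrow> sg_conj P L L' \<Longrightarrow> Q L'"
  shows "lin_span {tr G H L | L. Q L} = {f \<in> (kB G H :: (_ \<Rightarrow> 'k::field_char_0) set). \<forall>L. f L \<noteq> 0 \<longrightarrow> Q L}"
proof
  show "lin_span {tr G H L | L. Q L} \<subseteq> {f \<in> (kB G H :: (_ \<Rightarrow> 'k) set). \<forall>L. f L \<noteq> 0 \<longrightarrow> Q L}"
  proof (rule lin_span_subset)
    show "{tr G H L | L. Q L} \<subseteq> {f \<in> (kB G H :: (_ \<Rightarrow> 'k) set). \<forall>L. f L \<noteq> 0 \<longrightarrow> Q L}"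
    proof
      fix f :: "_ \<Rightarrow> 'k" assume "f \<in> {tr G H L | L. Q L}"
      then obtain L where L: "Q L" "f = tr G H L" by blast
      have "Q M" if "f M \<noteq> 0" for M
      proof -
        have "subgroup M P" "sg_conj P M L"
          using that tr_apply[OF Q(1)[OF L(1)], where 'k = 'k] unfolding L(2) by (auto split: if_splits)
        then have "sg_conj P L M" using P.sg_conj_sym subgroup.subset by blast
        then show ?thesis using Q(2) L(1) by blast
      qed
      then show "f \<in> {f \<in> kB G H. \<forall>L. f L \<noteq> 0 \<longrightarrow> Q L}" using L tr_in_kB[OF Q(1)[OF L(1)]] by blast
    qed
    show "(\<lambda>x. f x + f' x) \<in> {f \<in> (kB G H :: (_ \<Rightarrow> 'k) set). \<forall>L. f L \<noteq> 0 \<longrightarrow> Q L}"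
      if f: "f \<in> {f \<in> kB G H. \<forall>L. f L \<noteq> 0 \<longrightarrow> Q L}" and f': "f' \<in> {f \<in> kB G H. \<forall>L. f L \<noteq> 0 \<longrightarrow> Q L}" for f f'
    proof -
      have "Q L" if "f L + f' L \<noteq> 0" for L
      proof -
        have "f L \<noteq> 0 \<or> f' L \<noteq> 0" using that by auto
        then show ?thesis using f f' by blast
      qed
      then show ?thesis using f f' kB_add[of f G H f'] by simp
    qed
  qed (auto simp: kB_zero kB_scale)
  show "{f \<in> (kB G H :: (_ \<Rightarrow> 'k) set). \<forall>L. f L \<noteq> 0 \<longrightarrow> Q L} \<subseteq> lin_span {tr G H L | L. Q L}"
  proof
    fix f :: "_ \<Rightarrow> 'k" assume f: "f \<in> {f \<in> kB G H. \<forall>L. f L \<noteq> 0 \<longrightarrow> Q L}"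
    have "(\<lambda>M. \<Sum>C\<in>sg_classes P. f (rep C) * tr G H (rep C) M) \<in> lin_span {tr G H L | L. Q L}"
      by (rule lin_span_sum[of "sg_classes P" "\<lambda>C. f (rep C)" "\<lambda>C. tr G H (rep C)"]) (use f in blast)
    moreover have "(\<lambda>M. \<Sum>C\<in>sg_classes P. f (rep C) * tr G H (rep C) M) = f"
      by (rule kB_expand[symmetric]) (use f in blast)
    ultimately show "f \<in> lin_span {tr G H L | L. Q L}"
      by (rule back_subst[of "\<lambda>z. z \<in> lin_span {tr G H L | L. Q L}"])
  qed
qed

text \<open>A separate locale rather than an extension of \<open>fin_group\<close>: the sublocales below would otherwise apply
  to \<open>P \<times>\<times> P\<close> again, and so on without end.\<close>

locale double_burnside = fin_group P for P :: "('a,'m) monoid_scheme" (structure)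
begin

sublocale PP: two_groups P P by unfold_locales
sublocale PPP: three_groups P P P by unfold_locales

text \<open>A representative assembled from the representatives chosen in \<open>P\<close>; the one
  that \<open>rep\<close> picks for the same class in \<open>P \<times>\<times> P\<close> may be a
  different conjugate.\<close>

abbreviation rep_prod :: "'a set set \<times> 'a set set \<Rightarrow> ('a \<times> 'a) set" where "rep_prod p \<equiv> rep (fst p) \<times> rep (snd p)"
abbreviation class_pairs where "class_pairs \<equiv> sg_classes P \<times> sg_classes P"

lemma rep_prod_subgroup: "p \<in> class_pairs \<Longrightarrow> subgroup (rep_prod p) (P \<times>\<times> P)"
  using PP.Times_subgroup rep_subgroup by (auto simp: mem_Times_iff)

lemma Times_eq_subgroups:
  assumes "subgroup A P" "subgroup B P" "A \<times> B = A' \<times> B'" shows "A = A' \<and> B = B'"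
  using assms(3) subgroup.one_closed[OF assms(1)] subgroup.one_closed[OF assms(2)] times_eq_iff[of A B A' B'] by blast

text \<open>Products are conjugate factor by factor, so pairs of classes index the basis of
  \<open>ideal_I\<close> without repetition, and evaluation at \<open>rep_prod\<close> reads off
  coordinates.\<close>

lemma tr_ind:
  assumes "p \<in> class_pairs" "subgroup A P" "subgroup B P"
  shows "tr P P (rep_prod p) (A \<times> B) = (if p = (cls P A, cls P B) then 1 else (0::'k::field_char_0))"
proof -
  obtain C D where p: "p = (C,D)" "C \<in> sg_classes P" "D \<in> sg_classes P" using assms by auto
  have s: "subgroup (rep C) P" "subgroup (rep D) P" using p rep_subgroup by auto
  have "sg_conj (P \<times>\<times> P) (A \<times> B) (rep C \<times> rep D) \<longleftrightarrow> sg_conj P A (rep C) \<and> sg_conj P B (rep D)"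
    using sg_conj_Times_iff[OF is_group is_group, of A B "rep C \<times> rep D"] Times_eq_subgroups[OF s] by metis
  also have "\<dots> \<longleftrightarrow> p = (cls P A, cls P B)"
    using cls_eq_iff[OF assms(2) s(1)] cls_eq_iff[OF assms(3) s(2)] cls_rep p by auto
  finally show ?thesis
    using PP.Times_subgroup[OF assms(2,3)] p(1)
    unfolding PP.tr_apply[OF rep_prod_subgroup[OF assms(1)]] by (simp only: fst_conv snd_conv simp_thms)
qed

lemma tr_ind_nonprod:
  assumes "p \<in> class_pairs" "\<not> prod_sg P P M" shows "tr P P (rep_prod p) M = (0::'k::field_char_0)"
proof -
  have "subgroup (rep (fst p)) P" "subgroup (rep (snd p)) P" using assms rep_subgroup by (auto simp: mem_Times_iff)
  then have "prod_sg P P (rep_prod p)" unfolding prod_sg_def by blast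
  then have "\<not> (subgroup M (P \<times>\<times> P) \<and> sg_conj (P \<times>\<times> P) M (rep_prod p))"
    using assms(2) PP.prod_sg_conj PP.P.sg_conj_sym subgroup.subset by blast
  then show ?thesis by (simp add: PP.tr_apply[OF rep_prod_subgroup[OF assms(1)]])
qed

definition prod_cyc :: "('a \<times> 'a) set \<Rightarrow> bool" where
  "prod_cyc L \<longleftrightarrow> (\<exists>A B. cyclic_sg P A \<and> cyclic_sg P B \<and> L = A \<times> B)"

lemma ideal_I_eq: "ideal_I P = {f \<in> (kB P P :: (_ \<Rightarrow> 'k::field_char_0) set). \<forall>L. f L \<noteq> 0 \<longrightarrow> prod_sg P P L}"
proof -
  have "{tr P P (A \<times> B) | A B. subgroup A P \<and> subgroup B P} = {tr P P L :: _ \<Rightarrow> 'k | L. prod_sg P P L}"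
    unfolding prod_sg_def by blast
  moreover have "subgroup L (P \<times>\<times> P)" if "prod_sg P P L" for L
    using that PP.Times_subgroup unfolding prod_sg_def by blast
  ultimately show ?thesis
    unfolding ideal_I_def using PP.lin_span_tr[of "prod_sg P P", where 'k = 'k] PP.prod_sg_conj by simp
qed

lemma prod_cyc_prod_sg: "prod_cyc L \<Longrightarrow> prod_sg P P L"
  unfolding prod_cyc_def prod_sg_def using cyclic_sg_subgroup by blast

lemma ideal_Ic_eq: "ideal_Ic P = {f \<in> (kB P P :: (_ \<Rightarrow> 'k::field_char_0) set). \<forall>L. f L \<noteq> 0 \<longrightarrow> prod_cyc L}"
proof -
  have "{tr P P (A \<times> B) | A B. cyclic_sg P A \<and> cyclic_sg P B} = {tr P P L :: _ \<Rightarrow> 'k | L. prod_cyc L}"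
    unfolding prod_cyc_def by blast
  moreover have "subgroup L (P \<times>\<times> P)" if "prod_cyc L" for L
    using that PP.Times_subgroup cyclic_sg_subgroup unfolding prod_cyc_def by blast
  moreover have "prod_cyc L'" if L: "prod_cyc L" and L': "sg_conj (P \<times>\<times> P) L L'" for L L'
  proof -
    obtain A B where AB: "cyclic_sg P A" "cyclic_sg P B" "L = A \<times> B"
      using L unfolding prod_cyc_def by blast
    obtain A' B' where "sg_conj P A A'" "sg_conj P B B'" "L' = A' \<times> B'"
      using L' sg_conj_Times_iff[OF is_group is_group, of A B L'] AB by blast
    with AB show ?thesis unfolding prod_cyc_def using cyclic_sg_conj by blast
  qed
  ultimately show ?thesis
    unfolding ideal_Ic_def using PP.lin_span_tr[of prod_cyc, where 'k = 'k] by simp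
qed

lemma ideal_Ic_subset: "ideal_Ic P \<subseteq> (ideal_I P :: (_ \<Rightarrow> 'k::field_char_0) set)"
  unfolding ideal_I_eq ideal_Ic_eq using prod_cyc_prod_sg by blast

lemma prod_cyc_ind:
  assumes "p \<in> class_pairs" shows "prod_cyc (rep_prod p) \<longleftrightarrow> p \<in> cyc_classes \<times> cyc_classes"
proof
  have s: "subgroup (rep (fst p)) P" "subgroup (rep (snd p)) P" using assms rep_subgroup by (auto simp: mem_Times_iff)
  assume "prod_cyc (rep_prod p)"
  then obtain A B where "cyclic_sg P A" "cyclic_sg P B" "rep_prod p = A \<times> B" unfolding prod_cyc_def by blast
  then have "cyclic_sg P (rep (fst p))" "cyclic_sg P (rep (snd p))" using Times_eq_subgroups[OF s] by blast+
  then show "p \<in> cyc_classes \<times> cyc_classes" using assms by (simp add: cyc_classes_def mem_Times_iff)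
next
  assume "p \<in> cyc_classes \<times> cyc_classes"
  then have "cyclic_sg P (rep (fst p))" "cyclic_sg P (rep (snd p))" by (simp_all add: cyc_classes_def mem_Times_iff)
  then show "prod_cyc (rep_prod p)" unfolding prod_cyc_def by blast
qed

lemma finite_SC2: "finite class_pairs" using finite_sg_classes by simp

lemma I_expand:
  assumes "f \<in> (ideal_I P :: (_ \<Rightarrow> 'k::field_char_0) set)"
  shows "f = (\<lambda>M. \<Sum>p\<in>class_pairs. f (rep_prod p) * tr P P (rep_prod p) M)"
proof
  fix M
  show "f M = (\<Sum>p\<in>class_pairs. f (rep_prod p) * tr P P (rep_prod p) M)"
  proof (cases "prod_sg P P M")
    case True
    then obtain A B where AB: "subgroup A P" "subgroup B P" "M = A \<times> B" unfolding prod_sg_def by blast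
    have "(\<Sum>p\<in>class_pairs. f (rep_prod p) * tr P P (rep_prod p) M) = (\<Sum>p\<in>class_pairs. if p = (cls P A, cls P B) then f (rep_prod p) else 0)"
      unfolding AB(3) by (intro sum.cong refl) (simp add: tr_ind AB)
    also have "\<dots> = f (rep_prod (cls P A, cls P B))"
      using finite_SC2 cls_in_classes AB by (simp add: sum.delta)
    also have "\<dots> = f M"
    proof -
      have "sg_conj (P \<times>\<times> P) (A \<times> B) (rep_prod (cls P A, cls P B))"
        using sg_conj_Times_iff[OF is_group is_group, of A B "rep_prod (cls P A, cls P B)"] rep_cls[OF AB(1)] rep_cls[OF AB(2)]
        by (metis fst_conv snd_conv)
      moreover have "f \<in> kB P P" using assms unfolding ideal_I_eq by blast
      ultimately show ?thesis using PP.kB_conj[of f "A \<times> B"] PP.Times_subgroup AB by simp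
    qed
    finally show ?thesis by simp
  next
    case False
    then have "f M = 0" using assms unfolding ideal_I_eq by blast
    moreover have "(\<Sum>p\<in>class_pairs. f (rep_prod p) * tr P P (rep_prod p) M) = 0"
      by (rule sum.neutral) (simp add: tr_ind_nonprod[OF _ False])
    ultimately show ?thesis by simp
  qed
qed

text \<open>The operator with kernel \<open>biset_char P P a\<close>. It is defined on all
  functions; \<open>act_op_cf\<close> shows that it preserves the functions of cyclic type, and
  \<open>act_op_chi\<close> identifies it with the action on characters of
  \<open>kB P triv\<close>.\<close>

definition act_op :: "(('a \<times> 'a) set \<Rightarrow> 'k) \<Rightarrow> ('a \<Rightarrow> 'k) \<Rightarrow> 'a \<Rightarrow> 'k::field_char_0" where
  "act_op a f g = char_ip P (biset_char P P a g) f"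

lemma act_op_cong: "(\<And>h. h \<in> carrier P \<Longrightarrow> f h = f' h) \<Longrightarrow> act_op a f g = act_op a f' g"
  unfolding act_op_def by (rule char_ip_cong) simp_all

lemma act_op_sum_right: "act_op a (\<lambda>h. \<Sum>i\<in>I. c i * f i h) g = (\<Sum>i\<in>I. c i * act_op a (f i) g)"
  unfolding act_op_def by (rule char_ip_sum_right)

lemma act_op_zero: "(\<And>h. h \<in> carrier P \<Longrightarrow> f h = 0) \<Longrightarrow> act_op a f g = 0"
  unfolding act_op_def char_ip_def by simp

lemma act_op_sum_left: "act_op (\<lambda>L. \<Sum>i\<in>I. c i * a i L) f g = (\<Sum>i\<in>I. c i * act_op (a i) f g)"
  unfolding act_op_def biset_char_sum char_ip_sum_left ..

lemma act_op_add: "act_op (\<lambda>L. a L + b L) f g = act_op a f g + act_op b f g"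
  unfolding act_op_def biset_char_add char_ip_def by (simp add: distrib_right sum.distrib add_divide_distrib)

lemma act_op_diff: "act_op (\<lambda>L. a L - b L) f g = act_op a f g - act_op b f g"
  unfolding act_op_def biset_char_diff char_ip_def by (simp add: left_diff_distrib sum_subtractf diff_divide_distrib)

lemma act_op_scale: "act_op (\<lambda>L. c * a L) f g = c * act_op a f g"
  unfolding act_op_def biset_char_scale char_ip_def by (simp add: sum_distrib_left mult.assoc)

lemma act_op_zero_left: "act_op (\<lambda>L. 0) f g = 0"
  unfolding act_op_def biset_char_zero char_ip_def by simp

text \<open>An exchange of two finite sums, applied to the matrix product in
  \<open>biset_char_bcomp\<close>: products in the algebra become composites of operators.\<close>

lemma act_op_bcomp:
  assumes "g \<in> carrier P"
  shows "act_op (bcomp P P P a b) f g = act_op a (act_op b f) g"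
proof -
  let ?n = "of_nat (card (carrier P))"
  have "act_op (bcomp P P P a b) f g = (\<Sum>h'\<in>carrier P. (\<Sum>h\<in>carrier P. biset_char P P a g h * biset_char P P b h h') / ?n * f h') / ?n"
    unfolding act_op_def char_ip_def using assms by (simp add: PPP.biset_char_bcomp)
  also have "\<dots> = (\<Sum>h\<in>carrier P. biset_char P P a g h * ((\<Sum>h'\<in>carrier P. biset_char P P b h h' * f h') / ?n)) / ?n"
    by (simp add: sum_divide_distrib sum_distrib_left sum_distrib_right mult.assoc) (rule sum.swap)
  finally show ?thesis unfolding act_op_def char_ip_def .
qed

text \<open>The character of a product subgroup splits into two factors, so the operator has rank at
  most one.\<close>

lemma act_op_tr:
  assumes "subgroup A P" "subgroup B P" "g \<in> carrier P"
  shows "act_op (tr P P (A \<times> B)) f g = perm_char P A g * char_ip P (perm_char P B) f"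
  unfolding act_op_def char_ip_def using assms PP.Times_subgroup
  by (simp add: PP.biset_char_tr perm_char_Times[OF fin_group_axioms fin_group_axioms] sum_distrib_left mult.assoc)

end

section \<open>The action on functions of cyclic type\<close>

lemma triv_fin_group: "fin_group triv"
proof -
  have "group triv" by (rule groupI) (auto simp: triv_def)
  then show ?thesis unfolding fin_group_def fin_group_axioms_def by (simp add: triv_def)
qed

lemma triv_simps: "carrier triv = {()}" by (simp add: triv_def)

interpretation triv: fin_group triv by (rule triv_fin_group)

lemma subgroup_triv_iff: "subgroup B triv \<longleftrightarrow> B = {()}"
proof
  assume "subgroup B triv"
  then show "B = {()}" using subgroup.one_closed[of B triv] by auto
next
  assume "B = {()}"
  then show "subgroup B triv" using triv.subgroup_self by (simp add: triv_simps)
qed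

lemma perm_char_triv: "perm_char triv {()} () = (1 :: 'k::field_char_0)"
  by (simp add: perm_char_def triv_simps)

lemma (in fin_group) subgroup_Times_triv:
  assumes "subgroup L (P \<times>\<times> triv)" shows "\<exists>A. subgroup A P \<and> L = A \<times> {()}"
proof -
  interpret PT: two_groups P triv by unfold_locales
  have "L = fst ` L \<times> {()}" by force
  then show ?thesis using PT.Times_subgroupD(1)[of "fst ` L" "{()}"] assms by auto
qed

lemma (in fin_group) cyclic_cf_sum:
  "(\<And>i. i \<in> I \<Longrightarrow> cyclic_cf (f i)) \<Longrightarrow> cyclic_cf (\<lambda>g. \<Sum>i\<in>I. c i * f i g)"
  unfolding cyclic_cf_def by (intro ballI impI sum.cong refl arg_cong2[of _ _ _ _ "(*)"]) blast

lemma (in fin_group) cyclic_cf_cong: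
  "cyclic_cf f' \<Longrightarrow> (\<And>g. g \<in> carrier P \<Longrightarrow> f g = f' g) \<Longrightarrow> cyclic_cf f"
  unfolding cyclic_cf_def by simp

text \<open>The trivial group leaves one subgroup and one basis element, and the character value at
  the identity is the coordinate.\<close>

lemma kB_triv_eq_zero:
  assumes "f \<in> (kB triv triv :: (_ \<Rightarrow> 'k::field_char_0) set)" "biset_char triv triv f () () = 0"
  shows "f = (\<lambda>_. 0)"
proof
  fix L
  interpret TT: two_groups triv triv by unfold_locales
  have sub: "subgroup M (triv \<times>\<times> triv) \<Longrightarrow> M = {((),())}" for M
    using triv.subgroup_Times_triv[of M] by (auto simp: subgroup_triv_iff)
  show "f L = 0"
  proof (cases "subgroup L (triv \<times>\<times> triv)")
    case True
    have L: "L = {((),())}" using sub[OF True] .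
    have "sg_classes (triv \<times>\<times> triv) = {cls (triv \<times>\<times> triv) L}"
      using sub True L unfolding sg_classes_def by blast
    moreover have "rep (cls (triv \<times>\<times> triv) L) = L"
      using sub[OF TT.P.rep_subgroup[OF TT.P.cls_in_classes[OF True]]] L by simp
    moreover have "perm_char (triv \<times>\<times> triv) L ((),()) = (1::'k)"
      using perm_char_Times[OF triv_fin_group triv_fin_group, of "()" "()" "{()}" "{()}"] L
      by (simp add: perm_char_triv triv_simps)
    ultimately show ?thesis using assms(2) by (simp add: biset_char_def)
  next
    case False
    then show ?thesis using assms(1) by (simp add: kB_def)
  qed
qed

context double_burnside
begin

sublocale PT: two_groups P triv by unfold_locales
sublocale TP: two_groups triv P by unfold_locales
sublocale PPT: three_groups P P triv by unfold_locales
sublocale TPT: three_groups triv P triv by unfold_locales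

text \<open>Every subgroup of \<open>P \<times>\<times> triv\<close> has the form
  \<open>A \<times> {()}\<close>, so elements of \<open>L_{1,k}(P)\<close> are formal combinations
  of the coset spaces \<open>P / A\<close>.\<close>

lemma biset_char_triv_right:
  assumes x: "x \<in> (kB P triv :: (_ \<Rightarrow> 'k::field_char_0) set)"
  shows "\<exists>A r. (\<forall>C\<in>sg_classes (P \<times>\<times> triv). subgroup (A C) P) \<and>
    (\<forall>g\<in>carrier P. biset_char P triv x g () = (\<Sum>C\<in>sg_classes (P \<times>\<times> triv). r C * perm_char P (A C) g))"
proof -
  have "\<forall>C\<in>sg_classes (P \<times>\<times> triv). \<exists>A. subgroup A P \<and> rep C = A \<times> {()}"
    using PT.P.rep_subgroup subgroup_Times_triv by blast
  then obtain A where A: "\<forall>C\<in>sg_classes (P \<times>\<times> triv). subgroup (A C) P \<and> rep C = A C \<times> {()}" by metis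
  have "biset_char P triv x g () = (\<Sum>C\<in>sg_classes (P \<times>\<times> triv). x (rep C) * perm_char P (A C) g)" if "g \<in> carrier P" for g
    unfolding biset_char_def using A that
    by (intro sum.cong refl)
      (simp add: perm_char_Times[OF fin_group_axioms triv_fin_group] perm_char_triv triv_simps)
  then show ?thesis using A by (intro exI[of _ A] exI[of _ "\<lambda>C. x (rep C)"]) blast
qed

lemma biset_char_tr_triv:
  assumes "subgroup A P" "g \<in> carrier P"
  shows "biset_char P triv (tr P triv (A \<times> {()})) g () = (perm_char P A g :: 'k::field_char_0)"
    and "biset_char triv P (tr triv P ({()} \<times> A)) () g = (perm_char P A g :: 'k::field_char_0)"
proof -
  have t: "() \<in> carrier triv" by (simp add: triv_simps)
  have s: "subgroup (A \<times> {()}) (P \<times>\<times> triv)" "subgroup ({()} \<times> A) (triv \<times>\<times> P)"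
    using PT.Times_subgroup TP.Times_subgroup assms(1) subgroup_triv_iff by blast+
  show "biset_char P triv (tr P triv (A \<times> {()})) g () = (perm_char P A g :: 'k)"
    unfolding PT.biset_char_tr[OF s(1) assms(2) t] perm_char_Times[OF fin_group_axioms triv_fin_group assms(2) t] perm_char_triv
    by (rule mult_1_right)
  show "biset_char triv P (tr triv P ({()} \<times> A)) () g = (perm_char P A g :: 'k)"
    unfolding TP.biset_char_tr[OF s(2) t assms(2)] perm_char_Times[OF triv_fin_group fin_group_axioms t assms(2)] perm_char_triv
    by (rule mult_1_left)
qed

text \<open>Composing with the biset of \<open>{()} \<times> C\<close> computes the pairing of the
  character of \<open>x\<close> with that of \<open>P / C\<close>; nondegeneracy then kills the
  character. So the quotient by \<open>J1\<close> is the space of characters.\<close>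

lemma J1_iff:
  assumes x: "x \<in> (kB P triv :: (_ \<Rightarrow> 'k::field_char_0) set)"
  shows "x \<in> J1 P \<longleftrightarrow> (\<forall>g\<in>carrier P. biset_char P triv x g () = 0)"
proof
  assume J: "x \<in> J1 P"
  obtain A and r :: "_ \<Rightarrow> 'k" where A: "\<And>C. C \<in> sg_classes (P \<times>\<times> triv) \<Longrightarrow> subgroup (A C) P"
    "\<And>g. g \<in> carrier P \<Longrightarrow> biset_char P triv x g () = (\<Sum>C\<in>sg_classes (P \<times>\<times> triv). r C * perm_char P (A C) g)"
    using biset_char_triv_right[OF x] by blast
  have cyclic_cf: "cyclic_cf (\<lambda>g. biset_char P triv x g ())"
    by (rule cyclic_cf_cong[OF cyclic_cf_sum[OF perm_char_cf[OF A(1)]] A(2)])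
  have "char_ip P (rep_char C) (\<lambda>g. biset_char P triv x g ()) = 0" if C: "C \<in> cyc_classes" for C
  proof -
    have s: "subgroup (rep C) P" using cycD[OF C] by blast
    have "tr triv P ({()} \<times> rep C) \<in> (kB triv P :: (_ \<Rightarrow> 'k) set)"
      using TP.tr_in_kB TP.Times_subgroup[of "{()}"] s subgroup_triv_iff by blast
    then have "bcomp triv P triv (tr triv P ({()} \<times> rep C)) x = (\<lambda>_. 0)" using J unfolding J1_def by blast
    then have "biset_char triv triv (bcomp triv P triv (tr triv P ({()} \<times> rep C)) x) () () = 0" by (simp only: biset_char_zero)
    then show ?thesis unfolding char_ip_def
      by (simp add: TPT.biset_char_bcomp triv_simps biset_char_tr_triv(2)[OF s])
  qed
  from cyclic_cf_nondegenerate[OF cyclic_cf this] show "\<forall>g\<in>carrier P. biset_char P triv x g () = 0" by blast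
next
  assume z: "\<forall>g\<in>carrier P. biset_char P triv x g () = 0"
  have "bcomp triv P triv \<psi> x = (\<lambda>_. 0)" for \<psi>
  proof (rule kB_triv_eq_zero[OF TPT.bcomp_in_kB])
    show "biset_char triv triv (bcomp triv P triv \<psi> x) () () = 0"
      using z by (simp add: TPT.biset_char_bcomp triv_simps)
  qed
  then show "x \<in> J1 P" using x unfolding J1_def by blast
qed

lemma act_op_chi:
  assumes "g \<in> carrier P"
  shows "biset_char P triv (bcomp P P triv a x) g () = (act_op a (\<lambda>h. biset_char P triv x h ()) g :: 'k::field_char_0)"
  using assms by (simp add: PPT.biset_char_bcomp act_op_def char_ip_def triv_simps)

text \<open>\<open>J1_iff\<close> lets the module be seen through characters, where \<open>a\<close>
  acts as \<open>act_op a\<close>, and the bisets \<open>P / A\<close> supply all permutation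
  characters.\<close>

lemma ker_S1_iff:
  assumes "a \<in> (kB P P :: (_ \<Rightarrow> 'k::field_char_0) set)"
  shows "a \<in> ker_S1 P \<longleftrightarrow> (\<forall>A g. subgroup A P \<longrightarrow> g \<in> carrier P \<longrightarrow> act_op a (perm_char P A) g = 0)"
proof
  assume a: "a \<in> ker_S1 P"
  show "\<forall>A g. subgroup A P \<longrightarrow> g \<in> carrier P \<longrightarrow> act_op a (perm_char P A) g = 0"
  proof (intro allI impI)
    fix A g assume A: "subgroup A P" and g: "g \<in> carrier P"
    let ?x = "tr P triv (A \<times> {()}) :: _ \<Rightarrow> 'k"
    have "?x \<in> kB P triv" using PT.tr_in_kB PT.Times_subgroup[of A "{()}"] A subgroup_triv_iff by blast
    then have "bcomp P P triv a ?x \<in> J1 P" using a unfolding ker_S1_def by blast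
    then have "biset_char P triv (bcomp P P triv a ?x) g () = 0" using J1_iff[OF PPT.bcomp_in_kB] g by blast
    then have "act_op a (\<lambda>h. biset_char P triv ?x h ()) g = 0" by (simp only: act_op_chi[OF g])
    then show "act_op a (perm_char P A) g = 0" by (simp only: act_op_cong[OF biset_char_tr_triv(1)[OF A]])
  qed
next
  assume z: "\<forall>A g. subgroup A P \<longrightarrow> g \<in> carrier P \<longrightarrow> act_op a (perm_char P A) g = 0"
  have "bcomp P P triv a x \<in> J1 P" if x: "x \<in> kB P triv" for x
  proof -
    obtain A and r :: "_ \<Rightarrow> 'k" where A: "\<And>C. C \<in> sg_classes (P \<times>\<times> triv) \<Longrightarrow> subgroup (A C) P"
      "\<And>g. g \<in> carrier P \<Longrightarrow> biset_char P triv x g () = (\<Sum>C\<in>sg_classes (P \<times>\<times> triv). r C * perm_char P (A C) g)"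
      using biset_char_triv_right[OF x] by blast
    have "biset_char P triv (bcomp P P triv a x) g () = 0" if g: "g \<in> carrier P" for g
    proof -
      have "biset_char P triv (bcomp P P triv a x) g () = act_op a (\<lambda>h. \<Sum>C\<in>sg_classes (P \<times>\<times> triv). r C * perm_char P (A C) h) g"
        unfolding act_op_chi[OF g] by (rule act_op_cong) (rule A(2))
      also have "\<dots> = 0" unfolding act_op_sum_right using z A(1) g by simp
      finally show ?thesis .
    qed
    then show ?thesis using J1_iff[OF PPT.bcomp_in_kB] by blast
  qed
  then show "a \<in> ker_S1 P" using assms unfolding ker_S1_def by blast
qed

text \<open>The image of a permutation character is the character of an element of
  \<open>kB P triv\<close>, hence again a combination of permutation characters, and these span the
  space.\<close>

lemma act_op_cf:
  assumes "cyclic_cf f" shows "cyclic_cf (act_op a f :: 'a \<Rightarrow> 'k::field_char_0)"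
proof -
  obtain r where r: "\<forall>g\<in>carrier P. f g = (\<Sum>C\<in>cyc_classes. r C * rep_char C g)" using cyc_classes_span[OF assms] by blast
  have 1: "cyclic_cf (act_op a (perm_char P B))" if B: "subgroup B P" for B
  proof -
    let ?x = "tr P triv (B \<times> {()}) :: _ \<Rightarrow> 'k"
    have 2: "act_op a (perm_char P B) g = biset_char P triv (bcomp P P triv a ?x) g ()" if "g \<in> carrier P" for g
      unfolding act_op_chi[OF that] by (rule act_op_cong) (simp add: biset_char_tr_triv(1)[OF B])
    obtain A and r :: "_ \<Rightarrow> 'k" where A: "\<And>C. C \<in> sg_classes (P \<times>\<times> triv) \<Longrightarrow> subgroup (A C) P"
      "\<And>g. g \<in> carrier P \<Longrightarrow> biset_char P triv (bcomp P P triv a ?x) g () = (\<Sum>C\<in>sg_classes (P \<times>\<times> triv). r C * perm_char P (A C) g)"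
      using biset_char_triv_right[OF PPT.bcomp_in_kB[of a ?x]] by blast
    have "cyclic_cf (\<lambda>g. \<Sum>C\<in>sg_classes (P \<times>\<times> triv). r C * perm_char P (A C) g)"
      by (rule cyclic_cf_sum[OF perm_char_cf[OF A(1)]])
    then show ?thesis by (rule cyclic_cf_cong) (simp only: 2 A(2))
  qed
  have eq: "act_op a f g = (\<Sum>C\<in>cyc_classes. r C * act_op a (rep_char C) g)" for g
    unfolding act_op_sum_right[symmetric] by (rule act_op_cong) (use r in simp)
  have "cyclic_cf (\<lambda>g. \<Sum>C\<in>cyc_classes. r C * act_op a (rep_char C) g)"
    by (rule cyclic_cf_sum) (use 1 cycD in blast)
  then show ?thesis by (rule cyclic_cf_cong) (rule eq)
qed

lemma ker_S1_T_zero: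
  assumes "a \<in> ker_S1 P" "cyclic_cf f" "g \<in> carrier P"
  shows "act_op a f g = (0::'k::field_char_0)"
proof -
  obtain r where r: "\<forall>g\<in>carrier P. f g = (\<Sum>C\<in>cyc_classes. r C * rep_char C g)" using cyc_classes_span[OF assms(2)] by blast
  have "a \<in> kB P P" using assms(1) unfolding ker_S1_def by blast
  then have "act_op a (rep_char C) g = 0" if "C \<in> cyc_classes" for C using ker_S1_iff assms(1,3) cycD[OF that] by blast
  moreover have "act_op a f g = (\<Sum>C\<in>cyc_classes. r C * act_op a (rep_char C) g)"
    unfolding act_op_sum_right[symmetric] by (rule act_op_cong) (use r in simp)
  ultimately show ?thesis by simp
qed

lemma ker_S1I:
  assumes "a \<in> (kB P P :: (_ \<Rightarrow> 'k::field_char_0) set)"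
    "\<And>C g. C \<in> cyc_classes \<Longrightarrow> g \<in> carrier P \<Longrightarrow> act_op a (rep_char C) g = 0"
  shows "a \<in> ker_S1 P"
proof -
  have "act_op a (perm_char P A) g = 0" if A: "subgroup A P" "g \<in> carrier P" for A g
  proof -
    obtain r where r: "\<forall>g\<in>carrier P. perm_char P A g = (\<Sum>C\<in>cyc_classes. r C * (rep_char C g :: 'k))"
      using cyc_classes_span[OF perm_char_cf[OF A(1)]] by blast
    have "act_op a (perm_char P A) g = (\<Sum>C\<in>cyc_classes. r C * act_op a (rep_char C) g)"
      unfolding act_op_sum_right[symmetric] by (rule act_op_cong) (use r in simp)
    then show ?thesis using assms(2) A by simp
  qed
  then show ?thesis using ker_S1_iff[OF assms(1)] by blast
qed

lemma sum_tr_in_Ic: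
  "(\<lambda>L. \<Sum>p\<in>cyc_classes\<times>cyc_classes. c p * tr P P (rep_prod p) L) \<in> (ideal_Ic P :: (_ \<Rightarrow> 'k::field_char_0) set)"
  unfolding ideal_Ic_def
proof (rule lin_span_sum)
  fix p assume "p \<in> cyc_classes \<times> cyc_classes"
  then have "cyclic_sg P (rep (fst p))" "cyclic_sg P (rep (snd p))" by (simp_all add: cyc_classes_def mem_Times_iff)
  then show "tr P P (rep_prod p) \<in> {tr P P (A \<times> B) |A B. cyclic_sg P A \<and> cyclic_sg P B}" by blast
qed

lemma act_op_sum_tr:
  assumes "Q \<subseteq> class_pairs" "g \<in> carrier P"
  shows "act_op (\<lambda>L. \<Sum>p\<in>Q. c p * tr P P (rep_prod p) L) f g =
    (\<Sum>p\<in>Q. c p * (rep_char (fst p) g * char_ip P (rep_char (snd p)) f) :: 'k::field_char_0)"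
  unfolding act_op_sum_left
proof (intro sum.cong refl)
  fix p assume "p \<in> Q"
  then have "subgroup (rep (fst p)) P" "subgroup (rep (snd p)) P" using assms rep_subgroup by (auto simp: mem_Times_iff)
  then show "c p * act_op (tr P P (rep_prod p)) f g = c p * (rep_char (fst p) g * char_ip P (rep_char (snd p)) f)"
    by (simp only: act_op_tr[OF _ _ assms(2)])
qed

lemma cyc2_subset: "cyc_classes \<times> cyc_classes \<subseteq> class_pairs" by (auto simp: cyc_classes_def)

lemma Ic_expand:
  assumes "f \<in> (ideal_Ic P :: (_ \<Rightarrow> 'k::field_char_0) set)"
  shows "f = (\<lambda>M. \<Sum>p\<in>cyc_classes\<times>cyc_classes. f (rep_prod p) * tr P P (rep_prod p) M)"
proof -
  have "f (rep_prod p) = 0" if "p \<in> class_pairs - cyc_classes \<times> cyc_classes" for p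
    using assms that prod_cyc_ind[of p] unfolding ideal_Ic_eq by blast
  then have "(\<Sum>p\<in>class_pairs. f (rep_prod p) * tr P P (rep_prod p) M) = (\<Sum>p\<in>cyc_classes\<times>cyc_classes. f (rep_prod p) * tr P P (rep_prod p) M)" for M
    using finite_SC2 cyc2_subset by (intro sum.mono_neutral_right) auto
  then have "(\<lambda>M. \<Sum>p\<in>class_pairs. f (rep_prod p) * tr P P (rep_prod p) M) = (\<lambda>M. \<Sum>p\<in>cyc_classes\<times>cyc_classes. f (rep_prod p) * tr P P (rep_prod p) M)"
    by (rule ext)
  moreover have "f = (\<lambda>M. \<Sum>p\<in>class_pairs. f (rep_prod p) * tr P P (rep_prod p) M)"
    by (rule I_expand) (use assms ideal_Ic_subset in blast)
  ultimately show ?thesis by (rule trans[rotated])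
qed

text \<open>Let F be the coefficient matrix of \<open>f\<close>. Acting as zero on each
  \<open>rep_char A\<close> makes every column of F times the Gram matrix a relation between the
  independent characters \<open>rep_char C\<close>; so the product is zero, and
  \<open>\<gamma>\<close> cancels the Gram matrix.\<close>

lemma Ic_ker_zero:
  assumes "f \<in> ideal_Ic P" "f \<in> (ker_S1 P :: (_ \<Rightarrow> 'k::field_char_0) set)"
  shows "f = (\<lambda>_. 0)"
proof -
  obtain \<gamma> :: "'a set set \<Rightarrow> 'a set set \<Rightarrow> 'k" where \<gamma>: "\<And>D D'. D \<in> cyc_classes \<Longrightarrow> D' \<in> cyc_classes \<Longrightarrow>
    (\<Sum>E\<in>cyc_classes. \<gamma> D E * char_ip P (rep_char E) (rep_char D')) = (if D = D' then 1 else 0)" using dual_basis by blast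
  have z: "(\<Sum>D\<in>cyc_classes. f (rep_prod (C,D)) * char_ip P (rep_char D) (rep_char A)) = 0" if CA: "C \<in> cyc_classes" "A \<in> cyc_classes" for C A
  proof -
    have "(\<Sum>C\<in>cyc_classes. (\<Sum>D\<in>cyc_classes. f (rep_prod (C,D)) * char_ip P (rep_char D) (rep_char A)) * rep_char C g) = 0" if g: "g \<in> carrier P" for g
    proof -
      have "(\<Sum>C\<in>cyc_classes. (\<Sum>D\<in>cyc_classes. f (rep_prod (C,D)) * char_ip P (rep_char D) (rep_char A)) * rep_char C g) =
        (\<Sum>p\<in>cyc_classes\<times>cyc_classes. f (rep_prod p) * (rep_char (fst p) g * char_ip P (rep_char (snd p)) (rep_char A)))"
        by (simp add: sum.cartesian_product' sum_distrib_left sum_distrib_right ac_simps split_beta)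
      also have "\<dots> = act_op (\<lambda>M. \<Sum>p\<in>cyc_classes\<times>cyc_classes. f (rep_prod p) * tr P P (rep_prod p) M) (rep_char A) g"
        by (rule act_op_sum_tr[OF cyc2_subset g, symmetric])
      also have "\<dots> = act_op f (rep_char A) g" by (rule arg_cong[where f = "\<lambda>f. act_op f (rep_char A) g", OF Ic_expand[OF assms(1), symmetric]])
      also have "\<dots> = 0" using ker_S1_T_zero[OF assms(2) perm_char_cf g] cycD[OF CA(2)] by blast
      finally show ?thesis .
    qed
    from cyc_classes_indep[OF this] show ?thesis using CA by blast
  qed
  have "f (rep_prod (C,D)) = 0" if CD: "C \<in> cyc_classes" "D \<in> cyc_classes" for C D
  proof -
    have "f (rep_prod (C,D)) = (\<Sum>D'\<in>cyc_classes. f (rep_prod (C,D')) * (if D = D' then 1 else 0))"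
      using CD finite_cyc by (simp add: if_distrib[of "\<lambda>x. _ * x"] sum.delta' cong: if_cong)
    also have "\<dots> = (\<Sum>D'\<in>cyc_classes. f (rep_prod (C,D')) * (\<Sum>E\<in>cyc_classes. \<gamma> D E * char_ip P (rep_char E) (rep_char D')))"
      using \<gamma> CD by simp
    also have "\<dots> = (\<Sum>E\<in>cyc_classes. \<gamma> D E * (\<Sum>D'\<in>cyc_classes. f (rep_prod (C,D')) * char_ip P (rep_char D') (rep_char E)))"
      unfolding sum_distrib_left by (subst sum.swap) (simp add: ac_simps char_ip_sym[of P "rep_char _" "rep_char _"])
    also have "\<dots> = 0" using z CD by simp
    finally show ?thesis .
  qed
  then have "(\<Sum>p\<in>cyc_classes\<times>cyc_classes. f (rep_prod p) * tr P P (rep_prod p) M) = 0" for M by (intro sum.neutral) auto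
  then show ?thesis by (rule trans[OF Ic_expand[OF assms(1)] ext])
qed

text \<open>Basis elements of \<open>ideal_Ic\<close> act as basis vector times pairing with a basis
  vector; since the pairing is nondegenerate, such rank one operators span all
  endomorphisms.\<close>

lemma Ic_realizes:
  fixes a :: "('a \<times> 'a) set \<Rightarrow> 'k::field_char_0"
  obtains u where "u \<in> ideal_Ic P"
    "\<And>f g. cyclic_cf f \<Longrightarrow> g \<in> carrier P \<Longrightarrow> act_op u f g = act_op a f g"
proof -
  obtain \<gamma> :: "'a set set \<Rightarrow> 'a set set \<Rightarrow> 'k" where \<gamma>: "\<And>D D'. D \<in> cyc_classes \<Longrightarrow> D' \<in> cyc_classes \<Longrightarrow>
    (\<Sum>E\<in>cyc_classes. \<gamma> D E * char_ip P (rep_char E) (rep_char D')) = (if D = D' then 1 else 0)" using dual_basis by blast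
  have "\<forall>D\<in>cyc_classes. \<exists>t. \<forall>g\<in>carrier P. act_op a (rep_char D) g = (\<Sum>C\<in>cyc_classes. t C * rep_char C g)"
    using cyc_classes_span[OF act_op_cf[OF perm_char_cf]] cycD by blast
  from bchoice[OF this]
  obtain t where t: "\<forall>D\<in>cyc_classes. \<forall>g\<in>carrier P. act_op a (rep_char D) g = (\<Sum>C\<in>cyc_classes. t D C * rep_char C g)" by blast
  \<comment> \<open>\<open>t\<close> holds the coordinates of the images under \<open>a\<close> of
    the cyclic characters. The factor \<open>\<gamma>\<close> compensates the Gram matrix that
    appears when the resulting element acts on \<open>rep_char A\<close>.\<close>
  define c where "c p = (\<Sum>D\<in>cyc_classes. t D (fst p) * \<gamma> D (snd p))" for p
  define u where "u = (\<lambda>L. \<Sum>p\<in>cyc_classes\<times>cyc_classes. c p * tr P P (rep_prod p) L)"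
  have basis: "act_op u (rep_char A) g = act_op a (rep_char A) g" if A: "A \<in> cyc_classes" and g: "g \<in> carrier P" for A g
  proof -
    have "act_op u (rep_char A) g = (\<Sum>C\<in>cyc_classes. \<Sum>E\<in>cyc_classes. (\<Sum>D\<in>cyc_classes. t D C * \<gamma> D E) * (rep_char C g * char_ip P (rep_char E) (rep_char A)))"
      unfolding u_def act_op_sum_tr[OF cyc2_subset g] c_def by (simp add: sum.cartesian_product' split_beta)
    also have "\<dots> = (\<Sum>C\<in>cyc_classes. rep_char C g * (\<Sum>D\<in>cyc_classes. t D C * (\<Sum>E\<in>cyc_classes. \<gamma> D E * char_ip P (rep_char E) (rep_char A))))"
      by (intro sum.cong refl, simp only: sum_distrib_left sum_distrib_right, subst sum.swap) (simp add: ac_simps)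
    also have "\<dots> = (\<Sum>C\<in>cyc_classes. rep_char C g * (\<Sum>D\<in>cyc_classes. t D C * (if D = A then 1 else 0)))"
      using \<gamma> A by simp
    also have "\<dots> = (\<Sum>C\<in>cyc_classes. rep_char C g * t A C)"
      using A finite_cyc by (simp add: if_distrib[of "\<lambda>x. _ * x"] sum.delta cong: if_cong)
    also have "\<dots> = act_op a (rep_char A) g" using t A g by (simp add: mult.commute)
    finally show ?thesis .
  qed
  have "act_op u f g = act_op a f g" if f: "cyclic_cf f" and g: "g \<in> carrier P" for f g
  proof -
    obtain r where r: "\<forall>g\<in>carrier P. f g = (\<Sum>C\<in>cyc_classes. r C * rep_char C g)" using cyc_classes_span[OF f] by blast
    have "act_op b f g = (\<Sum>C\<in>cyc_classes. r C * act_op b (rep_char C) g)" for b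
      unfolding act_op_sum_right[symmetric] by (rule act_op_cong) (use r in simp)
    then show ?thesis using basis g by simp
  qed
  moreover have "u \<in> ideal_Ic P" unfolding u_def by (rule sum_tr_in_Ic)
  ultimately show ?thesis using that by blast
qed

end

section \<open>The Jacobson radical\<close>

context double_burnside
begin

lemma ker_S1_subset: "ker_S1 P \<subseteq> kB P P" unfolding ker_S1_def by blast

lemma I_subset: "ideal_I P \<subseteq> (kB P P :: (_ \<Rightarrow> 'k::field_char_0) set)" unfolding ideal_I_eq by blast

lemma ker_S1_add: "x \<in> ker_S1 P \<Longrightarrow> y \<in> ker_S1 P \<Longrightarrow> (\<lambda>L. x L + y L :: 'k::field_char_0) \<in> ker_S1 P"
  using ker_S1_subset by (intro ker_S1I kB_add) (auto simp: act_op_add ker_S1_T_zero perm_char_cf cycD)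

lemma ker_S1_scale: "x \<in> ker_S1 P \<Longrightarrow> (\<lambda>L. c * x L :: 'k::field_char_0) \<in> ker_S1 P"
  using ker_S1_subset by (intro ker_S1I kB_scale) (auto simp: act_op_scale ker_S1_T_zero perm_char_cf cycD)

lemma ker_S1_zero: "(\<lambda>L. 0 :: 'k::field_char_0) \<in> ker_S1 P"
  by (intro ker_S1I kB_zero) (simp add: act_op_zero_left)

lemma ker_S1_bcomp:
  assumes "x \<in> (ker_S1 P :: (_ \<Rightarrow> 'k::field_char_0) set)" shows "bcomp P P P r x \<in> ker_S1 P"
proof (rule ker_S1I[OF PPP.bcomp_in_kB])
  fix C g assume "C \<in> cyc_classes" "g \<in> carrier P"
  then show "act_op (bcomp P P P r x) (rep_char C) g = 0"
    using ker_S1_T_zero[OF assms perm_char_cf] cycD[of C] by (simp add: act_op_bcomp act_op_zero)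
qed

lemma I_zero: "(\<lambda>L. 0 :: 'k::field_char_0) \<in> ideal_I P"
  unfolding ideal_I_def by (rule lin_span_zero)

lemma I_add: "x \<in> ideal_I P \<Longrightarrow> y \<in> ideal_I P \<Longrightarrow> (\<lambda>L. x L + y L :: 'k::field_char_0) \<in> ideal_I P"
  unfolding ideal_I_def by (rule lin_span_add)

lemma I_scale: "x \<in> ideal_I P \<Longrightarrow> (\<lambda>L. c * x L :: 'k::field_char_0) \<in> ideal_I P"
  unfolding ideal_I_def by (rule lin_span_scale)

lemma I_diff:
  assumes "x \<in> ideal_I P" "y \<in> ideal_I P" shows "(\<lambda>L. x L - y L :: 'k::field_char_0) \<in> ideal_I P"
  using I_add[OF assms(1) I_scale[OF assms(2), of "-1"]] by simp

lemma I_bcomp: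
  assumes "x \<in> (ideal_I P :: (_ \<Rightarrow> 'k::field_char_0) set)" shows "bcomp P P P r x \<in> ideal_I P"
proof -
  have "prod_sg P P M" if M: "bcomp P P P r x M \<noteq> 0" for M
  proof -
    have "\<exists>C\<in>sg_classes (P \<times>\<times> P). \<exists>D\<in>sg_classes (P \<times>\<times> P).
      r (rep C) * x (rep D) * comp_class P P P (rep C) (rep D) M \<noteq> 0"
      using M unfolding bcomp_eq by (metis (no_types, lifting) sum.neutral)
    then obtain C D where CD: "C \<in> sg_classes (P \<times>\<times> P)" "x (rep D) \<noteq> 0" "comp_class P P P (rep C) (rep D) M \<noteq> (0::'k)"
      by auto
    have "prod_sg P P (rep D)" using assms CD(2) unfolding ideal_I_eq by blast
    then show ?thesis using PPP.comp_class_prod_sg[OF PP.P.rep_subgroup[OF CD(1)] _ CD(3)] by blast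
  qed
  then show ?thesis unfolding ideal_I_eq using PPP.bcomp_in_kB by blast
qed

lemma decompose:
  assumes "a \<in> (kB P P :: (_ \<Rightarrow> 'k::field_char_0) set)"
  shows "\<exists>u\<in>ideal_Ic P. (\<lambda>L. a L - u L) \<in> ker_S1 P"
proof -
  obtain u where u: "u \<in> ideal_Ic P" "\<And>f g. cyclic_cf f \<Longrightarrow> g \<in> carrier P \<Longrightarrow> act_op u f g = act_op a f g"
    using Ic_realizes[of a] by blast
  have "(\<lambda>L. - 1 * u L) \<in> kB P P" by (rule kB_scale) (use u(1) ideal_Ic_eq in blast)
  from kB_add[OF assms this] have "(\<lambda>L. a L - u L) \<in> kB P P" by simp
  then have "(\<lambda>L. a L - u L) \<in> ker_S1 P"
  proof (rule ker_S1I)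
    fix C g assume "C \<in> cyc_classes" "g \<in> carrier P"
    then show "act_op (\<lambda>L. a L - u L) (rep_char C) g = 0"
      using u(2)[OF perm_char_cf, of "rep C" g] cycD[of C] by (simp add: act_op_diff)
  qed
  with u(1) show ?thesis by blast
qed

text \<open>Some cyclic \<open>B\<close> pairs nontrivially with \<open>w\<close>, and then the
  elements built from \<open>C \<times> B\<close> send \<open>w\<close> to multiples of every basis
  function. This is simplicity of the module: each nonzero vector generates it.\<close>

lemma transitive:
  assumes w: "cyclic_cf (w :: 'a \<Rightarrow> 'k::field_char_0)" and g0: "g0 \<in> carrier P" "w g0 \<noteq> 0" and w': "cyclic_cf w'"
  shows "\<exists>s\<in>kB P P. \<forall>g\<in>carrier P. act_op s w g = w' g"
proof -
  obtain B where B: "B \<in> cyc_classes" "char_ip P (rep_char B) w \<noteq> 0" using cyclic_cf_nondegenerate[OF w _ g0(1)] g0(2) by blast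
  obtain r where r: "\<forall>g\<in>carrier P. w' g = (\<Sum>C\<in>cyc_classes. r C * rep_char C g)" using cyc_classes_span[OF w'] by blast
  let ?s = "\<lambda>L. \<Sum>C\<in>cyc_classes. (r C / char_ip P (rep_char B) w) * tr P P (rep C \<times> rep B) L"
  have "?s \<in> kB P P"
    using cycD B(1) by (intro kB_sum kB_scale PP.tr_in_kB PP.Times_subgroup) blast+
  moreover have "act_op ?s w g = w' g" if g: "g \<in> carrier P" for g
  proof -
    have "act_op ?s w g = (\<Sum>C\<in>cyc_classes. (r C / char_ip P (rep_char B) w) * (rep_char C g * char_ip P (rep_char B) w))"
      unfolding act_op_sum_left using g cycD B(1) by (intro sum.cong refl) (simp add: act_op_tr)
    also have "\<dots> = w' g" using r g B(2) by simp
    finally show ?thesis .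
  qed
  ultimately show ?thesis by blast
qed

text \<open>The quotient by the annihilator is a copy of the simple module generated by
  \<open>f\<close>; the proof spells this out with \<open>transitive\<close>.\<close>

lemma maximal_annihilator:
  fixes f :: "'a \<Rightarrow> 'k::field_char_0"
  assumes f: "cyclic_cf f" and g0: "g0 \<in> carrier P" "f g0 \<noteq> 0"
  shows "maximal_left_ideal P {x \<in> kB P P. \<forall>g\<in>carrier P. act_op x f g = 0}"
proof -
  let ?m = "{x \<in> kB P P. \<forall>g\<in>carrier P. act_op x f g = 0}"
  have "left_ideal P ?m"
    unfolding left_ideal_def
    by (auto simp: kB_zero kB_add kB_scale act_op_zero_left act_op_add act_op_scale act_op_bcomp act_op_zero PPP.bcomp_in_kB)
  moreover have "?m \<noteq> kB P P"
  proof -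
    obtain s where "s \<in> kB P P" "\<forall>g\<in>carrier P. act_op s f g = f g" using transitive[OF f g0 f] by blast
    then have "s \<notin> ?m" using g0 by auto
    then show ?thesis using \<open>s \<in> kB P P\<close> by blast
  qed
  moreover have "I' = ?m \<or> I' = kB P P" if I': "left_ideal P I'" "?m \<subseteq> I'" for I'
  proof (cases "I' = ?m")
    case False
    have sub: "I' \<subseteq> kB P P" using I'(1) unfolding left_ideal_def by blast
    obtain a where a: "a \<in> I'" "a \<notin> ?m" using False I'(2) by blast
    then obtain g1 where g1: "g1 \<in> carrier P" "act_op a f g1 \<noteq> 0" using sub by blast
    have "r \<in> I'" if r: "r \<in> kB P P" for r
    proof -
      \<comment> \<open>\<open>s\<close> sends \<open>a f\<close> to \<open>r f\<close>, so
        \<open>r - s a\<close> annihilates \<open>f\<close> and lies in \<open>I'\<close>, as does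
        \<open>s a\<close> itself.\<close>
      obtain s where s: "s \<in> kB P P" "\<forall>g\<in>carrier P. act_op s (act_op a f) g = act_op r f g"
        using transitive[OF act_op_cf[OF f] g1 act_op_cf[OF f]] by blast
      let ?sa = "bcomp P P P s a"
      have sa: "?sa \<in> I'" using I'(1) a(1) s(1) unfolding left_ideal_def by blast
      have "(\<lambda>L. r L + (- 1) * ?sa L) \<in> kB P P" using r PPP.bcomp_in_kB by (intro kB_add kB_scale)
      moreover have "act_op (\<lambda>L. r L + (- 1) * ?sa L) f g = 0" if "g \<in> carrier P" for g
        using s(2) that unfolding act_op_add act_op_scale by (simp add: act_op_bcomp)
      ultimately have "(\<lambda>L. r L + (- 1) * ?sa L) \<in> I'" using I'(2) by blast
      moreover have "(\<lambda>L. x L + y L) \<in> I'" if "x \<in> I'" "y \<in> I'" for x y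
        using I'(1) that unfolding left_ideal_def by blast
      from this[OF _ sa] have "(\<lambda>L. x L + ?sa L) \<in> I'" if "x \<in> I'" for x using that by blast
      ultimately have "(\<lambda>L. (r L + (- 1) * ?sa L) + ?sa L) \<in> I'" by meson
      then show ?thesis by simp
    qed
    then show ?thesis using sub by blast
  qed blast
  ultimately show ?thesis unfolding maximal_left_ideal_def by blast
qed

lemma jac_subset_ker_S1: "jac P \<subseteq> (ker_S1 P :: (_ \<Rightarrow> 'k::field_char_0) set)"
proof
  fix a :: "_ \<Rightarrow> 'k" assume a: "a \<in> jac P"
  then have kB: "a \<in> kB P P" unfolding jac_def by blast
  then show "a \<in> ker_S1 P"
  proof (rule ker_S1I)
    fix C g assume C: "C \<in> cyc_classes" and g: "g \<in> carrier P"
    have "cyclic_cf (rep_char C :: _ \<Rightarrow> 'k)" using perm_char_cf cycD[OF C] by blast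
    from maximal_annihilator[OF this gen(1)[OF C] rep_char_gen_nonzero[OF C]]
    show "act_op a (rep_char C) g = 0" using a g unfolding jac_def by blast
  qed
qed

section \<open>Nilpotence inside the product ideal\<close>

lemma bcomp_tr_ind:
  assumes "p \<in> class_pairs" "q \<in> class_pairs"
  shows "bcomp P P P (tr P P (rep_prod p)) (tr P P (rep_prod q)) =
    (\<lambda>M. char_ip P (rep_char (snd p)) (rep_char (fst q)) * (tr P P (rep_prod (fst p, snd q)) M :: 'k::field_char_0))"
  using assms rep_subgroup by (subst PPP.bcomp_tr_Times) (auto simp: mem_Times_iff)

text \<open>In the triple product the middle factor sits between two pairings. It contributes the
  pairing of some permutation character with the image under \<open>n\<close> of another one, and
  \<open>n\<close> annihilates permutation characters.\<close>

lemma cube_zero: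
  assumes n: "n \<in> ideal_I P" "n \<in> (ker_S1 P :: (_ \<Rightarrow> 'k::field_char_0) set)"
  shows "bcomp P P P n (bcomp P P P n n) = (\<lambda>_. 0)"
proof -
  define a where "a p = n (rep_prod p)" for p
  define \<beta> :: "'a set set \<Rightarrow> 'a set set \<Rightarrow> 'k" where "\<beta> C D = char_ip P (rep_char C) (rep_char D)" for C D
  have ex: "n = (\<lambda>M. \<Sum>p\<in>class_pairs. a p * tr P P (rep_prod p) M)" unfolding a_def by (rule I_expand[OF n(1)])
  have left: "bcomp P P P n (tr P P (rep_prod q)) = (\<lambda>M. \<Sum>p\<in>class_pairs. a p * (\<beta> (snd p) (fst q) * tr P P (rep_prod (fst p, snd q)) M))"
    if q: "q \<in> class_pairs" for q
  proof -
    have "bcomp P P P n (tr P P (rep_prod q)) = bcomp P P P (\<lambda>M. \<Sum>p\<in>class_pairs. a p * tr P P (rep_prod p) M) (tr P P (rep_prod q))"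
      by (rule arg_cong[OF ex])
    also have "\<dots> = (\<lambda>M. \<Sum>p\<in>class_pairs. a p * (\<beta> (snd p) (fst q) * tr P P (rep_prod (fst p, snd q)) M))"
      unfolding bcomp_sum_left \<beta>_def
      by (intro ext sum.cong refl arg_cong2[of _ _ _ _ "(*)"]) (simp add: bcomp_tr_ind[OF _ q])
    finally show ?thesis .
  qed
  have "bcomp P P P n n = bcomp P P P n (\<lambda>M. \<Sum>r\<in>class_pairs. a r * tr P P (rep_prod r) M)"
    by (rule arg_cong[OF ex])
  also have "\<dots> = (\<lambda>M. \<Sum>r\<in>class_pairs. a r * (\<Sum>q\<in>class_pairs. a q * (\<beta> (snd q) (fst r) * tr P P (rep_prod (fst q, snd r)) M)))"
    unfolding bcomp_sum_right
    by (intro ext sum.cong refl arg_cong2[of _ _ _ _ "(*)"]) (simp add: left)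
  also have "\<dots> = (\<lambda>M. \<Sum>x\<in>class_pairs\<times>class_pairs. (a (fst x) * a (snd x) * \<beta> (snd (snd x)) (fst (fst x))) *
      tr P P (rep_prod (fst (snd x), snd (fst x))) M)"
    by (simp add: sum.cartesian_product' sum_distrib_left mult.assoc)
  finally have nn: "bcomp P P P n n = \<dots>" .
  have "bcomp P P P n (bcomp P P P n n) M = 0" for M
  proof -
    have "bcomp P P P n (bcomp P P P n n) M = (\<Sum>x\<in>class_pairs\<times>class_pairs. (a (fst x) * a (snd x) * \<beta> (snd (snd x)) (fst (fst x))) *
      bcomp P P P n (tr P P (rep_prod (fst (snd x), snd (fst x)))) M)"
      unfolding nn bcomp_sum_right ..
    also have "\<dots> = (\<Sum>x\<in>class_pairs\<times>class_pairs. (a (fst x) * a (snd x) * \<beta> (snd (snd x)) (fst (fst x))) *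
      (\<Sum>p\<in>class_pairs. a p * (\<beta> (snd p) (fst (snd x)) * tr P P (rep_prod (fst p, snd (fst x))) M)))"
    proof (intro sum.cong refl arg_cong2[of _ _ _ _ "(*)"])
      fix x assume "x \<in> class_pairs \<times> class_pairs"
      then have "(fst (snd x), snd (fst x)) \<in> class_pairs" by (auto simp: mem_Times_iff)
      from left[OF this] show "bcomp P P P n (tr P P (rep_prod (fst (snd x), snd (fst x)))) M =
        (\<Sum>p\<in>class_pairs. a p * (\<beta> (snd p) (fst (snd x)) * tr P P (rep_prod (fst p, snd (fst x))) M))" by simp
    qed
    also have "\<dots> = (\<Sum>r\<in>class_pairs. \<Sum>q\<in>class_pairs. (a r * a q * \<beta> (snd q) (fst r)) *
      (\<Sum>p\<in>class_pairs. a p * (\<beta> (snd p) (fst q) * tr P P (rep_prod (fst p, snd r)) M)))"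
      by (simp only: sum.cartesian_product case_prod_unfold)
    \<comment> \<open>The sum over the middle index \<open>q\<close> is isolated; the outer basis
      element depends only on \<open>p\<close> and \<open>r\<close>.\<close>
    also have "\<dots> = (\<Sum>r\<in>class_pairs. \<Sum>p\<in>class_pairs. a r * a p * tr P P (rep_prod (fst p, snd r)) M *
        (\<Sum>q\<in>class_pairs. a q * (\<beta> (snd p) (fst q) * \<beta> (snd q) (fst r))))"
      by (rule sum.cong[OF refl], simp only: sum_distrib_left, subst sum.swap) (simp add: ac_simps)
    also have "\<dots> = 0"
    proof (intro sum.neutral ballI)
      fix r p assume r: "r \<in> class_pairs" and p: "p \<in> class_pairs"
      have s: "subgroup (rep (fst r)) P" using r rep_subgroup by (auto simp: mem_Times_iff)
      have "(\<Sum>q\<in>class_pairs. a q * (\<beta> (snd p) (fst q) * \<beta> (snd q) (fst r))) =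
        (\<Sum>q\<in>class_pairs. (a q * \<beta> (snd q) (fst r)) * char_ip P (rep_char (snd p)) (rep_char (fst q)))"
        unfolding \<beta>_def by (simp add: ac_simps)
      \<comment> \<open>Moved inside the pairing, the sum over \<open>q\<close> is \<open>n\<close>
        acting on \<open>rep_char (fst r)\<close>.\<close>
      also have "\<dots> = char_ip P (rep_char (snd p)) (\<lambda>h. \<Sum>q\<in>class_pairs. (a q * \<beta> (snd q) (fst r)) * rep_char (fst q) h)"
        by (rule char_ip_sum_right[symmetric])
      also have "\<dots> = char_ip P (rep_char (snd p)) (\<lambda>_. 0)"
      proof (rule char_ip_cong[OF refl])
        fix h assume h: "h \<in> carrier P"
        have "(\<Sum>q\<in>class_pairs. (a q * \<beta> (snd q) (fst r)) * rep_char (fst q) h) =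
          act_op (\<lambda>M. \<Sum>q\<in>class_pairs. a q * tr P P (rep_prod q) M) (rep_char (fst r)) h"
          unfolding act_op_sum_tr[OF subset_refl h] \<beta>_def by (simp add: ac_simps)
        also have "\<dots> = act_op n (rep_char (fst r)) h" by (rule arg_cong[where f = "\<lambda>x. act_op x (rep_char (fst r)) h", OF ex[symmetric]])
        also have "\<dots> = 0" by (rule ker_S1_T_zero[OF n(2) perm_char_cf[OF s] h])
        finally show "(\<Sum>q\<in>class_pairs. (a q * \<beta> (snd q) (fst r)) * rep_char (fst q) h) = 0" .
      qed
      also have "\<dots> = 0" by (simp add: char_ip_def)
      finally show "a r * a p * tr P P (rep_prod (fst p, snd r)) M *
        (\<Sum>q\<in>class_pairs. a q * (\<beta> (snd p) (fst q) * \<beta> (snd q) (fst r))) = 0" by simp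
    qed
    finally show ?thesis .
  qed
  then show ?thesis by (rule ext)
qed

text \<open>The intersection N is a left ideal. If a maximal left ideal \<open>m\<close> missed one
  of its elements, N + \<open>m\<close> would be everything and the identity would be
  \<open>x + y\<close> with \<open>x\<close> in N and \<open>y\<close> in \<open>m\<close>;
  nilpotence of \<open>x\<close> then drives the identity into \<open>m\<close>.\<close>

lemma I_ker_S1_subset_jac: "ideal_I P \<inter> ker_S1 P \<subseteq> (jac P :: (_ \<Rightarrow> 'k::field_char_0) set)"
proof -
  let ?N = "ideal_I P \<inter> ker_S1 P :: (_ \<Rightarrow> 'k) set"
  have "n \<in> m" if n: "n \<in> ?N" and m: "maximal_left_ideal P m" for n m
  proof (rule ccontr)
    assume "n \<notin> m"
    have lm: "left_ideal P m" using m unfolding maximal_left_ideal_def by blast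
    have m_kB: "m \<subseteq> kB P P" and m0: "(\<lambda>_. 0) \<in> m"
      and m_add: "\<And>x y. x \<in> m \<Longrightarrow> y \<in> m \<Longrightarrow> (\<lambda>L. x L + y L) \<in> m"
      and m_scale: "\<And>c x. x \<in> m \<Longrightarrow> (\<lambda>L. c * x L) \<in> m"
      and m_mult: "\<And>r x. r \<in> kB P P \<Longrightarrow> x \<in> m \<Longrightarrow> bcomp P P P r x \<in> m"
      using lm unfolding left_ideal_def by blast+
    have N_kB: "?N \<subseteq> kB P P" using ker_S1_subset by blast
    define I' where "I' = {z. \<exists>x\<in>?N. \<exists>y\<in>m. z = (\<lambda>L. x L + y L)}"
    have I'I: "(\<lambda>L. x L + y L) \<in> I'" if "x \<in> ?N" "y \<in> m" for x y using that unfolding I'_def by blast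
    have N0: "(\<lambda>_. 0) \<in> ?N" using I_zero ker_S1_zero by blast
    have "left_ideal P I'"
      unfolding left_ideal_def
    proof (intro conjI ballI allI)
      show "I' \<subseteq> kB P P" unfolding I'_def using N_kB m_kB kB_add by blast
      show "(\<lambda>_. 0) \<in> I'" using I'I[OF N0 m0] by simp
      fix z assume "z \<in> I'"
      then obtain x y where z: "x \<in> ?N" "y \<in> m" "z = (\<lambda>L. x L + y L)" unfolding I'_def by blast
      show "(\<lambda>L. c * z L) \<in> I'" for c
      proof -
        have "(\<lambda>L. c * x L) \<in> ?N" using z(1) I_scale ker_S1_scale by blast
        from I'I[OF this m_scale[OF z(2)]] show ?thesis using z(3) by (simp add: distrib_left)
      qed
      fix z' assume "z' \<in> I'"
      then obtain x' y' where z': "x' \<in> ?N" "y' \<in> m" "z' = (\<lambda>L. x' L + y' L)" unfolding I'_def by blast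
      have "(\<lambda>L. x L + x' L) \<in> ?N" using z(1) z'(1) I_add ker_S1_add by blast
      from I'I[OF this m_add[OF z(2) z'(2)]]
      show "(\<lambda>L. z L + z' L) \<in> I'" using z(3) z'(3) by (simp add: ac_simps)
    next
      fix r z :: "('a \<times> 'a) set \<Rightarrow> 'k" assume r: "r \<in> kB P P" and "z \<in> I'"
      then obtain x y where z: "x \<in> ?N" "y \<in> m" "z = (\<lambda>L. x L + y L)" unfolding I'_def by blast
      have "bcomp P P P r x \<in> ?N" using z(1) I_bcomp ker_S1_bcomp by blast
      from I'I[OF this m_mult[OF r z(2)]] show "bcomp P P P r z \<in> I'" unfolding z(3) bcomp_add_right .
    qed
    moreover have "m \<subseteq> I'" using I'I[OF N0] by auto
    moreover have "n \<in> I'" using I'I[OF n m0] by simp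
    ultimately have "I' = kB P P" using m \<open>n \<notin> m\<close> unfolding maximal_left_ideal_def by blast
    let ?e = "tr P P (diag P) :: _ \<Rightarrow> 'k"
    have e: "?e \<in> kB P P" using PP.tr_in_kB diag_subgroup by blast
    then obtain x y where xy: "x \<in> ?N" "y \<in> m" "?e = (\<lambda>L. x L + y L)" using \<open>I' = kB P P\<close> unfolding I'_def by blast
    have x_kB: "x \<in> kB P P" using xy N_kB by blast
    have y: "y = (\<lambda>L. ?e L - x L)" using fun_cong[OF xy(3)] by (simp add: algebra_simps)
    have 1: "bcomp P P P x y = (\<lambda>L. x L - bcomp P P P x x L)"
      unfolding y bcomp_diff_right PP.bcomp_diag[OF x_kB] ..
    have 2: "bcomp P P P x (bcomp P P P x y) = bcomp P P P x x"
      unfolding 1 bcomp_diff_right using cube_zero[of x] xy(1) by simp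
    \<comment> \<open>The geometric series for the inverse of \<open>e - x\<close>, applied to
      \<open>y = e - x\<close> by left multiplications so that each summand stays in
      \<open>m\<close>. The sum telescopes to \<open>e\<close>, as the leftover
      \<open>x (x x)\<close> vanishes by \<open>cube_zero\<close>.\<close>
    have "(\<lambda>L. y L + (bcomp P P P x y L + bcomp P P P x (bcomp P P P x y) L)) \<in> m"
      using xy(2) x_kB by (intro m_add m_mult)
    moreover have "(\<lambda>L. y L + (bcomp P P P x y L + bcomp P P P x (bcomp P P P x y) L)) = ?e"
      unfolding 2 unfolding 1 unfolding y by simp
    ultimately have "?e \<in> m" by simp
    then have "r \<in> m" if "r \<in> kB P P" for r using m_mult[OF that] PP.bcomp_diag[OF that] by metis
    then show False using m m_kB unfolding maximal_left_ideal_def by blast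
  qed
  then show ?thesis unfolding jac_def using ker_S1_subset by blast
qed

lemma I_jac_eq: "ideal_I P \<inter> jac P = ideal_I P \<inter> (ker_S1 P :: (_ \<Rightarrow> 'k::field_char_0) set)"
  using I_ker_S1_subset_jac jac_subset_ker_S1 by blast

section \<open>The two direct sums and the dimension\<close>

lemma direct_sum_kB: "is_direct_sum (kB P P :: (_ \<Rightarrow> 'k::field_char_0) set) (ideal_Ic P) (ker_S1 P)"
  unfolding is_direct_sum_def
proof
  have "(\<lambda>_. 0) \<in> (ideal_Ic P :: (_ \<Rightarrow> 'k) set)" unfolding ideal_Ic_def by (rule lin_span_zero)
  then show "ideal_Ic P \<inter> ker_S1 P = {\<lambda>_. 0 :: 'k}" using Ic_ker_zero ker_S1_zero by blast
  show "kB P P = {\<lambda>x. u x + w x :: 'k | u w. u \<in> ideal_Ic P \<and> w \<in> ker_S1 P}"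
  proof
    show "{\<lambda>x. u x + w x :: 'k | u w. u \<in> ideal_Ic P \<and> w \<in> ker_S1 P} \<subseteq> kB P P"
      using ideal_Ic_subset I_subset ker_S1_subset kB_add by blast
    show "kB P P \<subseteq> {\<lambda>x. u x + w x :: 'k | u w. u \<in> ideal_Ic P \<and> w \<in> ker_S1 P}"
    proof
      fix a :: "_ \<Rightarrow> 'k" assume "a \<in> kB P P"
      then obtain u where "u \<in> ideal_Ic P" "(\<lambda>L. a L - u L) \<in> ker_S1 P" using decompose by blast
      then show "a \<in> {\<lambda>x. u x + w x :: 'k | u w. u \<in> ideal_Ic P \<and> w \<in> ker_S1 P}"
        by (intro CollectI exI[of _ u] exI[of _ "\<lambda>L. a L - u L"]) simp
    qed
  qed
qed

lemma direct_sum_I: "is_direct_sum (ideal_I P :: (_ \<Rightarrow> 'k::field_char_0) set) (ideal_Ic P) (ideal_I P \<inter> jac P)"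
  unfolding is_direct_sum_def I_jac_eq
proof
  have "(\<lambda>_. 0) \<in> (ideal_Ic P :: (_ \<Rightarrow> 'k) set)" unfolding ideal_Ic_def by (rule lin_span_zero)
  then show "ideal_Ic P \<inter> (ideal_I P \<inter> ker_S1 P) = {\<lambda>_. 0 :: 'k}" using Ic_ker_zero ker_S1_zero I_zero by blast
  show "ideal_I P = {\<lambda>x. u x + w x :: 'k | u w. u \<in> ideal_Ic P \<and> w \<in> ideal_I P \<inter> ker_S1 P}"
  proof
    show "{\<lambda>x. u x + w x :: 'k | u w. u \<in> ideal_Ic P \<and> w \<in> ideal_I P \<inter> ker_S1 P} \<subseteq> ideal_I P"
      using ideal_Ic_subset I_add by blast
    show "ideal_I P \<subseteq> {\<lambda>x. u x + w x :: 'k | u w. u \<in> ideal_Ic P \<and> w \<in> ideal_I P \<inter> ker_S1 P}"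
    proof
      fix a :: "_ \<Rightarrow> 'k" assume a: "a \<in> ideal_I P"
      then obtain u where u: "u \<in> ideal_Ic P" "(\<lambda>L. a L - u L) \<in> ker_S1 P" using decompose I_subset by blast
      moreover have "(\<lambda>L. a L - u L) \<in> ideal_I P" using I_diff[OF a] u(1) ideal_Ic_subset by blast
      ultimately show "a \<in> {\<lambda>x. u x + w x :: 'k | u w. u \<in> ideal_Ic P \<and> w \<in> ideal_I P \<inter> ker_S1 P}"
        by (intro CollectI exI[of _ u] exI[of _ "\<lambda>L. a L - u L"]) simp
    qed
  qed
qed

lemma tr_ind_in_I: "p \<in> class_pairs \<Longrightarrow> tr P P (rep_prod p) \<in> (ideal_I P :: (_ \<Rightarrow> 'k::field_char_0) set)"
  unfolding ideal_I_def using rep_subgroup by (intro lin_span_incl) (auto simp: mem_Times_iff)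

lemma has_dim_I_jac: "has_dim (ideal_I P \<inter> jac P :: (_ \<Rightarrow> 'k::field_char_0) set) (num_b P ^ 2 - num_c P ^ 2)"
proof -
  let ?V = "ideal_I P \<inter> ker_S1 P :: (_ \<Rightarrow> 'k) set"
  define J where "J = class_pairs - cyc_classes \<times> cyc_classes"
  have finJ: "finite J" unfolding J_def using finite_SC2 by simp
  have "\<forall>p\<in>class_pairs. \<exists>u. u \<in> ideal_Ic P \<and> (\<lambda>L. tr P P (rep_prod p) L - u L :: 'k) \<in> ker_S1 P"
    using decompose tr_ind_in_I I_subset by blast
  from bchoice[OF this] obtain U
    where "\<forall>p\<in>class_pairs. U p \<in> ideal_Ic P \<and> (\<lambda>L. tr P P (rep_prod p) L - U p L :: 'k) \<in> ker_S1 P" ..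
  then have U: "U p \<in> ideal_Ic P" "(\<lambda>L. tr P P (rep_prod p) L - U p L :: 'k) \<in> ker_S1 P" if "p \<in> class_pairs" for p
    using that by (blast dest: bspec)+
  define e where "e p = (\<lambda>L. tr P P (rep_prod p) L - U p L)" for p
  have eV: "e p \<in> ?V" if "p \<in> J" for p
    using that U I_diff[OF tr_ind_in_I, of p "U p"] ideal_Ic_subset unfolding e_def J_def by blast
  \<comment> \<open>The correction \<open>U p\<close> is supported on products of cyclic subgroups
    and so leaves the coordinates indexed by \<open>J\<close> untouched. Independence and spanning
    are both read off from these coordinates.\<close>
  have delta: "e p (rep_prod q) = (if p = q then 1 else 0)" if pq: "p \<in> J" "q \<in> J" for p q
  proof -
    have q: "q \<in> class_pairs" "q \<notin> cyc_classes \<times> cyc_classes" and p: "p \<in> class_pairs" using pq unfolding J_def by auto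
    have "U p (rep_prod q) = 0" using U(1)[OF p] q prod_cyc_ind[OF q(1)] unfolding ideal_Ic_eq by blast
    moreover have "tr P P (rep_prod p) (rep_prod q) = (if p = q then 1 else (0::'k))"
      using tr_ind[OF p, of "rep (fst q)" "rep (snd q)"] q(1) rep_subgroup cls_rep by (auto simp: mem_Times_iff)
    ultimately show ?thesis unfolding e_def by simp
  qed
  have inj: "inj_on e J"
    using delta by (intro inj_onI) (metis zero_neq_one)
  have indep: "lin_indep (e ` J)"
    unfolding lin_indep_def
  proof (intro allI impI ballI, elim conjE)
    fix F c s assume F: "finite F" "F \<subseteq> e ` J" "(\<lambda>x. \<Sum>s\<in>F. c s * s x) = (\<lambda>_. 0)" and s: "s \<in> F"
    obtain p where p: "p \<in> J" "s = e p" using F(2) s by blast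
    have val: "s' (rep_prod p) = (if s' = s then 1 else 0)" if s': "s' \<in> F" for s'
    proof -
      obtain q where q: "q \<in> J" "s' = e q" using F(2) s' by blast
      then show ?thesis using delta[OF q(1) p(1)] p inj_onD[OF inj, of q p] by auto
    qed
    have "0 = (\<Sum>s'\<in>F. c s' * s' (rep_prod p))" using fun_cong[OF F(3), of "rep_prod p"] by simp
    also have "\<dots> = (\<Sum>s'\<in>F. if s' = s then c s' else 0)"
      by (intro sum.cong refl) (simp add: val)
    also have "\<dots> = c s" using F(1) s by (simp add: sum.delta)
    finally show "c s = 0" by simp
  qed
  have span: "lin_span (e ` J) = ?V"
  proof
    show "lin_span (e ` J) \<subseteq> ?V"
    proof (rule lin_span_subset)
      show "e ` J \<subseteq> ?V" using eV by blast
      show "(\<lambda>_. 0) \<in> ?V" using I_zero ker_S1_zero by blast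
      show "(\<lambda>x. f x + f' x) \<in> ?V" if "f \<in> ?V" "f' \<in> ?V" for f f'
        using that I_add ker_S1_add by blast
      show "(\<lambda>x. a * f x) \<in> ?V" if "f \<in> ?V" for a f
        using that I_scale ker_S1_scale by blast
    qed
    show "?V \<subseteq> lin_span (e ` J)"
    proof
      fix f assume f: "f \<in> ?V"
      let ?s = "\<lambda>L. \<Sum>p\<in>J. f (rep_prod p) * e p L"
      have s: "?s \<in> lin_span (e ` J)" by (rule lin_span_sum[of J "\<lambda>p. f (rep_prod p)" e]) blast
      then have sV: "?s \<in> ?V" using \<open>lin_span (e ` J) \<subseteq> ?V\<close> by blast
      \<comment> \<open>The coordinates of \<open>f\<close> on \<open>J\<close> are the only
        possible coefficients. The remainder vanishes there, so it is supported on products of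
        cyclic subgroups; being in the kernel too, it is zero by \<open>Ic_ker_zero\<close>.\<close>
      define d where "d = (\<lambda>L. f L - ?s L)"
      have dI: "d \<in> ideal_I P" unfolding d_def using I_diff f sV by blast
      have dk: "d \<in> ker_S1 P"
        using ker_S1_add[OF _ ker_S1_scale[of ?s "-1"], of f] f sV unfolding d_def by simp
      have dJ: "d (rep_prod q) = 0" if q: "q \<in> J" for q
      proof -
        have "?s (rep_prod q) = (\<Sum>p\<in>J. if p = q then f (rep_prod p) else 0)"
          using delta q by (intro sum.cong) auto
        then show ?thesis unfolding d_def using finJ q by (simp add: sum.delta)
      qed
      have "prod_cyc L" if L: "d L \<noteq> 0" for L
      proof -
        obtain A B where AB: "subgroup A P" "subgroup B P" "L = A \<times> B"
          using dI L unfolding ideal_I_eq prod_sg_def by blast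
        let ?q = "(cls P A, cls P B)"
        have q: "?q \<in> class_pairs" using cls_in_classes AB by simp
        have "sg_conj (P \<times>\<times> P) L (rep_prod ?q)"
          using sg_conj_Times_iff[OF is_group is_group, of A B "rep_prod ?q"] rep_cls[OF AB(1)] rep_cls[OF AB(2)] AB(3)
          by (metis fst_conv snd_conv)
        then have "d (rep_prod ?q) = d L"
          using PP.kB_conj[of d L] dI I_subset PP.Times_subgroup[OF AB(1,2)] AB(3) by blast
        then have "?q \<in> cyc_classes \<times> cyc_classes" using dJ[of ?q] L q unfolding J_def by auto
        then show ?thesis unfolding prod_cyc_def using cls_in_cyc_iff AB by blast
      qed
      then have "d \<in> ideal_Ic P" unfolding ideal_Ic_eq using dI I_subset by blast
      then have "d = (\<lambda>_. 0)" using Ic_ker_zero dk by blast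
      then have "f L = ?s L" for L using fun_cong[of d "\<lambda>_. 0" L] unfolding d_def by simp
      then have "f = ?s" by (rule ext)
      with s show "f \<in> lin_span (e ` J)" by (rule back_subst[of "\<lambda>g. g \<in> lin_span (e ` J)", OF _ sym])
    qed
  qed
  \<comment> \<open>The cyclic pairs are a subset of all pairs, so the subtraction of natural
    numbers does not truncate.\<close>
  have "card (e ` J) = num_b P ^ 2 - num_c P ^ 2"
    unfolding card_image[OF inj] unfolding J_def num_b_eq num_c_eq
    using card_Diff_subset[OF _ cyc2_subset] finite_cyc by (simp add: card_cartesian_product power2_eq_square)
  then show ?thesis unfolding has_dim_def I_jac_eq
    using finJ eV indep span by (intro exI[of _ "e ` J"]) auto
qed

end

theorem theorem10p2:
  fixes G :: "'a monoid"
  assumes "group G" and "finite (carrier G)"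
  shows "is_direct_sum (kB G G :: (('a \<times> 'a) set \<Rightarrow> 'k::field_char_0) set) (ideal_Ic G) (ker_S1 G)
       \<and> is_direct_sum (ideal_I G :: (('a \<times> 'a) set \<Rightarrow> 'k) set) (ideal_Ic G) (ideal_I G \<inter> jac G)
       \<and> has_dim (ideal_I G \<inter> jac G :: (('a \<times> 'a) set \<Rightarrow> 'k) set) (num_b G ^ 2 - num_c G ^ 2)"
proof -
  interpret double_burnside G
    using assms by (simp add: double_burnside_def fin_group_def fin_group_axioms_def)
  show ?thesis using direct_sum_kB direct_sum_I has_dim_I_jac by blast
qed

end
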